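(* Consider a Pólya urn that is tenable and balanced with balance constant $b>0$, with deterministic initial state $X_0$, and with $\lambda_1=b$. Suppose that $\mathbb E|\xi_{ij}|^p<\infty$ for all $i,j\in\{1,\dots,q\}$ and every $p\ge1$. (i) Assume that $\operatorname{Re}\lambda_2<\lambda_1/2$ and that, as $n\to\infty$, $$\frac{X_n-\mathbb E X_n}{\sqrt n}\overset{d}{\longrightarrow}N(0,\Sigma)$$ for some matrix $\Sigma$. Then this convergence holds with convergence of all moments. In particular, the covariance matrix satisfies $\operatorname{Cov}[X_n]/n\to\Sigma$. (ii) Assume that $\operatorname{Re}\lambda_2=\lambda_1/2$ and that, as $n\to\infty$, $$\frac{X_n-\mathbb E X_n}{\sqrt{n(\log n)^{2\nu_2+1}}}\overset{d}{\longrightarrow}N(0,\Sigma)$$ for some matrix $\Sigma$. Then this convergence holds with convergence of all moments. In particular, the covariance matrix satisfies $\operatorname{Cov}[X_n]/\bigl(n(\log n)^{2\nu_2+1}\bigr)\to\Sigma$.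
   Context: Pólya urn. Fix an integer $q\ge2$ (number of colours), activities $a_1,\dots,a_q\ge0$ (zero allowed), $a=(a_1,\dots,a_q)'$, and random vectors $\xi_i=(\xi_{i1},\dots,\xi_{iq})'$ in $\mathbb R^q$, $i=1,\dots,q$ (replacement vectors; entries real, possibly negative). The urn is a Markov process $X_n=(X_{n1},\dots,X_{nq})'\in[0,\infty)^q$, $n\ge0$, with deterministic initial state $X_0$. At each step $n+1\ge1$, a colour $I_{n+1}\in\{1,\dots,q\}$ is drawn which, conditionally on the past, equals $i$ with probability $a_iX_{ni}/\sum_j a_jX_{nj}$; given the past and $I_{n+1}=i$, the increment $\Delta X_n:=X_{n+1}-X_n$ has the same distribution as $\xi_i$ and is independent of the past. The urn is tenable if for every $n\ge0$, almost surely all $X_{ni}\ge0$ and $\sum_i a_iX_{ni}>0$. It is balanced if there is a constant $b>0$ with $\sum_j a_j\xi_{ij}=b$ a.s. for every $i$. Intensity matrix: $A$ is the $q\times q$ matrix with entries $(A)_{ij}=a_j\,\mathbb E\,\xi_{ji}$. Its set of eigenvalues is $\sigma(A)$. For $\lambda\in\sigma(A)$, $\nu_\lambda\ge0$ is the integer such that the largest Jordan block of $A$ with eigenvalue $\lambda$ has size $\nu_\lambda+1$. The eigenvalues, repeated according to algebraic multiplicity, are listed as $\lambda_1,\dots,\lambda_q$ in order of decreasing real part and, among those with equal real parts, in order of decreasing $\nu_j:=\nu_{\lambda_j}$. In a balanced urn $b$ is always an eigenvalue of $A$ (with left eigenvector $a'$); the hypothesis $\lambda_1=b$ says that $b$ can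 be taken as the first eigenvalue in this list. $N(0,\Sigma)$ is the (possibly degenerate) centred normal distribution in $\mathbb R^q$ with covariance matrix $\Sigma$. For random vectors $Z_n\overset{d}{\to}Z$ in $\mathbb R^q$, "convergence of all moments" means convergence of all ordinary (mixed) and absolute moments: $\mathbb E\prod_i Z_{ni}^{k_i}\to\mathbb E\prod_i Z_i^{k_i}$ for all integers $k_1,\dots,k_q\ge0$, and $\mathbb E|Z_n|^r\to\mathbb E|Z|^r$ for every real $r>0$, where $|\cdot|$ is the Euclidean norm. *)

theory Defs
  imports "HOL-Probability.Probability" "Jordan_Normal_Form.Jordan_Normal_Form_Uniqueness"
begin

no_notation Matrix.vec_index (infixl "$" 100)

text \<open>The colours are the elements of a finite type \<open>'q\<close>, so \<open>CARD('q)\<close> is their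
  number and the state space is \<open>real^'q\<close>.  The random replacement vectors \<open>xi i\<close> live on
  a probability space \<open>N\<close> of their own; only their individual laws matter.

  \<open>F n\<close> is the past up to time \<open>n\<close>: any filtration to which the process and the drawn
  colours are adapted, for instance the one they generate.  Conditional probabilities are
  conditional expectations of indicators.  The assumption \<open>increment\<close> says that, conditionally
  on the past and on \<open>I (Suc n) = i\<close>, the increment is distributed as \<open>xi i\<close> and
  independent of the past.\<close>

locale polya_urn =
  M: prob_space M + N: prob_space N + filtration "space M" F
  for M :: "'w measure" and N :: "'v measure" and F :: "nat \<Rightarrow> 'w measure" +
  fixes a :: "real^'q"
    and xi :: "'q \<Rightarrow> 'v \<Rightarrow> real^'q"
    and x0 :: "real^'q"
    and X :: "nat \<Rightarrow> 'w \<Rightarrow> real^'q"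
    and I :: "nat \<Rightarrow> 'w \<Rightarrow> 'q"
  assumes colours: "CARD('q) \<ge> 2"
    and activity_nonneg: "\<And>i. 0 \<le> a $ i"
    and xi_measurable: "\<And>i. xi i \<in> borel_measurable N"
    and past_subalgebra: "\<And>n. subalgebra M (F n)"
    and X_adapted: "\<And>n. X n \<in> borel_measurable (F n)"
    and I_adapted: "\<And>n. I (Suc n) \<in> measurable (F (Suc n)) (count_space UNIV)"
    and initial: "AE w in M. X 0 w = x0"
    and draw: "\<And>n i. AE w in M.
      real_cond_exp M (F n) (indicat_real {w \<in> space M. I (Suc n) w = i}) w
        = a $ i * X n w $ i / (\<Sum>j\<in>UNIV. a $ j * X n w $ j)"
    and increment: "\<And>n i B. B \<in> sets borel \<Longrightarrow> AE w in M.
      real_cond_exp M (F n)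
          (indicat_real {w \<in> space M. I (Suc n) w = i \<and> X (Suc n) w - X n w \<in> B}) w
        = real_cond_exp M (F n) (indicat_real {w \<in> space M. I (Suc n) w = i}) w
            * measure N {v \<in> space N. xi i v \<in> B}"

definition tenable :: "'w measure \<Rightarrow> real^'q \<Rightarrow> (nat \<Rightarrow> 'w \<Rightarrow> real^'q) \<Rightarrow> bool" where
  "tenable M a X \<longleftrightarrow>
     (\<forall>n. AE w in M. (\<forall>i. 0 \<le> X n w $ i) \<and> 0 < (\<Sum>i\<in>UNIV. a $ i * X n w $ i))"

definition balanced ::
  "'v measure \<Rightarrow> real^'q \<Rightarrow> ('q \<Rightarrow> 'v \<Rightarrow> real^'q) \<Rightarrow> real \<Rightarrow> bool" where
  "balanced N a xi b \<longleftrightarrow> 0 < b \<and> (\<forall>i. AE v in N. (\<Sum>j\<in>UNIV. a $ j * xi i v $ j) = b)"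

definition intensity_matrix ::
  "'v measure \<Rightarrow> real^'q \<Rightarrow> ('q \<Rightarrow> 'v \<Rightarrow> real^'q) \<Rightarrow> real^'q^'q" where
  "intensity_matrix N a xi = (\<chi> i j. a $ j * (\<integral>v. xi j v $ i \<partial>N))"

text \<open>A copy of a real matrix indexed by a finite type in the matrix type for which Jordan
  normal forms are available.  Rows and columns are enumerated by the same bijection
  \<open>from_nat_into UNIV\<close> between \<open>{..<CARD('q)}\<close> and \<open>'q\<close>; another enumeration
  would give a similar matrix.\<close>

definition complex_mat_of :: "real^'q^'q \<Rightarrow> complex mat" where
  "complex_mat_of A = Matrix.mat CARD('q) CARD('q)
     (\<lambda>(i, j). complex_of_real (A $ from_nat_into UNIV i $ from_nat_into UNIV j))"

text \<open>The largest Jordan block of \<open>A\<close> with eigenvalue \<open>l\<close> has size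
  \<open>jordan_nu A l + 1\<close>.  Jordan normal forms of \<open>A\<close> differ only in the order of the
  blocks, so taking the maximum over all of them is the same as fixing one.\<close>

definition jordan_nu :: "complex mat \<Rightarrow> complex \<Rightarrow> nat" where
  "jordan_nu A l = Max {k. \<exists>bs. jordan_nf A bs \<and> (k, l) \<in> set bs} - 1"

lemma Suc_jordan_nu:
  assumes bs: "jordan_nf A bs" and l: "l \<in> snd ` set bs"
  shows "Suc (jordan_nu A l) = Max {k. (k, l) \<in> set bs}"
proof -
  have eq: "{k. \<exists>bs. jordan_nf A bs \<and> (k, l) \<in> set bs} = {k. (k, l) \<in> set bs}"
    using bs jordan_nf_unique[OF bs] by blast
  have "{k. (k, l) \<in> set bs} \<subseteq> fst ` set bs" by force
  then have fin: "finite {k. (k, l) \<in> set bs}" by (rule finite_subset) simp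
  have ne: "{k. (k, l) \<in> set bs} \<noteq> {}" using l by auto
  have "Max {k. (k, l) \<in> set bs} \<in> {k. (k, l) \<in> set bs}" by (rule Max_in[OF fin ne])
  moreover have "0 \<notin> fst ` set bs" using bs by (simp add: jordan_nf_def)
  ultimately have "Max {k. (k, l) \<in> set bs} \<noteq> 0" by force
  then show ?thesis unfolding jordan_nu_def eq by simp
qed

text \<open>\<open>ls\<close> lists the eigenvalues of \<open>A\<close>, each as often as its algebraic multiplicity,
  in order of decreasing real part and, for equal real parts, decreasing \<open>jordan_nu\<close>.\<close>

definition eigenvalue_listing :: "complex mat \<Rightarrow> complex list \<Rightarrow> bool" where
  "eigenvalue_listing A ls \<longleftrightarrow>
     mset ls = proots (char_poly A) \<and>
     sorted_wrt (\<lambda>x y. Re y < Re x \<or> Re y = Re x \<and> jordan_nu A y \<le> jordan_nu A x) ls"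

definition cov_matrix :: "'w measure \<Rightarrow> ('w \<Rightarrow> real^'q) \<Rightarrow> real^'q^'q" where
  "cov_matrix M Z = (\<chi> i j. \<integral>w. (Z w $ i - (\<integral>w. Z w $ i \<partial>M)) * (Z w $ j - (\<integral>w. Z w $ j \<partial>M)) \<partial>M)"

text \<open>The normal law on the line with mean 0 and standard deviation \<open>s\<close>, a point mass when
  \<open>s = 0\<close>.\<close>

definition normal_law :: "real \<Rightarrow> real measure" where
  "normal_law s = (if s = 0 then return borel 0 else density lborel (normal_density 0 s))"

text \<open>\<open>mu\<close> is the possibly degenerate normal law with mean 0 and covariance matrix \<open>S\<close>:
  all linear functionals are centred normal.\<close>

definition centred_normal :: "real^'q^'q \<Rightarrow> (real^'q) measure \<Rightarrow> bool" where
  "centred_normal S mu \<longleftrightarrow>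
     prob_space mu \<and> sets mu = sets borel \<and>
     (\<forall>u. \<exists>s\<ge>0. distr mu borel (\<lambda>x. u \<bullet> x) = normal_law s) \<and>
     cov_matrix mu (\<lambda>x. x) = S"

definition converges_in_distribution ::
  "'w measure \<Rightarrow> (nat \<Rightarrow> 'w \<Rightarrow> real^'q) \<Rightarrow> (real^'q) measure \<Rightarrow> bool" where
  "converges_in_distribution M Z mu \<longleftrightarrow>
     (\<forall>f :: real^'q \<Rightarrow> real. continuous_on UNIV f \<longrightarrow> bounded (range f) \<longrightarrow>
        (\<lambda>n. \<integral>w. f (Z n w) \<partial>M) \<longlonglongrightarrow> (\<integral>x. f x \<partial>mu))"

text \<open>Integrability is required explicitly because the Bochner integral of a non-integrable
  function is 0 by convention.\<close>

definition expectations_converge ::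
  "'w measure \<Rightarrow> (nat \<Rightarrow> 'w \<Rightarrow> real^'q) \<Rightarrow> (real^'q) measure \<Rightarrow> (real^'q \<Rightarrow> real) \<Rightarrow> bool" where
  "expectations_converge M Z mu f \<longleftrightarrow>
     (\<forall>n. integrable M (\<lambda>w. f (Z n w))) \<and> integrable mu f \<and>
     (\<lambda>n. \<integral>w. f (Z n w) \<partial>M) \<longlonglongrightarrow> (\<integral>x. f x \<partial>mu)"

definition all_moments_converge ::
  "'w measure \<Rightarrow> (nat \<Rightarrow> 'w \<Rightarrow> real^'q) \<Rightarrow> (real^'q) measure \<Rightarrow> bool" where
  "all_moments_converge M Z mu \<longleftrightarrow>
     (\<forall>k :: 'q \<Rightarrow> nat. expectations_converge M Z mu (\<lambda>x. \<Prod>i\<in>UNIV. (x $ i) ^ k i)) \<and>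
     (\<forall>r>0. expectations_converge M Z mu (\<lambda>x. norm x powr r))"

end

(*
  After centring, Y n = X n - E (X n) satisfies Y (n+1) = (1 + B / s n) Y n + noise, where B is the
  intensity matrix and s n = a . X n = a . x0 + n b is deterministic.  The noise is a martingale
  difference with uniformly bounded conditional moments.  Linear functionals U given by the rows of
  the base change to Jordan normal form turn this into scalar recursions: U o B = l U + U', with U'
  the next functional of the same Jordan chain.  By induction along the chains these recursions bound
  the moments of U (Y n) of order 2k by constant multiples of g n ^ k, where g n = n if
  Re l < b / 2 and g n = n (ln n)^(2 j + 1) if Re l = b / 2 and U is at position j of its chain.
  The functional belonging to the simple eigenvalue b is a multiple of a, and a . Y n = 0.
  Hence all moments of the normalised variables stay bounded, which gives uniform integrability
  and so upgrades convergence in distribution to convergence of moments.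
*)
theory Submission
  imports Defs "Jordan_Normal_Form.Jordan_Normal_Form_Existence"
begin

no_notation scalar_prod (infix "\<bullet>" 70)

section \<open>Linear functionals adapted to the Jordan normal form\<close>

text \<open>The noise does not shrink with \<open>n\<close>, so Minkowski's inequality applied to
  whole increments would only give \<open>L^p\<close> norms growing linearly in \<open>n\<close>.
  The order \<open>sqrt n\<close> comes from cancellation at every even exponent: when
  \<open>norm (w + e) ^ (2 * k)\<close> is expanded with its first-order term kept exact, that term
  has mean zero, and the noise adds only a constant to the square of the \<open>L^(2k)\<close> norm,
  just as for variances. Minkowski serves only for the predictable part, and all orders obey one
  recursion \<open>w(n+1)^2 \<le> (norm (1 + l / s n) * w(n) + u(n) / s n)^2 + c\<close>, where
  \<open>u\<close> bounds the next functional. The constant \<open>K\<close> in front of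
  \<open>g n\<close> must survive every step unchanged. The slack is linear in \<open>K\<close>, the
  cross term with the next functional only of order \<open>sqrt K\<close>, so a large
  \<open>K\<close> closes the induction. If \<open>Re l < b / 2\<close>, the slack is a fixed
  multiple of \<open>K\<close>. If \<open>Re l = b / 2\<close>, it comes only from the growth of the
  logarithm, and matching it with the cross term costs two powers of the logarithm per
  position.\<close>

text \<open>\<open>pos i\<close> counts the rows below row \<open>i\<close> in its Jordan block.
  Counting from the end of the block fits the recursion, which refers row \<open>i\<close> to row
  \<open>Suc i\<close>: later inductions start at \<open>pos i = 0\<close>, where no superdiagonal
  entry occurs.\<close>

lemma jordan_matrix_rows:
  fixes bs :: "(nat \<times> complex) list"
  defines "n \<equiv> sum_list (map fst bs)"
  shows "\<exists>ev pos. \<forall>i<n. (\<exists>k. (k, ev i) \<in> set bs \<and> pos i < k) \<and>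
    (\<forall>j<n. jordan_matrix bs $$ (i, j) =
       (if j = i then ev i else if pos i \<noteq> 0 \<and> j = Suc i then 1 else 0)) \<and>
    (pos i \<noteq> 0 \<longrightarrow> Suc i < n \<and> pos (Suc i) = pos i - 1 \<and> ev (Suc i) = ev i)"
  unfolding n_def
proof (induction bs)
  case Nil
  then show ?case by simp
next
  case (Cons bk bs)
  obtain m l where bk: "bk = (m, l)" by (cases bk)
  define n where "n = sum_list (map fst bs)"
  from Cons obtain ev pos where rows: "\<forall>i<n. (\<exists>k. (k, ev i) \<in> set bs \<and> pos i < k) \<and>
    (\<forall>j<n. jordan_matrix bs $$ (i, j) =
       (if j = i then ev i else if pos i \<noteq> 0 \<and> j = Suc i then 1 else 0)) \<and>
    (pos i \<noteq> 0 \<longrightarrow> Suc i < n \<and> pos (Suc i) = pos i - 1 \<and> ev (Suc i) = ev i)"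
    unfolding n_def by (elim exE)
  from rows have
    mem: "\<And>i. i < n \<Longrightarrow> \<exists>k. (k, ev i) \<in> set bs \<and> pos i < k" and
    ent: "\<And>i j. i < n \<Longrightarrow> j < n \<Longrightarrow> jordan_matrix bs $$ (i, j) =
       (if j = i then ev i else if pos i \<noteq> 0 \<and> j = Suc i then 1 else 0)" and
    link: "\<And>i. i < n \<Longrightarrow> pos i \<noteq> 0 \<Longrightarrow> Suc i < n \<and> pos (Suc i) = pos i - 1 \<and> ev (Suc i) = ev i"
    by blast+
  define ev' where "ev' i = (if i < m then l else ev (i - m))" for i
  define pos' where "pos' i = (if i < m then m - 1 - i else pos (i - m))" for i
  have ent': "jordan_matrix (bk # bs) $$ (i, j) =
       (if j = i then ev' i else if pos' i \<noteq> 0 \<and> j = Suc i then 1 else 0)"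
    if "i < m + n" "j < m + n" for i j
  proof -
    have d: "dim_row (jordan_matrix bs) = n" "dim_col (jordan_matrix bs) = n"
      by (simp_all add: n_def)
    have db: "dim_row (jordan_block m l) = m" "dim_col (jordan_block m l) = m"
      using jordan_block_carrier[of m l] by auto
    have "jordan_matrix (bk # bs) $$ (i, j) =
      (if i < m then if j < m then jordan_block m l $$ (i, j) else 0
       else if j < m then 0 else jordan_matrix bs $$ (i - m, j - m))"
      unfolding bk jordan_matrix_Cons using that
      by (subst index_mat_four_block) (auto simp: d db n_def)
    then show ?thesis
      using that ent[of "i - m" "j - m"] link[of "i - m"]
      by (auto simp: ev'_def pos'_def jordan_block_index)
  qed
  have mem': "\<exists>k. (k, ev' i) \<in> set (bk # bs) \<and> pos' i < k" if "i < m + n" for i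
  proof (cases "i < m")
    case True
    then show ?thesis by (auto simp: ev'_def pos'_def bk)
  next
    case False
    then have "i - m < n" using that by simp
    from mem[OF this] show ?thesis using False by (auto simp: ev'_def pos'_def)
  qed
  have link': "Suc i < m + n \<and> pos' (Suc i) = pos' i - 1 \<and> ev' (Suc i) = ev' i"
    if "i < m + n" "pos' i \<noteq> 0" for i
  proof (cases "i < m")
    case True
    then show ?thesis using that by (auto simp: ev'_def pos'_def)
  next
    case False
    then have im: "i - m < n" "Suc i - m = Suc (i - m)" using that by auto
    then show ?thesis using False that link[OF im(1)] by (auto simp: ev'_def pos'_def)
  qed
  have "sum_list (map fst (bk # bs)) = m + n" by (simp add: bk n_def)
  then show ?case using mem' ent' link' by (intro exI[of _ ev'] exI[of _ pos']) auto
qed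

text \<open>In \<open>A = P * J * Q\<close> the rows of \<open>Q\<close> are generalised left
  eigenvectors and serve as the functionals \<open>U i\<close>. The columns of \<open>P\<close>
  recover a vector from its values under them, whence the norm bound. A left eigenvector
  \<open>a\<close> of \<open>B\<close> becomes the left eigenvector \<open>a' P\<close> of
  \<open>J\<close>; the \<open>c i\<close> are its entries.\<close>

lemma jordan_functionals:
  fixes B :: "real^'q^'q"
  defines "n \<equiv> CARD('q)" and "A \<equiv> complex_mat_of B"
  obtains U :: "nat \<Rightarrow> real^'q \<Rightarrow> complex" and ev :: "nat \<Rightarrow> complex" and pos :: "nat \<Rightarrow> nat"
  where "\<And>i. linear (U i)"
    and "\<And>i x. i < n \<Longrightarrow> U i (B *v x) = ev i * U i x + (if pos i \<noteq> 0 then U (Suc i) x else 0)"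
    and "\<And>i. i < n \<Longrightarrow> pos i \<noteq> 0 \<Longrightarrow> Suc i < n \<and> pos (Suc i) = pos i - 1 \<and> ev (Suc i) = ev i"
    and "\<And>i. i < n \<Longrightarrow> pos i \<le> jordan_nu A (ev i)"
    and "proots (char_poly A) = mset (map ev [0..<n])"
    and "\<exists>C. \<forall>x. norm x \<le> C * (\<Sum>i<n. norm (U i x))"
    and "\<And>(a::real^'q) b. (\<And>x. a \<bullet> (B *v x) = b * (a \<bullet> x)) \<Longrightarrow>
      \<exists>c. (\<forall>x. complex_of_real (a \<bullet> x) = (\<Sum>i<n. c i * U i x)) \<and>
          (\<forall>i<n. c i * ev i + (if 0 < i \<and> pos (i - 1) \<noteq> 0 then c (i - 1) else 0) = of_real b * c i)"
proof -
  define e :: "nat \<Rightarrow> 'q" where "e = from_nat_into UNIV"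
  have bij: "bij_betw e {..<n} UNIV"
    unfolding e_def n_def by (rule bij_betw_from_nat_into_finite) simp
  have sum_e: "(\<Sum>k\<in>UNIV. h k) = (\<Sum>j<n. h (e j))" for h :: "'q \<Rightarrow> 'b::comm_monoid_add"
    using sum.reindex_bij_betw[OF bij, of h] by simp
  have A: "A \<in> carrier_mat n n" by (simp add: A_def complex_mat_of_def n_def)
  have Aij: "A $$ (i, j) = of_real (B $ e i $ e j)" if "i < n" "j < n" for i j
    using that by (simp add: A_def complex_mat_of_def n_def e_def)
  from char_poly_factorized[OF A] obtain as where "char_poly A = (\<Prod>a\<leftarrow>as. [:- a, 1:])" by blast
  from jordan_nf_exists[OF A this] obtain bs where jnf: "jordan_nf A bs" by blast
  define J where "J = jordan_matrix bs"
  from jnf have sim: "similar_mat A J" by (simp add: jordan_nf_def J_def)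
  from similar_matD[OF sim] obtain n' P Q where
    "{A, J, P, Q} \<subseteq> carrier_mat n' n'" "P * Q = 1\<^sub>m n'" "Q * P = 1\<^sub>m n'" "A = P * J * Q" by blast
  moreover then have "n' = n" using A by auto
  ultimately have J: "J \<in> carrier_mat n n" and P: "P \<in> carrier_mat n n" and Q: "Q \<in> carrier_mat n n"
    and PQ: "P * Q = 1\<^sub>m n" and QP: "Q * P = 1\<^sub>m n" and APJQ: "A = P * J * Q" by auto
  have nbs: "n = sum_list (map fst bs)" using J by (auto simp: J_def)
  from jordan_matrix_rows[of bs] obtain ev pos where
    rows: "\<forall>i<n. (\<exists>k. (k, ev i) \<in> set bs \<and> pos i < k) \<and>
    (\<forall>j<n. J $$ (i, j) =
       (if j = i then ev i else if pos i \<noteq> 0 \<and> j = Suc i then 1 else 0)) \<and>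
    (pos i \<noteq> 0 \<longrightarrow> Suc i < n \<and> pos (Suc i) = pos i - 1 \<and> ev (Suc i) = ev i)"
    unfolding nbs[symmetric] J_def by (elim exE)
  from rows have
    mem: "\<And>i. i < n \<Longrightarrow> \<exists>k. (k, ev i) \<in> set bs \<and> pos i < k" and
    ent: "\<And>i j. i < n \<Longrightarrow> j < n \<Longrightarrow> J $$ (i, j) =
       (if j = i then ev i else if pos i \<noteq> 0 \<and> j = Suc i then 1 else 0)" and
    link: "\<And>i. i < n \<Longrightarrow> pos i \<noteq> 0 \<Longrightarrow> Suc i < n \<and> pos (Suc i) = pos i - 1 \<and> ev (Suc i) = ev i"
    by blast+
  \<comment> \<open>This identity describes the action of \<open>B\<close> on the functionals; its
    counterpart \<open>AP\<close> carries left eigenvectors of \<open>A\<close> over to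
    \<open>J\<close>.\<close>
  have QA: "Q * A = J * Q"
  proof -
    have "Q * A = (Q * P) * (J * Q)" using P J Q APJQ by (simp add: assoc_mult_mat[of _ n n _ n _ n])
    then show ?thesis using QP J Q by simp
  qed
  have AP: "A * P = P * J"
  proof -
    have "A * P = (P * J) * (Q * P)" using P J Q APJQ by (simp add: assoc_mult_mat[of _ n n _ n _ n])
    then show ?thesis using QP J P by simp
  qed
  define cv where "cv x = vec n (\<lambda>j. complex_of_real (x $ e j))" for x :: "real^'q"
  have cv: "cv x \<in> carrier_vec n" for x by (simp add: cv_def)
  have cvB: "cv (B *v x) = A *\<^sub>v cv x" for x
  proof (rule eq_vecI)
    fix i assume "i < dim_vec (A *\<^sub>v cv x)"
    then have i: "i < n" using A by simp
    show "vec_index (cv (B *v x)) i = vec_index (A *\<^sub>v cv x) i"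
      using i A by (simp add: cv_def scalar_prod_def matrix_vector_mult_def Aij sum_e atLeast0LessThan)
  qed (use A in \<open>simp add: cv_def\<close>)
  define U where "U i x = (\<Sum>j<n. Q $$ (i, j) * of_real (x $ e j))" for i x
  have U: "U i x = vec_index (Q *\<^sub>v cv x) i" if "i < n" for i x
    using that Q by (simp add: U_def cv_def scalar_prod_def atLeast0LessThan)
  have lin: "linear (U i)" for i
    by (intro linearI)
      (simp_all add: U_def sum.distrib distrib_left sum_distrib_left
        scaleR_conv_of_real[where 'a = complex] mult.left_commute)
  have rep: "complex_of_real (x $ e j) = (\<Sum>i<n. P $$ (j, i) * U i x)" if j: "j < n" for x j
  proof -
    have "cv x = P *\<^sub>v (Q *\<^sub>v cv x)"
      using cv P Q PQ by (metis assoc_mult_mat_vec one_mult_mat_vec)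
    then have "vec_index (cv x) j = vec_index (P *\<^sub>v (Q *\<^sub>v cv x)) j" by simp
    also have "\<dots> = (\<Sum>i<n. P $$ (j, i) * vec_index (Q *\<^sub>v cv x) i)"
      using j P Q by (simp add: scalar_prod_def atLeast0LessThan)
    finally show ?thesis using j by (simp add: cv_def U)
  qed
  have UB: "U i (B *v x) = ev i * U i x + (if pos i \<noteq> 0 then U (Suc i) x else 0)" if i: "i < n" for i x
  proof -
    have "U i (B *v x) = vec_index (Q *\<^sub>v (A *\<^sub>v cv x)) i" by (simp add: U i cvB)
    also have "Q *\<^sub>v (A *\<^sub>v cv x) = J *\<^sub>v (Q *\<^sub>v cv x)"
      using A J Q cv QA by (metis assoc_mult_mat_vec)
    also have "vec_index \<dots> i = (\<Sum>j<n. J $$ (i, j) * vec_index (Q *\<^sub>v cv x) j)"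
      using i J Q by (simp add: scalar_prod_def atLeast0LessThan)
    also have "\<dots> = (\<Sum>j<n. (if j = i then ev i * U i x else 0) +
        (if j = Suc i then if pos i \<noteq> 0 then U (Suc i) x else 0 else 0))"
      using i by (intro sum.cong) (auto simp: ent U)
    also have "\<dots> = ev i * U i x + (if pos i \<noteq> 0 then U (Suc i) x else 0)"
      using i link[OF i] by (simp add: sum.distrib)
    finally show ?thesis .
  qed
  have nu: "pos i \<le> jordan_nu A (ev i)" if i: "i < n" for i
  proof -
    from mem[OF i] obtain k where k: "(k, ev i) \<in> set bs" "pos i < k" by blast
    have "{k. (k, ev i) \<in> set bs} \<subseteq> fst ` set bs" by force
    then have "finite {k. (k, ev i) \<in> set bs}" by (rule finite_subset) simp
    then have "k \<le> Max {k. (k, ev i) \<in> set bs}" using k by (intro Max_ge) auto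
    also have "\<dots> = Suc (jordan_nu A (ev i))" using k by (intro Suc_jordan_nu[OF jnf, symmetric]) force
    finally show ?thesis using k by simp
  qed
  have roots: "proots (char_poly A) = mset (map ev [0..<n])"
  proof -
    have ut: "upper_triangular J" using J by (intro upper_triangularI) (auto simp: ent)
    have dg: "diag_mat J = map ev [0..<n]" using J by (auto simp: diag_mat_def ent)
    have "char_poly A = (\<Prod>a\<leftarrow>map ev [0..<n]. [:- a, 1:])"
      using char_poly_similar[OF sim] char_poly_upper_triangular[OF J ut] dg by simp
    moreover have "proots (\<Prod>a\<leftarrow>as. [:- a, 1:]) = mset as" for as :: "complex list"
    proof (induction as)
      case (Cons x as)
      have "(\<Prod>a\<leftarrow>as. [:- a, 1:]) \<noteq> 0" by (auto simp: prod_list_zero_iff)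
      then show ?case using Cons by (simp add: proots_mult del: mult_pCons_left)
    qed simp
    ultimately show ?thesis by metis
  qed
  define C where "C = (\<Sum>j<n. \<Sum>i<n. norm (P $$ (j, i)))"
  have nb: "norm x \<le> C * (\<Sum>i<n. norm (U i x))" for x
  proof -
    have "norm x \<le> (\<Sum>k\<in>UNIV. \<bar>x $ k\<bar>)" by (rule norm_le_l1_cart)
    also have "\<dots> = (\<Sum>j<n. \<bar>x $ e j\<bar>)" by (rule sum_e)
    also have "\<dots> = (\<Sum>j<n. norm (\<Sum>i<n. P $$ (j, i) * U i x))"
      by (intro sum.cong refl) (simp add: rep[symmetric])
    also have "\<dots> \<le> (\<Sum>j<n. \<Sum>i<n. norm (P $$ (j, i)) * (\<Sum>k<n. norm (U k x)))"
    proof (intro sum_mono order_trans[OF norm_sum])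
      fix i j assume "i \<in> {..<n}"
      then have "norm (U i x) \<le> (\<Sum>k<n. norm (U k x))" by (intro member_le_sum) auto
      then show "norm (P $$ (j, i) * U i x) \<le> norm (P $$ (j, i)) * (\<Sum>k<n. norm (U k x))"
        by (simp add: norm_mult mult_left_mono)
    qed
    also have "\<dots> = C * (\<Sum>k<n. norm (U k x))"
      by (simp add: C_def sum_distrib_right)
    finally show ?thesis .
  qed
  have left: "\<exists>c. (\<forall>x. complex_of_real (a \<bullet> x) = (\<Sum>i<n. c i * U i x)) \<and>
      (\<forall>i<n. c i * ev i + (if 0 < i \<and> pos (i - 1) \<noteq> 0 then c (i - 1) else 0) = of_real b * c i)"
    if a: "\<And>x. a \<bullet> (B *v x) = b * (a \<bullet> x)" for a :: "real^'q" and b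
  proof -
    \<comment> \<open>A matrix with one row instead of a vector, so that associativity of matrix
      products moves \<open>P\<close> and \<open>J\<close> past it.\<close>
    define R where "R = Matrix.mat 1 n (\<lambda>(_, j). complex_of_real (a $ e j))"
    have R: "R \<in> carrier_mat 1 n" by (simp add: R_def)
    have RA: "R * A = of_real b \<cdot>\<^sub>m R"
    proof (rule eq_matI)
      fix i k assume "i < dim_row (of_real b \<cdot>\<^sub>m R)" "k < dim_col (of_real b \<cdot>\<^sub>m R)"
      then have ik: "i = 0" "k < n" using R by auto
      have "(\<Sum>j<n. a $ e j * B $ e j $ e k) = b * a $ e k"
      proof -
        have "a \<bullet> (B *v axis (e k) 1) = b * (a \<bullet> axis (e k) 1)" by (rule a)
        moreover have "B *v axis (e k) 1 = (\<chi> i. B $ i $ e k)"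
          by (simp add: matrix_vector_mult_basis column_def)
        moreover have "a \<bullet> axis (e k) 1 = a $ e k" by (simp add: inner_axis)
        moreover have "a \<bullet> (\<chi> i. B $ i $ e k) = (\<Sum>j<n. a $ e j * B $ e j $ e k)"
          by (simp add: inner_vec_def sum_e)
        ultimately show ?thesis by simp
      qed
      then have "complex_of_real (\<Sum>j<n. a $ e j * B $ e j $ e k) = of_real (b * a $ e k)" by simp
      then show "(R * A) $$ (i, k) = (of_real b \<cdot>\<^sub>m R) $$ (i, k)"
        using ik A by (simp add: R_def scalar_prod_def Aij atLeast0LessThan)
    qed (use R A in auto)
    define c where "c i = (R * P) $$ (0, i)" for i
    have c: "c i = (\<Sum>j<n. of_real (a $ e j) * P $$ (j, i))" if "i < n" for i
      using that P by (simp add: c_def R_def scalar_prod_def atLeast0LessThan)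
    have "R * P * J = of_real b \<cdot>\<^sub>m (R * P)"
    proof -
      have "R * P * J = R * (A * P)" using R P J by (simp add: AP)
      also have "\<dots> = R * A * P" using R P A by simp
      also have "\<dots> = of_real b \<cdot>\<^sub>m (R * P)" unfolding RA using R P by (simp add: mult_smult_assoc_mat)
      finally show ?thesis .
    qed
    then have eq: "(R * P * J) $$ (0, i) = of_real b * c i" if "i < n" for i
      using that R P by (simp add: c_def)
    have "(R * P * J) $$ (0, i) = c i * ev i + (if 0 < i \<and> pos (i - 1) \<noteq> 0 then c (i - 1) else 0)"
      if i: "i < n" for i
    proof -
      have "(R * P * J) $$ (0, i) = (\<Sum>j<n. c j * J $$ (j, i))"
        using i R P J by (simp add: c_def scalar_prod_def atLeast0LessThan del: assoc_mult_mat)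
      \<comment> \<open>Column \<open>i\<close> of \<open>J\<close> has its diagonal entry and
        possibly a 1 in row \<open>i - 1\<close>. For \<open>i = 0\<close> truncated subtraction
        gives \<open>i - 1 = i\<close>; the test \<open>0 < i\<close> removes that spurious
        term.\<close>
      also have "\<dots> = (\<Sum>j<n. (if j = i then c i * ev i else 0) +
          (if j = i - 1 then if 0 < i \<and> pos (i - 1) \<noteq> 0 then c (i - 1) else 0 else 0))"
        using i by (intro sum.cong) (auto simp: ent)
      also have "\<dots> = c i * ev i + (if 0 < i \<and> pos (i - 1) \<noteq> 0 then c (i - 1) else 0)"
        using i by (simp add: sum.distrib)
      finally show ?thesis .
    qed
    moreover have "complex_of_real (a \<bullet> x) = (\<Sum>i<n. c i * U i x)" for x
    proof -
      have "complex_of_real (a \<bullet> x) = (\<Sum>j<n. of_real (a $ e j) * of_real (x $ e j))"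
        by (simp add: inner_vec_def sum_e)
      also have "\<dots> = (\<Sum>j<n. \<Sum>i<n. of_real (a $ e j) * P $$ (j, i) * U i x)"
        by (intro sum.cong refl) (simp add: rep sum_distrib_left mult.assoc)
      also have "\<dots> = (\<Sum>i<n. c i * U i x)"
        by (subst sum.swap) (simp add: c sum_distrib_right)
      finally show ?thesis .
    qed
    ultimately show ?thesis using eq by (intro exI[of _ c]) auto
  qed
  from nb have nb': "\<exists>C. \<forall>x. norm x \<le> C * (\<Sum>i<n. norm (U i x))" by blast
  show thesis
    by (rule that[of U ev pos]) (fact lin UB link nu roots nb' left)+
qed

text \<open>All entries of \<open>ls\<close> after the first have real part at most
  \<open>Re (ls ! 1) < b\<close>, so \<open>b\<close> is a simple eigenvalue with a single index
  \<open>i0\<close>. The coefficients of \<open>a\<close> form a left eigenvector of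
  \<open>J\<close> for \<open>b\<close>, which is supported at \<open>i0\<close>; thus
  \<open>U i0\<close> is proportional to \<open>a\<close> and vanishes where \<open>a\<close> does.
  The other eigenvalues obey the order of the listing.\<close>

lemma spectral_functionals:
  fixes B :: "real^'q^'q" and a :: "real^'q" and b :: real
  defines "A \<equiv> complex_mat_of B"
  assumes ls: "eigenvalue_listing A ls" and ls0: "ls ! 0 = of_real b"
    and ls1: "Re (ls ! 1) < b" and q: "CARD('q) \<ge> 2"
    and a: "a \<noteq> 0" "\<And>x. a \<bullet> (B *v x) = b * (a \<bullet> x)"
  obtains U :: "nat \<Rightarrow> real^'q \<Rightarrow> complex" and ev :: "nat \<Rightarrow> complex" and pos :: "nat \<Rightarrow> nat"
    and n :: nat and C :: real
  where "\<And>i. linear (U i)"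
    and "\<And>i x. i < n \<Longrightarrow> U i (B *v x) = ev i * U i x + (if pos i \<noteq> 0 then U (Suc i) x else 0)"
    and "\<And>i. i < n \<Longrightarrow> pos i \<noteq> 0 \<Longrightarrow> Suc i < n \<and> pos (Suc i) = pos i - 1 \<and> ev (Suc i) = ev i"
    and "\<And>i. i < n \<Longrightarrow> (\<forall>x. a \<bullet> x = 0 \<longrightarrow> U i x = 0) \<or>
      Re (ev i) < Re (ls ! 1) \<or> Re (ev i) = Re (ls ! 1) \<and> pos i \<le> jordan_nu A (ls ! 1)"
    and "\<And>x. norm x \<le> C * (\<Sum>i<n. norm (U i x))"
proof -
  define n where "n = CARD('q)"
  obtain U :: "nat \<Rightarrow> real^'q \<Rightarrow> complex" and ev pos where
    lin: "\<And>i. linear (U i)" and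
    UB: "\<And>i x. i < n \<Longrightarrow> U i (B *v x) = ev i * U i x + (if pos i \<noteq> 0 then U (Suc i) x else 0)" and
    link: "\<And>i. i < n \<Longrightarrow> pos i \<noteq> 0 \<Longrightarrow> Suc i < n \<and> pos (Suc i) = pos i - 1 \<and> ev (Suc i) = ev i" and
    nu: "\<And>i. i < n \<Longrightarrow> pos i \<le> jordan_nu A (ev i)" and
    roots: "proots (char_poly A) = mset (map ev [0..<n])" and
    nb: "\<exists>C. \<forall>x. norm x \<le> C * (\<Sum>i<n. norm (U i x))" and
    left: "\<And>(a::real^'q) b. (\<And>x. a \<bullet> (B *v x) = b * (a \<bullet> x)) \<Longrightarrow>
      \<exists>c. (\<forall>x. complex_of_real (a \<bullet> x) = (\<Sum>i<n. c i * U i x)) \<and>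
          (\<forall>i<n. c i * ev i + (if 0 < i \<and> pos (i - 1) \<noteq> 0 then c (i - 1) else 0) = of_real b * c i)"
    unfolding A_def n_def
  proof (rule jordan_functionals[of B], goal_cases)
    case (1 U ev pos)
    show ?case by (rule 1(1)[of U ev pos]) (fact 1)+
  qed
  have mls: "mset ls = mset (map ev [0..<n])"
    using ls roots by (simp add: eigenvalue_listing_def)
  then have "length ls = n" by (metis mset_eq_length length_map length_upt diff_zero)
  then obtain l1 rest where ls_eq: "ls = of_real b # l1 # rest"
    using q ls0 by (cases ls; cases "tl ls") (auto simp: n_def)
  have l1: "ls ! 1 = l1" by (simp add: ls_eq)
  have tail: "Re y < Re l1 \<or> Re y = Re l1 \<and> jordan_nu A y \<le> jordan_nu A l1"
    if "y \<in> set (l1 # rest)" for y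
    using ls that by (auto simp: eigenvalue_listing_def ls_eq)
  then have nb1: "of_real b \<notin> set (l1 # rest)" using ls1 unfolding l1 by fastforce
  have "card {i. i < n \<and> ev i = of_real b} = count (mset (map ev [0..<n])) (of_real b)"
    unfolding count_mset count_list_eq_length_filter length_filter_conv_card
    by (intro arg_cong[where f = card] Collect_cong) auto
  also have "\<dots> = 1"
  proof -
    have "l1 \<noteq> of_real b" "of_real b \<notin># mset rest" using nb1 by auto
    then show ?thesis by (subst mls[symmetric]) (simp add: ls_eq not_in_iff)
  qed
  finally obtain i0 where "{i. i < n \<and> ev i = of_real b} = {i0}" by (auto simp: card_1_singleton_iff)
  then have i0: "i0 < n" "ev i0 = of_real b" and uniq: "\<And>i. i < n \<Longrightarrow> ev i = of_real b \<Longrightarrow> i = i0"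
    by auto
  from left[OF a(2)] obtain c where
    rep: "\<And>x. complex_of_real (a \<bullet> x) = (\<Sum>i<n. c i * U i x)" and
    eig: "\<And>i. i < n \<Longrightarrow>
      c i * ev i + (if 0 < i \<and> pos (i - 1) \<noteq> 0 then c (i - 1) else 0) = of_real b * c i"
    by blast
  \<comment> \<open>The eigenvector equation determines \<open>c (Suc i)\<close> from
    \<open>c i\<close>, since its eigenvalue differs from \<open>b\<close>. A linked predecessor has
    the same eigenvalue, hence is not \<open>i0\<close> either and has coefficient 0 by
    induction.\<close>
  have c0: "c i = 0" if "i < n" "i \<noteq> i0" for i
    using that
  proof (induction i)
    case 0
    then show ?case using eig[of 0] uniq[of 0] by (auto simp: mult.commute)
  next
    case (Suc i)
    have "c i = 0" if "pos i \<noteq> 0"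
    proof (rule Suc.IH)
      show "i < n" using Suc.prems by simp
      from link[OF this that] show "i \<noteq> i0" using i0(2) uniq[OF Suc.prems(1)] by auto
    qed
    then have "c (Suc i) * ev (Suc i) = of_real b * c (Suc i)" using eig[OF Suc.prems(1)]
      by (cases "pos i = 0") auto
    then show ?case using uniq[OF Suc.prems(1)] Suc.prems(2) by (auto simp: mult.commute)
  qed
  have ax: "complex_of_real (a \<bullet> x) = c i0 * U i0 x" for x
  proof -
    have "(\<Sum>i<n. c i * U i x) = (\<Sum>i\<in>{i0}. c i * U i x)"
      using i0 c0 by (intro sum.mono_neutral_right) auto
    then show ?thesis using rep by simp
  qed
  have "c i0 \<noteq> 0" using ax[of a] a(1) by auto
  then have vanish: "U i0 x = 0" if "a \<bullet> x = 0" for x using ax[of x] that by simp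
  have good: "(\<forall>x. a \<bullet> x = 0 \<longrightarrow> U i x = 0) \<or>
      Re (ev i) < Re (ls ! 1) \<or> Re (ev i) = Re (ls ! 1) \<and> pos i \<le> jordan_nu A (ls ! 1)"
    if i: "i < n" for i
  proof (cases "i = i0")
    case True
    then show ?thesis using vanish by auto
  next
    case False
    have "ev i \<in> set (map ev [0..<n])" using i by auto
    then have "ev i \<in> set ls" using mls by (metis set_mset_mset)
    moreover have "ev i \<noteq> of_real b" using uniq[OF i] False by blast
    ultimately have "ev i \<in> set (l1 # rest)" by (auto simp: ls_eq)
    from tail[OF this] show ?thesis using nu[OF i] unfolding l1 by auto
  qed
  from nb obtain C where C: "\<And>x. norm x \<le> C * (\<Sum>i<n. norm (U i x))" by blast
  show thesis by (rule that[of U n ev pos C]) (fact lin UB link good C)+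
qed

section \<open>Moment inequalities and the scalar drift\<close>

text \<open>If \<open>e \<le> w\<close>, trade the factor \<open>e ^ k\<close> for
  \<open>w ^ k\<close>; otherwise trade \<open>w ^ a\<close> for \<open>e ^ a\<close>. In the next
  expansion every mixed monomial of degree at least two in \<open>e\<close> is thereby reduced to
  the two extreme ones.\<close>

lemma power_mult_split_le:
  fixes w e :: real
  assumes "0 \<le> w" "0 \<le> e"
  shows "w ^ a * e ^ (k + 2) \<le> w ^ (a + k) * e\<^sup>2 + e ^ (a + k + 2)"
proof (cases "e \<le> w")
  case True
  then have "w ^ a * e ^ k * e\<^sup>2 \<le> w ^ a * w ^ k * e\<^sup>2"
    using assms by (intro mult_right_mono mult_left_mono power_mono) auto
  moreover have "0 \<le> e ^ (a + k + 2)" using assms by simp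
  moreover have "w ^ a * e ^ (k + 2) = w ^ a * e ^ k * e\<^sup>2" "w ^ (a + k) * e\<^sup>2 = w ^ a * w ^ k * e\<^sup>2"
    by (simp_all only: power_add mult.assoc)
  ultimately show ?thesis by linarith
next
  case False
  then have "w ^ a * e ^ (k + 2) \<le> e ^ a * e ^ (k + 2)"
    using assms by (intro mult_right_mono power_mono) auto
  moreover have "0 \<le> w ^ (a + k) * e\<^sup>2" using assms by simp
  moreover have "e ^ (a + k + 2) = e ^ a * e ^ (k + 2)" by (simp only: power_add mult.assoc)
  ultimately show ?thesis by linarith
qed

text \<open>The first-order term keeps its sign and its inner product, so that it can later be
  integrated to zero; all else is at least quadratic in \<open>e\<close>. The induction multiplies
  by the square of \<open>norm (w + e)\<close>, a polynomial in the norms and the inner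
  product.\<close>

lemma norm_add_power_le:
  "\<exists>C\<ge>0. \<forall>w e :: 'a::real_inner. norm (w + e) ^ (2 * Suc m) \<le>
     norm w ^ (2 * Suc m) + 2 * real (Suc m) * norm w ^ (2 * m) * (w \<bullet> e)
     + C * (norm w ^ (2 * m) * (norm e)\<^sup>2 + norm e ^ (2 * Suc m))"
proof (induction m)
  case 0
  have "norm (w + e) ^ 2 = norm w ^ 2 + 2 * (w \<bullet> e) + norm e ^ 2" for w e :: 'a
    by (simp add: power2_norm_eq_inner algebra_simps inner_commute)
  then show ?case by (intro exI[of _ 1]) auto
next
  case (Suc m)
  then obtain C where C: "C \<ge> 0" and IH: "\<And>w e :: 'a. norm (w + e) ^ (2 * Suc m) \<le>
     norm w ^ (2 * Suc m) + 2 * real (Suc m) * norm w ^ (2 * m) * (w \<bullet> e)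
     + C * (norm w ^ (2 * m) * (norm e)\<^sup>2 + norm e ^ (2 * Suc m))"
    by blast
  \<comment> \<open>1 pays for \<open>x ^ (2 * m + 2) * y ^ 2\<close>, \<open>4 + 2\<close> times
    \<open>Suc m\<close> for the first-order term of the induction hypothesis against
    \<open>2 * r\<close> and \<open>y ^ 2\<close>, and \<open>8 * C\<close> for its remainder times
    \<open>2 * x ^ 2 + 2 * y ^ 2\<close>.\<close>
  define D where "D = 1 + 6 * real (Suc m) + 8 * C"
  have "norm (w + e) ^ (2 * Suc (Suc m)) \<le>
     norm w ^ (2 * Suc (Suc m)) + 2 * real (Suc (Suc m)) * norm w ^ (2 * Suc m) * (w \<bullet> e)
     + D * (norm w ^ (2 * Suc m) * (norm e)\<^sup>2 + norm e ^ (2 * Suc (Suc m)))" for w e :: 'a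
  proof -
    define x y r where "x = norm w" and "y = norm e" and "r = w \<bullet> e"
    define T where "T = x ^ (2 * m + 2) * y\<^sup>2 + y ^ (2 * m + 4)"
    have xy: "0 \<le> x" "0 \<le> y" by (auto simp: x_def y_def)
    have r: "\<bar>r\<bar> \<le> x * y" unfolding x_def y_def r_def by (rule Cauchy_Schwarz_ineq2)
    have N2: "norm (w + e) ^ 2 = x\<^sup>2 + 2 * r + y\<^sup>2"
      by (simp add: x_def y_def r_def power2_norm_eq_inner algebra_simps inner_commute)
    have t1: "x ^ (2 * m + 2) * y\<^sup>2 \<le> T" "y ^ (2 * m + 4) \<le> T" using xy by (auto simp: T_def)
    have t2: "x ^ (2 * m) * y ^ 4 \<le> T" using power_mult_split_le[OF xy, of "2 * m" 2]
      by (simp only: T_def add.assoc numeral_plus_numeral add_num_simps)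
    have t3: "x\<^sup>2 * y ^ (2 * m + 2) \<le> T" using power_mult_split_le[OF xy, of 2 "2 * m"]
      by (simp only: T_def add.commute[of 2 "2 * m"] add.assoc numeral_plus_numeral add_num_simps
          add.commute[of "y ^ _"])
    have t4: "x ^ (2 * m + 1) * y ^ 3 \<le> T" using power_mult_split_le[OF xy, of "2 * m + 1" 1]
      by (simp add: T_def numeral_eq_Suc)
    have "norm (w + e) ^ (2 * Suc (Suc m)) = norm (w + e) ^ (2 * Suc m) * norm (w + e) ^ 2"
      by (simp add: power2_eq_square mult_ac)
    also have "\<dots> \<le> (x ^ (2 * m + 2) + 2 * real (Suc m) * x ^ (2 * m) * r
        + C * (x ^ (2 * m) * y\<^sup>2 + y ^ (2 * m + 2))) * norm (w + e) ^ 2"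
      using IH[of w e] by (intro mult_right_mono) (auto simp: x_def y_def r_def)
    also have "\<dots> = x ^ (2 * m + 4) + 2 * real (Suc (Suc m)) * x ^ (2 * m + 2) * r
        + x ^ (2 * m + 2) * y\<^sup>2 + 4 * real (Suc m) * (x ^ (2 * m) * r\<^sup>2)
        + 2 * real (Suc m) * (x ^ (2 * m) * r * y\<^sup>2)
        + C * (x ^ (2 * m) * y\<^sup>2 + y ^ (2 * m + 2)) * norm (w + e) ^ 2"
      unfolding N2 by (simp add: algebra_simps power2_eq_square power_add numeral_eq_Suc)
    also have "\<dots> \<le> x ^ (2 * m + 4) + 2 * real (Suc (Suc m)) * x ^ (2 * m + 2) * r
        + T + 4 * real (Suc m) * T + 2 * real (Suc m) * T + C * (8 * T)"
    proof (intro add_mono order_refl t1)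
      have "r\<^sup>2 \<le> (x * y)\<^sup>2" using r by (metis abs_le_square_iff abs_of_nonneg mult_nonneg_nonneg xy)
      then have "x ^ (2 * m) * r\<^sup>2 \<le> x ^ (2 * m) * (x * y)\<^sup>2" using xy by (intro mult_left_mono) auto
      also have "\<dots> = x ^ (2 * m + 2) * y\<^sup>2" by (simp add: power_mult_distrib power_add power2_eq_square)
      finally have "x ^ (2 * m) * r\<^sup>2 \<le> T" using t1 by simp
      then show "4 * real (Suc m) * (x ^ (2 * m) * r\<^sup>2) \<le> 4 * real (Suc m) * T"
        by (intro mult_left_mono) auto
      have "x ^ (2 * m) * r * y\<^sup>2 \<le> x ^ (2 * m) * (x * y) * y\<^sup>2"
        using r xy by (intro mult_right_mono mult_left_mono) auto
      also have "\<dots> = x ^ (2 * m + 1) * y ^ 3" by (simp add: power_add power3_eq_cube power2_eq_square)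
      finally show "2 * real (Suc m) * (x ^ (2 * m) * r * y\<^sup>2) \<le> 2 * real (Suc m) * T"
        using t4 by (intro mult_left_mono) auto
      have "norm (w + e) ^ 2 \<le> 2 * x\<^sup>2 + 2 * y\<^sup>2"
        using N2 r sum_squares_bound[of x y] by simp
      then have "(x ^ (2 * m) * y\<^sup>2 + y ^ (2 * m + 2)) * norm (w + e) ^ 2
          \<le> (x ^ (2 * m) * y\<^sup>2 + y ^ (2 * m + 2)) * (2 * x\<^sup>2 + 2 * y\<^sup>2)"
        using xy by (intro mult_left_mono) auto
      also have "\<dots> = 2 * (x ^ (2 * m + 2) * y\<^sup>2) + 2 * (x ^ (2 * m) * y ^ 4)
          + 2 * (x\<^sup>2 * y ^ (2 * m + 2)) + 2 * y ^ (2 * m + 4)"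
        by (simp add: algebra_simps power2_eq_square power_add numeral_eq_Suc)
      also have "\<dots> \<le> 8 * T" using t1 t2 t3 by simp
      finally show "C * (x ^ (2 * m) * y\<^sup>2 + y ^ (2 * m + 2)) * norm (w + e) ^ 2 \<le> C * (8 * T)"
        unfolding mult.assoc using C by (rule mult_left_mono)
    qed
    also have "\<dots> = x ^ (2 * m + 4) + 2 * real (Suc (Suc m)) * x ^ (2 * m + 2) * r + D * T"
      by (simp add: D_def algebra_simps)
    finally have "norm (w + e) ^ (2 * Suc (Suc m)) \<le>
        x ^ (2 * m + 4) + 2 * real (Suc (Suc m)) * x ^ (2 * m + 2) * r + D * T" .
    moreover have "2 * Suc (Suc m) = 2 * m + 4" "2 * Suc m = 2 * m + 2" by simp_all
    ultimately show ?thesis unfolding x_def y_def r_def T_def by (simp only:)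
  qed
  then show ?case using C by (intro exI[of _ D]) (auto simp: D_def)
qed

text \<open>The two moment inequalities below divide by their bounds. Enlarging the bounds by
  \<epsilon> and letting it tend to 0 admits the bound 0 as well.\<close>

lemma power_le_of_eps:
  fixes a :: real
  assumes "\<And>\<epsilon>. 0 < \<epsilon> \<Longrightarrow> I \<le> (a + \<epsilon>) ^ p"
  shows "I \<le> a ^ p"
proof (rule tendsto_lowerbound)
  show "((\<lambda>\<epsilon>. (a + \<epsilon>) ^ p) \<longlongrightarrow> a ^ p) (at_right 0)"
    by (auto intro!: tendsto_eq_intros)
  show "\<forall>\<^sub>F \<epsilon> in at_right 0. I \<le> (a + \<epsilon>) ^ p"
    using assms by (auto simp: eventually_at_right_less eventually_at_filter)
qed simp

section \<open>Minkowski and Lyapunov inequalities for integer exponents\<close>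

text \<open>\<open>(norm (f x) + norm (g x)) / (\<alpha> + \<beta>)\<close> is the convex
  combination of \<open>norm (f x) / \<alpha>\<close> and \<open>norm (g x) / \<beta>\<close> with
  weights \<open>t\<close> and \<open>1 - t\<close>. Convexity of the power, integrated, bounds its
  moment by 1.\<close>

lemma Minkowski_pos:
  fixes f g :: "'a \<Rightarrow> 'b::{banach, second_countable_topology}"
  assumes [measurable]: "f \<in> borel_measurable M" "g \<in> borel_measurable M"
    and f: "integrable M (\<lambda>x. norm (f x) ^ p)" "(\<integral>x. norm (f x) ^ p \<partial>M) \<le> \<alpha> ^ p"
    and g: "integrable M (\<lambda>x. norm (g x) ^ p)" "(\<integral>x. norm (g x) ^ p \<partial>M) \<le> \<beta> ^ p"
    and pos: "0 < \<alpha>" "0 < \<beta>"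
  shows "integrable M (\<lambda>x. norm (f x + g x) ^ p)"
    and "(\<integral>x. norm (f x + g x) ^ p \<partial>M) \<le> (\<alpha> + \<beta>) ^ p"
proof -
  define s where "s = (\<alpha> + \<beta>) ^ p"
  define t where "t = \<alpha> / (\<alpha> + \<beta>)"
  have s: "s > 0" using pos by (simp add: s_def)
  have t: "0 \<le> t" "t \<le> 1" "1 - t = \<beta> / (\<alpha> + \<beta>)" using pos by (auto simp: t_def field_simps)
  have le: "norm (f x + g x) ^ p \<le>
      s * (t * (norm (f x) ^ p / \<alpha> ^ p) + (1 - t) * (norm (g x) ^ p / \<beta> ^ p))" for x
  proof -
    have cv: "convex_on {0::real..} (\<lambda>x. x ^ p)"
      by (cases "even p") (auto intro: convex_power_odd convex_on_subset[OF convex_power_even])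
    have "((1 - t) * (norm (g x) / \<beta>) + t * (norm (f x) / \<alpha>)) ^ p \<le>
        (1 - t) * (norm (g x) / \<beta>) ^ p + t * (norm (f x) / \<alpha>) ^ p"
      using convex_onD[OF cv, of t "norm (g x) / \<beta>" "norm (f x) / \<alpha>"] t pos by simp
    moreover have "(1 - t) * (norm (g x) / \<beta>) + t * (norm (f x) / \<alpha>) = (norm (f x) + norm (g x)) / (\<alpha> + \<beta>)"
      unfolding t(3) using pos by (simp add: t_def add_divide_distrib)
    ultimately have "((norm (f x) + norm (g x)) / (\<alpha> + \<beta>)) ^ p \<le>
        t * (norm (f x) ^ p / \<alpha> ^ p) + (1 - t) * (norm (g x) ^ p / \<beta> ^ p)"
      by (simp add: power_divide)
    then have "(norm (f x) + norm (g x)) ^ p \<le>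
      s * (t * (norm (f x) ^ p / \<alpha> ^ p) + (1 - t) * (norm (g x) ^ p / \<beta> ^ p))"
      using s by (simp add: power_divide s_def[symmetric] pos_divide_le_eq mult.commute)
    moreover have "norm (f x + g x) ^ p \<le> (norm (f x) + norm (g x)) ^ p"
      by (intro power_mono norm_triangle_ineq) auto
    ultimately show ?thesis by linarith
  qed
  have int: "integrable M (\<lambda>x. s * (t * (norm (f x) ^ p / \<alpha> ^ p) + (1 - t) * (norm (g x) ^ p / \<beta> ^ p)))"
    using f g by (intro integrable_mult_right Bochner_Integration.integrable_add integrable_divide) auto
  show I: "integrable M (\<lambda>x. norm (f x + g x) ^ p)"
    by (rule Bochner_Integration.integrable_bound[OF int]) (use le in \<open>auto intro: order_trans[OF _ abs_ge_self]\<close>)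
  have "(\<integral>x. norm (f x + g x) ^ p \<partial>M) \<le>
      (\<integral>x. s * (t * (norm (f x) ^ p / \<alpha> ^ p) + (1 - t) * (norm (g x) ^ p / \<beta> ^ p)) \<partial>M)"
    by (rule integral_mono[OF I int le])
  also have "\<dots> = s * (t * ((\<integral>x. norm (f x) ^ p \<partial>M) / \<alpha> ^ p) + (1 - t) * ((\<integral>x. norm (g x) ^ p \<partial>M) / \<beta> ^ p))"
    using f g by simp
  also have "\<dots> \<le> s * (t * 1 + (1 - t) * 1)"
    using s t f g pos by (intro mult_left_mono add_mono) (auto simp: divide_le_eq)
  finally show "(\<integral>x. norm (f x + g x) ^ p \<partial>M) \<le> (\<alpha> + \<beta>) ^ p" by (simp add: s_def)
qed

lemma Minkowski_le:
  fixes f g :: "'a \<Rightarrow> 'b::{banach, second_countable_topology}"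
  assumes meas: "f \<in> borel_measurable M" "g \<in> borel_measurable M"
    and f: "integrable M (\<lambda>x. norm (f x) ^ p)" "(\<integral>x. norm (f x) ^ p \<partial>M) \<le> \<alpha> ^ p"
    and g: "integrable M (\<lambda>x. norm (g x) ^ p)" "(\<integral>x. norm (g x) ^ p \<partial>M) \<le> \<beta> ^ p"
    and nonneg: "0 \<le> \<alpha>" "0 \<le> \<beta>"
  shows "(\<integral>x. norm (f x + g x) ^ p \<partial>M) \<le> (\<alpha> + \<beta>) ^ p"
proof (rule power_le_of_eps)
  fix \<epsilon> :: real assume \<epsilon>: "0 < \<epsilon>"
  have "\<alpha> ^ p \<le> (\<alpha> + \<epsilon> / 2) ^ p" "\<beta> ^ p \<le> (\<beta> + \<epsilon> / 2) ^ p"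
    using nonneg \<epsilon> by (auto intro!: power_mono)
  then have "(\<integral>x. norm (f x + g x) ^ p \<partial>M) \<le> ((\<alpha> + \<epsilon> / 2) + (\<beta> + \<epsilon> / 2)) ^ p"
    using f g nonneg \<epsilon> by (intro Minkowski_pos(2) meas) auto
  then show "(\<integral>x. norm (f x + g x) ^ p \<partial>M) \<le> (\<alpha> + \<beta> + \<epsilon>) ^ p" by (simp add: algebra_simps)
qed

text \<open>Weighted AM-GM for \<open>m\<close> copies of \<open>u ^ Suc m\<close> and one 1. The
  induction step adds \<open>(u ^ Suc m - 1) * (u - 1) \<ge> 0\<close>, whose factors have equal
  sign.\<close>

lemma power_Suc_Young:
  fixes u :: real
  assumes "0 \<le> u"
  shows "real (Suc m) * u ^ m \<le> real m * u ^ Suc m + 1"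
proof (induction m)
  case 0
  then show ?case by simp
next
  case (Suc m)
  have "0 \<le> (u ^ Suc m - 1) * (u - 1)"
  proof (cases "u \<le> 1")
    case True
    then have "u ^ Suc m \<le> 1" using assms by (intro power_le_one)
    then show ?thesis using True by (intro mult_nonpos_nonpos) auto
  next
    case False
    then have "1 \<le> u ^ Suc m" by (intro one_le_power) simp
    then show ?thesis using False by (intro mult_nonneg_nonneg) auto
  qed
  moreover have "real (Suc m) * u ^ m * u \<le> (real m * u ^ Suc m + 1) * u"
    using Suc assms by (rule mult_right_mono)
  ultimately show ?case by (simp add: algebra_simps)
qed

text \<open>Monotonicity of \<open>L^p\<close> norms for consecutive exponents: integrate
  \<open>power_Suc_Young\<close> at \<open>f x / d\<close> with \<open>d\<close> slightly above
  \<open>c\<close>. The total mass 1 integrates the constant.\<close>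

lemma (in prob_space) lower_moment_le:
  fixes f :: "'a \<Rightarrow> real"
  assumes int: "integrable M (\<lambda>x. f x ^ m)" "integrable M (\<lambda>x. f x ^ Suc m)"
    and nonneg: "\<And>x. 0 \<le> f x" and c: "0 \<le> c"
    and le: "(\<integral>x. f x ^ Suc m \<partial>M) \<le> c ^ Suc m"
  shows "(\<integral>x. f x ^ m \<partial>M) \<le> c ^ m"
proof (rule power_le_of_eps)
  fix \<epsilon> :: real assume \<epsilon>: "0 < \<epsilon>"
  define d where "d = c + \<epsilon>"
  have d: "0 < d" using c \<epsilon> by (simp add: d_def)
  have le': "(\<integral>x. f x ^ Suc m \<partial>M) \<le> d ^ Suc m"
    using c \<epsilon> by (intro order_trans[OF le] power_mono) (auto simp: d_def)
  have "real (Suc m) * (\<integral>x. f x ^ m \<partial>M) / d ^ m = (\<integral>x. real (Suc m) * (f x / d) ^ m \<partial>M)"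
    by (simp add: power_divide)
  also have "\<dots> \<le> (\<integral>x. real m * (f x / d) ^ Suc m + 1 \<partial>M)"
    using int d nonneg by (intro integral_mono power_Suc_Young) (auto simp: power_divide simp del: power_Suc)
  also have "\<dots> = real m * ((\<integral>x. f x ^ Suc m \<partial>M) / d ^ Suc m) + 1"
    using int by (simp add: power_divide prob_space del: power_Suc)
  also have "\<dots> \<le> real m * 1 + 1"
    using d le' by (intro add_right_mono mult_left_mono) (auto simp: divide_le_eq simp del: power_Suc)
  finally have "real (Suc m) * (\<integral>x. f x ^ m \<partial>M) \<le> real (Suc m) * d ^ m"
    using d by (simp add: divide_le_eq algebra_simps)
  then show "(\<integral>x. f x ^ m \<partial>M) \<le> (c + \<epsilon>) ^ m" unfolding d_def by (simp add: mult_le_cancel_left)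
qed

section \<open>Absorbing error terms in one step of the recursion\<close>

text \<open>With \<open>x\<close> the square of an \<open>L^p\<close> bound, this turns the
  contribution of the noise to the moment into an additive constant on that square.\<close>

lemma power_add_const_ge:
  fixes x c :: real
  assumes "0 \<le> x" "1 \<le> c"
  shows "x ^ Suc m + c * x ^ m + c \<le> (x + 2 * c) ^ Suc m"
proof -
  have "x ^ m \<le> (x + 2 * c) ^ m" using assms by (intro power_mono) auto
  moreover have "1 \<le> (x + 2 * c) ^ m" using assms by (intro one_le_power) auto
  ultimately have "x * x ^ m + (c * x ^ m + c * 1) \<le> x * (x + 2 * c) ^ m + (c * (x + 2 * c) ^ m + c * (x + 2 * c) ^ m)"
    using assms by (intro add_mono mult_left_mono) auto
  then show ?thesis by (simp add: algebra_simps)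
qed

text \<open>The slack \<open>\<delta> * K\<close> outgrows a cross term of order
  \<open>sqrt K\<close>. For \<open>K \<ge> 1\<close>, \<open>Q\<close> is at most
  \<open>Q * sqrt K\<close>, so it suffices that \<open>sqrt K\<close> exceeds
  \<open>(P + Q) / \<delta>\<close>.\<close>

lemma sqrt_absorb:
  fixes P Q \<delta> :: real
  assumes "0 \<le> P" "0 \<le> Q" "0 < \<delta>"
  shows "\<exists>K0\<ge>1. \<forall>K\<ge>K0. P * sqrt K + Q \<le> \<delta> * K"
proof (intro exI[of _ "max 1 (((P + Q) / \<delta>)\<^sup>2)"] conjI allI impI)
  fix K assume K: "max 1 (((P + Q) / \<delta>)\<^sup>2) \<le> K"
  have "(P + Q) / \<delta> \<le> sqrt K" using K by (intro real_le_rsqrt) auto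
  then have "P + Q \<le> \<delta> * sqrt K" using assms by (simp add: divide_le_eq mult.commute)
  then have "(P + Q) * sqrt K \<le> \<delta> * sqrt K * sqrt K" using K by (intro mult_right_mono) auto
  moreover have "Q \<le> Q * sqrt K" using K assms by (intro mult_le_cancel_left1[THEN iffD2]) auto
  ultimately show "P * sqrt K + Q \<le> \<delta> * K" using K by (simp add: algebra_simps)
qed simp

lemma norm_one_plus_div:
  fixes \<mu> :: complex
  assumes "1 \<le> t"
  shows "(norm (1 + \<mu> / of_real t))\<^sup>2 = 1 + 2 * Re \<mu> / t + (norm \<mu>)\<^sup>2 / t\<^sup>2"
    and "norm (1 + \<mu> / of_real t) \<le> 1 + norm \<mu>"
proof -
  show "(norm (1 + \<mu> / of_real t))\<^sup>2 = 1 + 2 * Re \<mu> / t + (norm \<mu>)\<^sup>2 / t\<^sup>2"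
    unfolding cmod_power2 using assms by (simp add: field_simps power2_eq_square)
  have "norm (\<mu> / of_real t) \<le> norm \<mu>"
    using assms by (simp add: norm_divide divide_le_eq mult_le_cancel_left1)
  then show "norm (1 + \<mu> / of_real t) \<le> 1 + norm \<mu>"
    using norm_triangle_ineq[of 1 "\<mu> / of_real t"] by simp
qed

text \<open>The next two lemmas describe one step of the recursion for \<open>U (Y n)\<close>, with time \<open>t = s n / b\<close> and
  \<open>\<mu> = l / b\<close>: \<open>sqrt (K * g t)\<close> bounds the norm of \<open>U (Y n)\<close> in \<open>L\<^sup>2\<^sup>m\<close>, \<open>sqrt (C * h t)\<close> that of the
  next functional in the chain, and \<open>D\<close> accounts for the noise.  In the critical case each position
  in the chain costs a factor \<open>(ln t)\<^sup>2\<close>, so that \<open>h t = g t / (ln t)\<^sup>2\<close>; at the end of a chain the next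
  functional is zero.\<close>

lemma drift_subcritical:
  fixes \<mu> :: complex
  assumes \<mu>: "Re \<mu> < 1 / 2" and C: "0 \<le> C" "0 \<le> D"
  shows "\<exists>K0\<ge>1. \<exists>t0\<ge>1. \<forall>K\<ge>K0. \<forall>t\<ge>t0.
    (norm (1 + \<mu> / of_real t) * sqrt (K * t) + sqrt (C * t) / t)\<^sup>2 + D \<le> K * (t + 1)"
proof -
  \<comment> \<open>\<open>K * \<delta>\<close> is the gap between \<open>K * (t + 1)\<close> and
    \<open>K * (t + 2 * Re \<mu>)\<close>. One half pays for the second-order term
    \<open>K * norm \<mu> ^ 2 / t\<close>, which fixes \<open>t0\<close>; the other half pays for
    the cross term, \<open>C\<close> and \<open>D\<close>.\<close>
  define \<delta> where "\<delta> = 1 - 2 * Re \<mu>"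
  have \<delta>: "0 < \<delta>" using \<mu> by (simp add: \<delta>_def)
  obtain K0 where K0: "K0 \<ge> 1" "\<And>K. K \<ge> K0 \<Longrightarrow> 2 * (1 + norm \<mu>) * sqrt C * sqrt K + (C + D) \<le> \<delta> / 2 * K"
    using sqrt_absorb[of "2 * (1 + norm \<mu>) * sqrt C" "C + D" "\<delta> / 2"] C \<delta> by auto
  define t0 where "t0 = max 1 (2 * (norm \<mu>)\<^sup>2 / \<delta>)"
  have "(norm (1 + \<mu> / of_real t) * sqrt (K * t) + sqrt (C * t) / t)\<^sup>2 + D \<le> K * (t + 1)"
    if K: "K \<ge> K0" and t: "t \<ge> t0" for K t
  proof -
    have t1: "1 \<le> t" using t by (simp add: t0_def)
    have K1: "1 \<le> K" using K K0 by simp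
    let ?N = "norm (1 + \<mu> / of_real t)"
    have prod: "sqrt (K * t) * sqrt (C * t) = sqrt K * sqrt C * t"
      using t1 by (simp add: real_sqrt_mult)
    have "(?N * sqrt (K * t) + sqrt (C * t) / t)\<^sup>2
        = ?N\<^sup>2 * (sqrt (K * t))\<^sup>2 + 2 * ?N * (sqrt (K * t) * sqrt (C * t)) / t
          + (sqrt (C * t))\<^sup>2 / t\<^sup>2"
      by (simp add: power2_sum power_mult_distrib power_divide mult_ac)
    also have "\<dots> = ?N\<^sup>2 * K * t + 2 * ?N * sqrt K * sqrt C + C / t"
      unfolding prod using t1 K1 C by (simp add: power2_eq_square)
    also have "?N\<^sup>2 * K * t = K * (t + 2 * Re \<mu>) + K * ((norm \<mu>)\<^sup>2 / t)"
      unfolding norm_one_plus_div(1)[OF t1] using t1 by (simp add: field_simps power2_eq_square)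
    also have "(norm \<mu>)\<^sup>2 / t \<le> \<delta> / 2"
      using t t1 \<delta> by (auto simp: t0_def field_simps)
    also have "2 * ?N * sqrt K * sqrt C \<le> 2 * (1 + norm \<mu>) * sqrt K * sqrt C"
      using norm_one_plus_div(2)[OF t1] C K1 by (intro mult_right_mono mult_left_mono) auto
    also have "C / t \<le> C" using C t1 by (simp add: divide_le_eq mult_le_cancel_left1)
    finally have "(?N * sqrt (K * t) + sqrt (C * t) / t)\<^sup>2 + D
        \<le> K * (t + 2 * Re \<mu>) + K * (\<delta> / 2) + 2 * (1 + norm \<mu>) * sqrt K * sqrt C + C + D"
      using K1 by simp
    also have "\<dots> \<le> K * (t + 2 * Re \<mu>) + K * (\<delta> / 2) + \<delta> / 2 * K"
      using K0(2)[OF K] by (simp add: algebra_simps)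
    also have "\<dots> = K * (t + 1)" by (simp add: \<delta>_def algebra_simps)
    finally show ?thesis .
  qed
  then show ?thesis using K0(1) by (intro exI[of _ K0] conjI exI[of _ t0]) (auto simp: t0_def)
qed

lemma drift_critical:
  fixes \<mu> :: complex and l :: nat
  assumes \<mu>: "Re \<mu> = 1 / 2" and C: "0 \<le> C" "0 \<le> D"
  defines "g \<equiv> (\<lambda>t. t * ln t ^ (2 * l + 1))"
  shows "\<exists>K0\<ge>1. \<exists>t0\<ge>1. \<forall>K\<ge>K0. \<forall>t\<ge>t0.
    (norm (1 + \<mu> / of_real t) * sqrt (K * g t) + sqrt (C * (g t / (ln t)\<^sup>2)) / t)\<^sup>2 + D \<le> K * g (t + 1)"
proof -
  obtain K0 where K0: "K0 \<ge> 1" "\<And>K. K \<ge> K0 \<Longrightarrow> 2 * (1 + norm \<mu>) * sqrt C * sqrt K + (C + D) \<le> 1 / 2 * K"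
    using sqrt_absorb[of "2 * (1 + norm \<mu>) * sqrt C" "C + D" "1 / 2"] C by auto
  have "((\<lambda>t::real. (norm \<mu>)\<^sup>2 * (ln t / t)) \<longlongrightarrow> (norm \<mu>)\<^sup>2 * 0) at_top"
    by (intro tendsto_mult tendsto_const lim_ln_over_power[of 1, simplified] ln_x_over_x_tendsto_0)
  then have "\<forall>\<^sub>F t::real in at_top. (norm \<mu>)\<^sup>2 * (ln t / t) < 1 / 2"
    by (intro order_tendstoD) auto
  then obtain t1 where t1: "\<And>t. t \<ge> t1 \<Longrightarrow> (norm \<mu>)\<^sup>2 * (ln t / t) \<le> 1 / 2"
    by (auto simp: eventually_at_top_linorder intro: less_imp_le)
  \<comment> \<open>From \<open>exp 1\<close> on, \<open>ln t \<ge> 1\<close>; hence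
    \<open>E \<ge> 1\<close> below, and constants such as \<open>D\<close> may be multiplied by
    \<open>E\<close>.\<close>
  define t0 where "t0 = max (exp 1) t1"
  have "(norm (1 + \<mu> / of_real t) * sqrt (K * g t) + sqrt (C * (g t / (ln t)\<^sup>2)) / t)\<^sup>2 + D \<le> K * g (t + 1)"
    if K: "K \<ge> K0" and t: "t \<ge> t0" for K t
  proof -
    have te: "exp 1 \<le> t" using t by (simp add: t0_def)
    then have tp: "1 \<le> t" using exp_ge_add_one_self[of 1] by linarith
    have L: "1 \<le> ln t" using te tp by (simp add: ln_ge_iff)
    have K1: "1 \<le> K" using K K0 by simp
    \<comment> \<open>Since \<open>2 * Re \<mu> = 1\<close>, the main term is
      \<open>K * (t + 1) * ln t * E\<close>, and \<open>ln (t + 1) \<ge> ln t + 1 / (t + 1)\<close>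
      leaves only the slack \<open>K * E\<close>. Dividing \<open>g t\<close> by the square of
      \<open>ln t\<close> makes the cross term \<open>sqrt (g t * h t) / t\<close> equal to
      \<open>E\<close>, so that half of the slack can absorb it; the other half pays for the
      second-order term.\<close>
    define E where "E = ln t ^ (2 * l)"
    have E: "1 \<le> E" using L by (simp add: E_def one_le_power)
    have g: "g t = t * ln t * E" by (simp add: g_def E_def)
    have gh: "g t / (ln t)\<^sup>2 = t * E / ln t" using L by (simp add: g power2_eq_square)
    let ?N = "norm (1 + \<mu> / of_real t)"
    have prod: "sqrt (K * g t) * sqrt (C * (g t / (ln t)\<^sup>2)) = sqrt K * sqrt C * (t * E)"
    proof -
      have "(t * ln t * E) * (t * E / ln t) = (t * E)\<^sup>2" using L by (simp add: power2_eq_square)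
      then have "K * g t * (C * (g t / (ln t)\<^sup>2)) = K * C * (t * E)\<^sup>2"
        unfolding gh unfolding g by (metis mult.assoc mult.left_commute)
      moreover have "sqrt (K * C * (t * E)\<^sup>2) = sqrt K * sqrt C * (t * E)"
        using tp E by (simp add: real_sqrt_mult)
      ultimately show ?thesis by (metis real_sqrt_mult)
    qed
    have "(?N * sqrt (K * g t) + sqrt (C * (g t / (ln t)\<^sup>2)) / t)\<^sup>2
        = ?N\<^sup>2 * (sqrt (K * g t))\<^sup>2 + 2 * ?N * (sqrt (K * g t) * sqrt (C * (g t / (ln t)\<^sup>2))) / t
          + (sqrt (C * (g t / (ln t)\<^sup>2)))\<^sup>2 / t\<^sup>2"
      by (simp add: power2_sum power_mult_distrib power_divide mult_ac)
    also have "\<dots> = ?N\<^sup>2 * (K * g t) + 2 * ?N * sqrt K * sqrt C * E + C * E / (ln t * t)"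
      unfolding prod using tp L E K1 C by (simp add: g gh power2_eq_square)
    also have "?N\<^sup>2 * (K * g t) = K * ((t + 1) * (ln t * E)) + K * ((norm \<mu>)\<^sup>2 * (ln t / t) * E)"
      unfolding norm_one_plus_div(1)[OF tp] g using tp \<mu> by (simp add: field_simps power2_eq_square)
    also have "(norm \<mu>)\<^sup>2 * (ln t / t) * E \<le> 1 / 2 * E"
      using t1[of t] t E by (intro mult_right_mono) (auto simp: t0_def)
    also have "2 * ?N * sqrt K * sqrt C * E \<le> 2 * (1 + norm \<mu>) * sqrt K * sqrt C * E"
      using norm_one_plus_div(2)[OF tp] C K1 E by (intro mult_right_mono mult_left_mono) auto
    also have "C * E / (ln t * t) \<le> C * E"
    proof -
      have "1 * 1 \<le> ln t * t" using L tp by (intro mult_mono) auto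
      then have "C * E / (ln t * t) \<le> C * E / 1" using C E by (intro divide_left_mono) auto
      then show ?thesis by simp
    qed
    finally have "(?N * sqrt (K * g t) + sqrt (C * (g t / (ln t)\<^sup>2)) / t)\<^sup>2 + D
        \<le> K * ((t + 1) * (ln t * E)) + K * (1 / 2 * E) + 2 * (1 + norm \<mu>) * sqrt K * sqrt C * E + C * E + D * E"
      using K1 C E mult_left_mono[of 1 E D] by simp
    also have "\<dots> = K * ((t + 1) * (ln t * E)) + K * (1 / 2 * E) + (2 * (1 + norm \<mu>) * sqrt C * sqrt K + (C + D)) * E"
      by (simp add: algebra_simps)
    also have "\<dots> \<le> K * ((t + 1) * (ln t * E)) + K * (1 / 2 * E) + (1 / 2 * K) * E"
      using K0(2)[OF K] E by (intro add_left_mono mult_right_mono) auto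
    also have "\<dots> = K * ((t + 1) * ((ln t + 1 / (t + 1)) * E))"
      using tp by (simp add: field_simps)
    also have "\<dots> \<le> K * ((t + 1) * (ln (t + 1) * ln (t + 1) ^ (2 * l)))"
    proof (intro mult_left_mono mult_mono)
      have "ln (t / (t + 1)) \<le> t / (t + 1) - 1" using tp by (intro ln_le_minus_one) auto
      moreover have "t / (t + 1) - 1 = - (1 / (t + 1))" using tp by (simp add: field_simps)
      ultimately show "ln t + 1 / (t + 1) \<le> ln (t + 1)" using tp by (simp add: ln_div)
      show "E \<le> ln (t + 1) ^ (2 * l)" unfolding E_def using L tp by (intro power_mono) auto
    qed (use tp K1 E in auto)
    finally show ?thesis by (simp add: g_def)
  qed
  moreover have "1 \<le> t0" using exp_ge_add_one_self[of 1] by (simp add: t0_def)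
  ultimately show ?thesis using K0(1) by (intro exI[of _ K0] conjI exI[of _ t0]) auto
qed

section \<open>From bounded moments to convergence of moments\<close>

text \<open>A Fatou argument for weak convergence: the truncations \<open>min k g\<close> are
  bounded and continuous, inherit the bound \<open>C\<close> in the limit law, and increase to
  \<open>g\<close>.\<close>

lemma integrable_of_weak_limit:
  fixes Z :: "nat \<Rightarrow> 'w \<Rightarrow> real^'q" and g :: "real^'q \<Rightarrow> real"
  assumes M: "prob_space M" and mu: "prob_space mu" "sets mu = sets borel"
    and conv: "converges_in_distribution M Z mu"
    and Z [measurable]: "\<And>n. Z n \<in> borel_measurable M"
    and g: "continuous_on UNIV g" "\<And>x. 0 \<le> g x"
    and int: "\<And>n. integrable M (\<lambda>w. g (Z n w))"
    and bound: "\<forall>\<^sub>F n in sequentially. (\<integral>w. g (Z n w) \<partial>M) \<le> C"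
  shows "integrable mu g" and "(\<integral>x. g x \<partial>mu) \<le> C"
proof -
  interpret M: prob_space M by fact
  interpret mu: prob_space mu by fact
  have [measurable]: "g \<in> borel_measurable borel" using g(1) by (rule borel_measurable_continuous_onI)
  have [measurable]: "g \<in> borel_measurable mu" by (simp cong: measurable_cong_sets add: mu(2))
  define h where "h k x = min (real k) (g x)" for k x
  have h: "0 \<le> h k x" "h k x \<le> real k" "h k x \<le> g x" for k x using g(2) by (auto simp: h_def)
  have [measurable]: "h k \<in> borel_measurable mu" "h k \<in> borel_measurable borel" for k
    unfolding h_def by measurable
  have hle: "(\<integral>x. h k x \<partial>mu) \<le> C" for k
  proof (rule tendsto_upperbound)
    have "continuous_on UNIV (h k)" unfolding h_def using g(1) by (intro continuous_intros)
    moreover have "bounded (range (h k))"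
      by (rule boundedI[of _ "real k"]) (use h in auto)
    ultimately show "(\<lambda>n. \<integral>w. h k (Z n w) \<partial>M) \<longlonglongrightarrow> (\<integral>x. h k x \<partial>mu)"
      using conv by (simp add: converges_in_distribution_def)
    show "\<forall>\<^sub>F n in sequentially. (\<integral>w. h k (Z n w) \<partial>M) \<le> C"
      using bound
    proof eventually_elim
      case (elim n)
      have "integrable M (\<lambda>w. h k (Z n w))"
        by (rule Bochner_Integration.integrable_bound[OF int[of n]]) (use h g(2) in auto)
      then have "(\<integral>w. h k (Z n w) \<partial>M) \<le> (\<integral>w. g (Z n w) \<partial>M)"
        by (intro integral_mono int h)
      then show ?case using elim by simp
    qed
  qed simp
  have hint: "integrable mu (h k)" for k
    by (rule mu.integrable_const_bound[of _ "real k"]) (use h in auto)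
  have "incseq (\<lambda>k. \<integral>x. h k x \<partial>mu)"
    by (intro incseq_SucI integral_mono hint) (auto simp: h_def)
  then obtain L where L: "(\<lambda>k. \<integral>x. h k x \<partial>mu) \<longlonglongrightarrow> L" "\<And>k. (\<integral>x. h k x \<partial>mu) \<le> L"
    using hle incseq_convergent[of "\<lambda>k. \<integral>x. h k x \<partial>mu" C] by blast
  have lim: "(\<lambda>k. h k x) \<longlonglongrightarrow> g x" for x
  proof (rule tendsto_eventually)
    have "g x \<le> real k" if "nat \<lceil>g x\<rceil> \<le> k" for k using that by linarith
    then show "\<forall>\<^sub>F k in sequentially. h k x = g x"
      unfolding eventually_sequentially h_def by (intro exI[of _ "nat \<lceil>g x\<rceil>"]) auto
  qed
  have mono: "mono (\<lambda>k. h k x)" for x by (rule monoI) (auto simp: h_def)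
  have "has_bochner_integral mu g L"
    using hint mono lim L(1) by (intro has_bochner_integral_monotone_convergence) auto
  moreover have "L \<le> C" using hle by (intro LIMSEQ_le_const2[OF L(1)]) auto
  ultimately show "integrable mu g" "(\<integral>x. g x \<partial>mu) \<le> C"
    by (auto simp: has_bochner_integral_iff)
qed

text \<open>Bounded second moments of \<open>f (Z n)\<close> give uniform integrability: cutting
  \<open>f\<close> off at height \<open>K\<close> changes it by at most \<open>f ^ 2 / K\<close>,
  hence expectations by at most \<open>C / K\<close>, under all late \<open>Z n\<close> and under
  the limit law. Weak convergence handles the truncated function.\<close>

lemma expectations_convergeI:
  fixes Z :: "nat \<Rightarrow> 'w \<Rightarrow> real^'q" and f :: "real^'q \<Rightarrow> real"
  assumes M: "prob_space M" and mu: "prob_space mu" "sets mu = sets borel"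
    and conv: "converges_in_distribution M Z mu"
    and Z [measurable]: "\<And>n. Z n \<in> borel_measurable M"
    and f: "continuous_on UNIV f"
    and int: "\<And>n. integrable M (\<lambda>w. (f (Z n w))\<^sup>2)"
    and bound: "\<forall>\<^sub>F n in sequentially. (\<integral>w. (f (Z n w))\<^sup>2 \<partial>M) \<le> C"
  shows "expectations_converge M Z mu f"
proof -
  interpret M: prob_space M by fact
  interpret mu: prob_space mu by fact
  have [measurable]: "f \<in> borel_measurable borel" using f by (rule borel_measurable_continuous_onI)
  have [measurable]: "f \<in> borel_measurable mu" by (simp cong: measurable_cong_sets add: mu(2))
  have cont2: "continuous_on UNIV (\<lambda>x. (f x)\<^sup>2)" using f by (intro continuous_intros)
  have mu2: "integrable mu (\<lambda>x. (f x)\<^sup>2)" "(\<integral>x. (f x)\<^sup>2 \<partial>mu) \<le> C"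
    using integrable_of_weak_limit[OF M mu conv Z cont2 _ int bound] by auto
  have C: "0 \<le> C" by (rule order_trans[OF Bochner_Integration.integral_nonneg mu2(2)]) simp
  have intM: "integrable M (\<lambda>w. f (Z n w))" for n
    by (rule M.square_integrable_imp_integrable[OF _ int]) measurable
  have intmu: "integrable mu f"
    by (rule mu.square_integrable_imp_integrable[OF _ mu2(1)]) measurable
  define h where "h K x = max (- K) (min K (f x))" for K x
  have [measurable]: "h K \<in> borel_measurable borel" "h K \<in> borel_measurable mu" for K
    unfolding h_def by measurable
  have hb: "\<bar>h K x\<bar> \<le> K" if "0 < K" for K x using that by (auto simp: h_def)
  have hd: "\<bar>f x - h K x\<bar> \<le> (f x)\<^sup>2 / K" if K: "0 < K" for K x
  proof (cases "\<bar>f x\<bar> \<le> K")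
    case True
    then have "h K x = f x" by (auto simp: h_def)
    then show ?thesis using K by simp
  next
    case False
    then have "\<bar>f x - h K x\<bar> \<le> \<bar>f x\<bar>" using K by (auto simp: h_def)
    also have "\<dots> \<le> \<bar>f x\<bar> * \<bar>f x\<bar> / K"
      unfolding pos_le_divide_eq[OF K] using False by (intro mult_left_mono) auto
    finally show ?thesis by (simp add: power2_eq_square)
  qed
  \<comment> \<open>The measure is arbitrary because the estimate is applied both to
    \<open>M\<close> and to \<open>mu\<close>.\<close>
  have diff: "\<bar>(\<integral>x. \<phi> x \<partial>P) - (\<integral>x. \<psi> x \<partial>P)\<bar> \<le> C / K"
    if "integrable P \<phi>" "integrable P \<psi>" "integrable P (\<lambda>x. (\<phi> x)\<^sup>2)" "(\<integral>x. (\<phi> x)\<^sup>2 \<partial>P) \<le> C"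
      "0 < K" "\<And>x. \<bar>\<phi> x - \<psi> x\<bar> \<le> (\<phi> x)\<^sup>2 / K"
    for P :: "'c measure" and \<phi> \<psi> :: "'c \<Rightarrow> real" and K
  proof -
    have "\<bar>(\<integral>x. \<phi> x \<partial>P) - (\<integral>x. \<psi> x \<partial>P)\<bar> = \<bar>\<integral>x. \<phi> x - \<psi> x \<partial>P\<bar>" using that by simp
    also have "\<dots> \<le> (\<integral>x. \<bar>\<phi> x - \<psi> x\<bar> \<partial>P)" by (rule integral_abs_bound)
    also have "\<dots> \<le> (\<integral>x. (\<phi> x)\<^sup>2 / K \<partial>P)" using that by (intro integral_mono) auto
    also have "\<dots> \<le> C / K" using that by (simp add: divide_right_mono)
    finally show ?thesis .
  qed
  have "(\<lambda>n. \<integral>w. f (Z n w) \<partial>M) \<longlonglongrightarrow> (\<integral>x. f x \<partial>mu)"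
  proof (rule LIMSEQ_I)
    fix e :: real assume e: "0 < e"
    \<comment> \<open>Then \<open>C / K\<close> is below \<open>e / 4\<close>; the summand 1 keeps
      \<open>K\<close> positive if \<open>C = 0\<close>.\<close>
    define K where "K = 4 * (C + 1) / e"
    have K: "0 < K" using C e by (simp add: K_def)
    have CK: "C / K < e / 3" using C e by (simp add: K_def field_simps add_nonneg_pos)
    have cont: "continuous_on UNIV (h K)" unfolding h_def using f by (intro continuous_intros)
    have "bounded (range (h K))"
      by (rule boundedI[of _ K]) (use hb[OF K] in auto)
    then have "(\<lambda>n. \<integral>w. h K (Z n w) \<partial>M) \<longlonglongrightarrow> (\<integral>x. h K x \<partial>mu)"
      using conv cont by (simp add: converges_in_distribution_def)
    from tendstoD[OF this, of "e / 3"]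
    have "\<forall>\<^sub>F n in sequentially. \<bar>(\<integral>w. h K (Z n w) \<partial>M) - (\<integral>x. h K x \<partial>mu)\<bar> < e / 3"
      using e by (simp add: dist_real_def)
    then have "\<forall>\<^sub>F n in sequentially. norm ((\<integral>w. f (Z n w) \<partial>M) - (\<integral>x. f x \<partial>mu)) < e"
      using bound
    proof eventually_elim
      case (elim n)
      have "integrable M (\<lambda>w. h K (Z n w))" "integrable mu (h K)"
        using hb[OF K] by (auto intro!: M.integrable_const_bound[of _ K] mu.integrable_const_bound[of _ K])
      then have "\<bar>(\<integral>w. f (Z n w) \<partial>M) - (\<integral>w. h K (Z n w) \<partial>M)\<bar> \<le> C / K"
        "\<bar>(\<integral>x. f x \<partial>mu) - (\<integral>x. h K x \<partial>mu)\<bar> \<le> C / K"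
        using intM intmu int mu2 elim K hd by (auto intro!: diff)
      then show ?case using elim CK unfolding real_norm_def by linarith
    qed
    then show "\<exists>N. \<forall>n\<ge>N. norm ((\<integral>w. f (Z n w) \<partial>M) - (\<integral>x. f x \<partial>mu)) < e"
      by (simp add: eventually_sequentially)
  qed
  then show ?thesis using intM intmu by (simp add: expectations_converge_def)
qed

text \<open>The square of every function in \<open>all_moments_converge\<close> is at most
  \<open>1 + norm x ^ (2 * m)\<close> for some \<open>m\<close>, so even moments of the norm control
  all of them. The 1 covers \<open>norm x < 1\<close>, where the larger exponent
  \<open>2 * m\<close> gives the smaller power.\<close>

lemma all_moments_convergeI:
  fixes Z :: "nat \<Rightarrow> 'w \<Rightarrow> real^'q"
  assumes M: "prob_space M" and mu: "prob_space mu" "sets mu = sets borel"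
    and conv: "converges_in_distribution M Z mu"
    and Z [measurable]: "\<And>n. Z n \<in> borel_measurable M"
    and int: "\<And>m n. integrable M (\<lambda>w. norm (Z n w) ^ (2 * m))"
    and bound: "\<And>m. \<exists>C. \<forall>\<^sub>F n in sequentially. (\<integral>w. norm (Z n w) ^ (2 * m) \<partial>M) \<le> C"
  shows "all_moments_converge M Z mu"
proof -
  interpret M: prob_space M by fact
  have dom: "expectations_converge M Z mu f"
    if f: "continuous_on UNIV f" and le: "\<And>x. (f x)\<^sup>2 \<le> 1 + norm x ^ (2 * m)" for f m
  proof -
    have [measurable]: "f \<in> borel_measurable borel" using f by (rule borel_measurable_continuous_onI)
    obtain C where C: "\<forall>\<^sub>F n in sequentially. (\<integral>w. norm (Z n w) ^ (2 * m) \<partial>M) \<le> C"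
      using bound by blast
    have i1: "integrable M (\<lambda>w. 1 + norm (Z n w) ^ (2 * m))" for n using int by simp
    have i2: "integrable M (\<lambda>w. (f (Z n w))\<^sup>2)" for n
      by (rule Bochner_Integration.integrable_bound[OF i1[of n]])
        (use le in \<open>auto simp: order_trans[OF le abs_ge_self]\<close>)
    show ?thesis
    proof (rule expectations_convergeI[OF M mu conv Z f i2])
      show "\<forall>\<^sub>F n in sequentially. (\<integral>w. (f (Z n w))\<^sup>2 \<partial>M) \<le> 1 + C"
        using C
      proof eventually_elim
        case (elim n)
        have "(\<integral>w. (f (Z n w))\<^sup>2 \<partial>M) \<le> (\<integral>w. 1 + norm (Z n w) ^ (2 * m) \<partial>M)"
          by (intro integral_mono i1 i2 le)
        then show ?case using elim int by (simp add: M.prob_space)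
      qed
    qed
  qed
  show ?thesis
    unfolding all_moments_converge_def
  proof (intro conjI allI impI)
    fix k :: "'q \<Rightarrow> nat"
    have "(\<Prod>i\<in>UNIV. (x $ i) ^ k i)\<^sup>2 \<le> norm x ^ (2 * (\<Sum>i\<in>UNIV. k i))" for x :: "real^'q"
    proof -
      have "(\<Prod>i\<in>UNIV. (x $ i) ^ k i)\<^sup>2 = (\<Prod>i\<in>UNIV. \<bar>x $ i\<bar> ^ (2 * k i))"
        by (simp add: prod_power_distrib power_mult[symmetric] power_even_abs mult.commute)
      also have "\<dots> \<le> (\<Prod>i\<in>UNIV. norm x ^ (2 * k i))"
        by (intro prod_mono conjI power_mono component_le_norm_cart) auto
      also have "\<dots> = norm x ^ (2 * (\<Sum>i\<in>UNIV. k i))"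
        by (simp add: power_sum[symmetric] sum_distrib_left)
      finally show ?thesis .
    qed
    then show "expectations_converge M Z mu (\<lambda>x. \<Prod>i\<in>UNIV. (x $ i) ^ k i)"
      by (intro dom[of _ "\<Sum>i\<in>UNIV. k i"] continuous_intros) (simp add: add_increasing)
  next
    fix r :: real assume r: "0 < r"
    define m where "m = nat \<lceil>r\<rceil>"
    have "(norm x powr r)\<^sup>2 \<le> 1 + norm x ^ (2 * m)" for x :: "real^'q"
    proof (cases "norm x \<le> 1")
      case True
      then have "norm x powr r \<le> 1" using r by (intro powr_le1) auto
      then have "(norm x powr r)\<^sup>2 \<le> 1" by (intro power_le_one) auto
      then show ?thesis by (simp add: add_increasing2)
    next
      case False
      then have "(norm x powr r)\<^sup>2 = norm x powr (2 * r)" by (simp add: power2_eq_square powr_add[symmetric])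
      also have "\<dots> \<le> norm x powr real (2 * m)"
        using False of_nat_ceiling[of r] by (intro powr_mono) (auto simp: m_def)
      also have "\<dots> = norm x ^ (2 * m)" using False by (intro powr_realpow) auto
      finally show ?thesis by simp
    qed
    then show "expectations_converge M Z mu (\<lambda>x. norm x powr r)"
      using r by (intro dom[of _ m] continuous_on_powr' continuous_intros) auto
  qed
qed

section \<open>Covariance of the limit law\<close>

text \<open>\<open>centred_normal\<close> speaks of one-dimensional projections; the mean is read
  off the projection to a coordinate axis. It turns \<open>cov_matrix mu\<close> into plain second
  moments.\<close>

lemma centred_normal_mean:
  fixes mu :: "(real^'q) measure"
  assumes "centred_normal S mu"
  shows "(\<integral>x. x $ i \<partial>mu) = 0"
proof -
  from assms obtain s where s: "0 \<le> s" "distr mu borel (\<lambda>x. axis i 1 \<bullet> x) = normal_law s"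
    unfolding centred_normal_def by blast
  have [measurable]: "(\<lambda>x. axis i 1 \<bullet> x) \<in> borel_measurable mu"
    using assms by (simp cong: measurable_cong_sets add: centred_normal_def)
  have "(\<integral>x. x $ i \<partial>mu) = (\<integral>x. axis i 1 \<bullet> x \<partial>mu)" by (simp add: inner_axis')
  also have "\<dots> = (\<integral>t. t \<partial>distr mu borel (\<lambda>x. axis i 1 \<bullet> x))" by (simp add: integral_distr)
  also have "\<dots> = 0"
    using s integral_normal_moment_nz_1[of s 0]
    by (auto simp: normal_law_def integral_return integral_density)
  finally show ?thesis .
qed

lemma second_moments_converge:
  fixes Z :: "nat \<Rightarrow> 'w \<Rightarrow> real^'q"
  assumes conv: "all_moments_converge M Z mu" and mu: "centred_normal S mu"
  shows "(\<lambda>n. \<chi> i j. \<integral>w. Z n w $ i * Z n w $ j \<partial>M) \<longlonglongrightarrow> S"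
proof (intro vec_tendstoI)
  fix i j :: 'q
  \<comment> \<open>The sum of two indicators covers the case \<open>i = j\<close>, where the
    exponent is 2.\<close>
  define k where "k l = of_bool (l = i) + (of_bool (l = j) :: nat)" for l
  have eq: "(\<Prod>l\<in>UNIV. (x $ l) ^ k l) = x $ i * x $ j" for x :: "real^'q"
  proof -
    have "(\<Prod>l\<in>UNIV. (x $ l) ^ k l) = (\<Prod>l\<in>UNIV. (if l = i then x $ l else 1) * (if l = j then x $ l else 1))"
      by (intro prod.cong refl) (auto simp: k_def power_add)
    then show ?thesis by (simp add: prod.distrib)
  qed
  have "(\<lambda>n. \<integral>w. Z n w $ i * Z n w $ j \<partial>M) \<longlonglongrightarrow> (\<integral>x. x $ i * x $ j \<partial>mu)"
  proof -
    have "expectations_converge M Z mu (\<lambda>x. \<Prod>l\<in>UNIV. (x $ l) ^ k l)"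
      using conv unfolding all_moments_converge_def by blast
    then show ?thesis unfolding eq expectations_converge_def by blast
  qed
  moreover have "(\<integral>x. x $ i * x $ j \<partial>mu) = S $ i $ j"
    using mu centred_normal_mean[OF mu] by (auto simp: centred_normal_def cov_matrix_def)
  ultimately show "(\<lambda>n. (\<chi> i j. \<integral>w. Z n w $ i * Z n w $ j \<partial>M) $ i $ j) \<longlonglongrightarrow> S $ i $ j"
    by simp
qed

section \<open>Increments of the urn\<close>

text \<open>The sum is at most \<open>card A\<close> times its largest term. The exponent is a
  successor because the inequality fails for \<open>A = {}\<close> and exponent 0.\<close>

lemma sum_power_le:
  fixes x :: "'i \<Rightarrow> real"
  assumes "finite A" "\<And>i. i \<in> A \<Longrightarrow> 0 \<le> x i"
  shows "(\<Sum>i\<in>A. x i) ^ Suc m \<le> real (card A) ^ Suc m * (\<Sum>i\<in>A. x i ^ Suc m)"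
proof (cases "A = {}")
  case False
  define y where "y = Max (x ` A)"
  have "y \<in> x ` A" unfolding y_def using assms(1) False by (intro Max_in) auto
  then obtain j where j: "j \<in> A" "y = x j" by blast
  have "(\<Sum>i\<in>A. x i) \<le> real (card A) * y"
    using assms(1) by (intro sum_bounded_above) (simp add: y_def)
  then have "(\<Sum>i\<in>A. x i) ^ Suc m \<le> (real (card A) * y) ^ Suc m"
    by (intro power_mono sum_nonneg assms)
  also have "\<dots> = real (card A) ^ Suc m * x j ^ Suc m" by (simp only: power_mult_distrib j)
  also have "x j ^ Suc m \<le> (\<Sum>i\<in>A. x i ^ Suc m)"
    using assms j by (intro member_le_sum[of j A]) auto
  finally show ?thesis by (simp add: mult_left_mono)
qed simp

lemma add_power_le:
  fixes x y :: real
  assumes "0 \<le> x" "0 \<le> y"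
  shows "(x + y) ^ m \<le> 2 ^ m * (x ^ m + y ^ m)"
proof -
  have "(x + y) ^ m \<le> (2 * max x y) ^ m" using assms by (intro power_mono) auto
  also have "\<dots> = 2 ^ m * max x y ^ m" by (rule power_mult_distrib)
  also have "max x y ^ m \<le> x ^ m + y ^ m" using assms by (auto simp: max_def)
  finally show ?thesis by (simp add: mult_left_mono)
qed

lemma integrable_of_le:
  fixes f g :: "'a \<Rightarrow> real"
  assumes "integrable M g" "f \<in> borel_measurable M" "\<And>x. 0 \<le> f x" "\<And>x. f x \<le> g x"
  shows "integrable M f"
  by (rule Bochner_Integration.integrable_bound[OF assms(1,2)])
    (rule AE_I2, simp add: assms(3) order_trans[OF assms(4) abs_ge_self])

lemma sqrt_power_even: "0 \<le> x \<Longrightarrow> sqrt x ^ (2 * m) = x ^ m"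
  by (simp add: power_mult)

lemma vec_nth_borel [measurable]: "(\<lambda>x::real^'q. x $ i) \<in> borel_measurable borel"
  by (intro borel_measurable_continuous_onI continuous_intros)

lemma linear_borel:
  fixes f :: "'b::euclidean_space \<Rightarrow> 'c::euclidean_space"
  shows "linear f \<Longrightarrow> f \<in> borel_measurable borel"
  by (intro borel_measurable_continuous_onI linear_continuous_on) (simp add: linear_conv_bounded_linear)

locale balanced_urn = polya_urn M N F a xi x0 X I
  for M :: "'w measure" and N :: "'v measure" and F :: "nat \<Rightarrow> 'w measure"
    and a :: "real^'q" and xi :: "'q \<Rightarrow> 'v \<Rightarrow> real^'q" and x0 :: "real^'q"
    and X :: "nat \<Rightarrow> 'w \<Rightarrow> real^'q" and I :: "nat \<Rightarrow> 'w \<Rightarrow> 'q" +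
  fixes b :: real
  assumes tenable: "tenable M a X" and balanced: "balanced N a xi b"
    and moments: "\<And>i j p. 1 \<le> p \<Longrightarrow> integrable N (\<lambda>v. \<bar>xi i v $ j\<bar> powr p)"
begin

definition jump :: "nat \<Rightarrow> 'w \<Rightarrow> real^'q" where "jump n w = X (Suc n) w - X n w"

definition draw_prob :: "nat \<Rightarrow> 'q \<Rightarrow> 'w \<Rightarrow> real" where
  "draw_prob n i w = a $ i * X n w $ i / (\<Sum>j\<in>UNIV. a $ j * X n w $ j)"

definition activity :: "nat \<Rightarrow> real" where "activity n = a \<bullet> x0 + real n * b"

abbreviation B :: "real^'q^'q" where "B \<equiv> intensity_matrix N a xi"

text \<open>The conditional mean of \<open>jump n\<close> given \<open>F n\<close>, in a form that
  is linear in \<open>X n\<close> at every point because the denominator is deterministic.\<close>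

definition drift :: "nat \<Rightarrow> 'w \<Rightarrow> real^'q" where "drift n w = (1 / activity n) *\<^sub>R (B *v X n w)"

definition noise :: "nat \<Rightarrow> 'w \<Rightarrow> real^'q" where "noise n w = jump n w - drift n w"

definition Y :: "nat \<Rightarrow> 'w \<Rightarrow> real^'q" where "Y n w = X n w - (\<integral>w. X n w \<partial>M)"

lemma F_measurable: "f \<in> measurable (F n) K \<Longrightarrow> f \<in> measurable M K"
  by (rule measurable_from_subalg[OF past_subalgebra])

declare X_adapted [measurable]

lemma X_M [measurable]: "X n \<in> borel_measurable M"
  by (rule F_measurable[OF X_adapted])

lemma I_M [measurable]: "I (Suc n) \<in> measurable M (count_space UNIV)"
  by (rule F_measurable[OF I_adapted])

lemma jump_M [measurable]: "jump n \<in> borel_measurable M"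
  unfolding jump_def[abs_def] by measurable

lemma draw_prob_F [measurable]: "draw_prob n i \<in> borel_measurable (F n)"
  unfolding draw_prob_def[abs_def] by measurable

lemma draw_prob_M [measurable]: "draw_prob n i \<in> borel_measurable M"
  by (rule F_measurable[OF draw_prob_F])

lemma draw_prob_simplex:
  "AE w in M. (\<forall>i. 0 \<le> draw_prob n i w \<and> draw_prob n i w \<le> 1) \<and> (\<Sum>i\<in>UNIV. draw_prob n i w) = 1"
  using tenable[unfolded tenable_def, rule_format, of n]
proof eventually_elim
  case (elim w)
  then have nn: "0 \<le> draw_prob n i w" for i
    using activity_nonneg by (auto simp: draw_prob_def intro!: divide_nonneg_nonneg)
  have one: "(\<Sum>i\<in>UNIV. draw_prob n i w) = 1"
    using elim by (simp add: draw_prob_def sum_divide_distrib[symmetric])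
  moreover have "draw_prob n i w \<le> (\<Sum>i\<in>UNIV. draw_prob n i w)" for i
    using nn by (intro member_le_sum) auto
  ultimately show ?case using nn by simp
qed

lemma integrable_mult_draw_prob:
  assumes "integrable M W" shows "integrable M (\<lambda>w. W w * draw_prob n i w)"
proof (rule Bochner_Integration.integrable_bound[OF assms])
  show "AE w in M. norm (W w * draw_prob n i w) \<le> norm (W w)"
    using draw_prob_simplex[of n]
    by eventually_elim (simp add: abs_mult mult_left_le)
qed (use assms in measurable)

lemma integral_draw_prob_nonneg:
  assumes "\<And>w. 0 \<le> W w" shows "0 \<le> (\<integral>w. W w * draw_prob n i w \<partial>M)"
proof (rule integral_nonneg_AE)
  show "AE w in M. 0 \<le> W w * draw_prob n i w"
    using draw_prob_simplex[of n] by eventually_elim (simp add: assms)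
qed

lemma sum_integral_draw_prob:
  assumes "integrable M W"
  shows "(\<Sum>i\<in>UNIV. \<integral>w. W w * draw_prob n i w \<partial>M) = (\<integral>w. W w \<partial>M)"
proof -
  have "(\<Sum>i\<in>UNIV. \<integral>w. W w * draw_prob n i w \<partial>M) = (\<integral>w. (\<Sum>i\<in>UNIV. W w * draw_prob n i w) \<partial>M)"
    by (rule Bochner_Integration.integral_sum[symmetric]) (rule integrable_mult_draw_prob[OF assms])
  also have "\<dots> = (\<integral>w. W w \<partial>M)"
  proof (rule integral_cong_AE)
    show "AE w in M. (\<Sum>i\<in>UNIV. W w * draw_prob n i w) = W w"
      using draw_prob_simplex[of n] by eventually_elim (simp add: sum_distrib_left[symmetric])
  qed (use assms in measurable)
  finally show ?thesis .
qed

section \<open>Integrals of functions of the jump against weights from the past\<close>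

text \<open>Integrating \<open>increment\<close> and \<open>draw\<close> against an
  \<open>F n\<close>-measurable weight removes the conditional expectations. All later facts about
  the dynamics rest on this integrated form.\<close>

lemma integral_indicator_jump:
  assumes W: "W \<in> borel_measurable (F n)" "integrable M W" and E: "E \<in> sets borel"
  shows "(\<integral>w. W w * indicat_real {w \<in> space M. I (Suc n) w = i \<and> jump n w \<in> E} w \<partial>M)
    = (\<integral>w. W w * draw_prob n i w \<partial>M) * measure N {v \<in> space N. xi i v \<in> E}"
proof -
  interpret S: finite_measure_subalgebra M "F n"
    by (simp add: finite_measure_subalgebra_def finite_measure_subalgebra_axioms_def
        past_subalgebra M.finite_measure_axioms)
  let ?A = "{w \<in> space M. I (Suc n) w = i \<and> jump n w \<in> E}"
  have [measurable]: "?A \<in> sets M" using E by measurable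
  have WM: "W \<in> borel_measurable M" by (rule F_measurable[OF W(1)])
  have int: "integrable M (\<lambda>w. W w * indicat_real ?A w)"
    using integrable_mult_indicator[of ?A M W] W(2) by (simp add: mult.commute)
  have "(\<integral>w. W w * indicat_real ?A w \<partial>M) = (\<integral>w. W w * real_cond_exp M (F n) (indicat_real ?A) w \<partial>M)"
    by (rule S.real_cond_exp_intg(2)[OF int W(1), symmetric]) measurable
  also have "\<dots> = (\<integral>w. W w * draw_prob n i w * measure N {v \<in> space N. xi i v \<in> E} \<partial>M)"
  proof (rule integral_cong_AE)
    show "AE w in M. W w * real_cond_exp M (F n) (indicat_real ?A) w =
        W w * draw_prob n i w * measure N {v \<in> space N. xi i v \<in> E}"
      using increment[OF E, of n i] draw[of n i]
      by eventually_elim (simp add: jump_def draw_prob_def)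
  qed (use WM in measurable)
  finally show ?thesis by simp
qed

text \<open>Under the measure with density \<open>W\<close> on the event that colour
  \<open>i\<close> is drawn, the law of the jump is a multiple of the law of \<open>xi i\<close>.
  Comparing the two measures on Borel sets yields all nonnegative \<open>h\<close> at once.\<close>

lemma nn_integral_jump_colour:
  assumes W: "W \<in> borel_measurable (F n)" "integrable M W" "\<And>w. 0 \<le> W w"
    and h [measurable]: "h \<in> borel_measurable borel"
  shows "(\<integral>\<^sup>+w. ennreal (W w) * indicator {w \<in> space M. I (Suc n) w = i} w * h (jump n w) \<partial>M)
    = ennreal (\<integral>w. W w * draw_prob n i w \<partial>M) * (\<integral>\<^sup>+v. h (xi i v) \<partial>N)"
proof -
  have [measurable]: "W \<in> borel_measurable M" by (rule F_measurable[OF W(1)])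
  note [measurable] = xi_measurable
  let ?f = "\<lambda>w. ennreal (W w) * indicator {w \<in> space M. I (Suc n) w = i} w"
  let ?c = "\<integral>w. W w * draw_prob n i w \<partial>M"
  have eq: "distr (density M ?f) borel (jump n) = scale_measure (ennreal ?c) (distr N borel (xi i))"
  proof (rule measure_eqI)
    fix E assume "E \<in> sets (distr (density M ?f) borel (jump n))"
    then have E [measurable]: "E \<in> sets borel" by simp
    let ?A = "{w \<in> space M. I (Suc n) w = i \<and> jump n w \<in> E}"
    have [measurable]: "?A \<in> sets M" by measurable
    have int: "integrable M (\<lambda>w. W w * indicat_real ?A w)"
      using integrable_mult_indicator[of ?A M W] W(2) by (simp add: mult.commute)
    have "emeasure (distr (density M ?f) borel (jump n)) E
        = (\<integral>\<^sup>+w. ?f w * indicator (jump n -` E \<inter> space M) w \<partial>M)"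
      by (simp add: emeasure_distr emeasure_density)
    also have "\<dots> = (\<integral>\<^sup>+w. ennreal (W w * indicat_real ?A w) \<partial>M)"
      by (intro nn_integral_cong) (auto split: split_indicator)
    also have "\<dots> = ennreal (\<integral>w. W w * indicat_real ?A w \<partial>M)"
      using W(3) by (intro nn_integral_eq_integral int) auto
    also have "\<dots> = ennreal ?c * ennreal (measure N {v \<in> space N. xi i v \<in> E})"
      unfolding integral_indicator_jump[OF W(1,2) E]
      by (intro ennreal_mult integral_draw_prob_nonneg W(3)) simp
    also have "\<dots> = emeasure (scale_measure (ennreal ?c) (distr N borel (xi i))) E"
    proof -
      have "xi i -` E \<inter> space N = {v \<in> space N. xi i v \<in> E}" by auto
      then show ?thesis by (simp add: emeasure_distr N.emeasure_eq_measure)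
    qed
    finally show "emeasure (distr (density M ?f) borel (jump n)) E =
        emeasure (scale_measure (ennreal ?c) (distr N borel (xi i))) E" .
  qed simp
  have "(\<integral>\<^sup>+w. ?f w * h (jump n w) \<partial>M) = (\<integral>\<^sup>+x. h x \<partial>distr (density M ?f) borel (jump n))"
    by (simp add: nn_integral_distr nn_integral_density)
  also have "\<dots> = ennreal ?c * (\<integral>\<^sup>+v. h (xi i v) \<partial>N)"
    unfolding eq by (simp add: nn_integral_scale_measure nn_integral_distr)
  finally show ?thesis .
qed

lemma nn_integral_jump:
  assumes W: "W \<in> borel_measurable (F n)" "integrable M W" "\<And>w. 0 \<le> W w"
    and h [measurable]: "h \<in> borel_measurable borel"
  shows "(\<integral>\<^sup>+w. ennreal (W w) * h (jump n w) \<partial>M)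
    = (\<Sum>i\<in>UNIV. ennreal (\<integral>w. W w * draw_prob n i w \<partial>M) * (\<integral>\<^sup>+v. h (xi i v) \<partial>N))"
proof -
  have [measurable]: "W \<in> borel_measurable M" by (rule F_measurable[OF W(1)])
  have "(\<integral>\<^sup>+w. ennreal (W w) * h (jump n w) \<partial>M)
    = (\<integral>\<^sup>+w. (\<Sum>i\<in>UNIV. ennreal (W w) * indicator {w \<in> space M. I (Suc n) w = i} w * h (jump n w)) \<partial>M)"
  proof (rule nn_integral_cong)
    fix w assume "w \<in> space M"
    then have "(\<Sum>i\<in>UNIV. ennreal (W w) * indicator {w \<in> space M. I (Suc n) w = i} w * h (jump n w))
      = (\<Sum>i\<in>UNIV. if i = I (Suc n) w then ennreal (W w) * h (jump n w) else 0)"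
      by (intro sum.cong) auto
    then show "ennreal (W w) * h (jump n w) =
      (\<Sum>i\<in>UNIV. ennreal (W w) * indicator {w \<in> space M. I (Suc n) w = i} w * h (jump n w))"
      by simp
  qed
  also have "\<dots> = (\<Sum>i\<in>UNIV. \<integral>\<^sup>+w. ennreal (W w) * indicator {w \<in> space M. I (Suc n) w = i} w * h (jump n w) \<partial>M)"
    by (rule nn_integral_sum) measurable
  also have "\<dots> = (\<Sum>i\<in>UNIV. ennreal (\<integral>w. W w * draw_prob n i w \<partial>M) * (\<integral>\<^sup>+v. h (xi i v) \<partial>N))"
    by (intro sum.cong refl nn_integral_jump_colour W h)
  finally show ?thesis .
qed

lemma integral_jump_nonneg:
  assumes W: "W \<in> borel_measurable (F n)" "integrable M W" "\<And>w. 0 \<le> W w"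
    and h [measurable]: "h \<in> borel_measurable borel" and h0: "\<And>x. 0 \<le> h x"
    and hi: "\<And>i. integrable N (\<lambda>v. h (xi i v))"
  shows "integrable M (\<lambda>w. W w * h (jump n w))"
    and "(\<integral>w. W w * h (jump n w) \<partial>M)
      = (\<Sum>i\<in>UNIV. (\<integral>w. W w * draw_prob n i w \<partial>M) * (\<integral>v. h (xi i v) \<partial>N))"
proof -
  have [measurable]: "W \<in> borel_measurable M" by (rule F_measurable[OF W(1)])
  let ?S = "\<Sum>i\<in>UNIV. (\<integral>w. W w * draw_prob n i w \<partial>M) * (\<integral>v. h (xi i v) \<partial>N)"
  have S: "0 \<le> ?S"
    by (intro sum_nonneg mult_nonneg_nonneg integral_draw_prob_nonneg W(3)
        Bochner_Integration.integral_nonneg h0)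
  have "(\<integral>\<^sup>+w. ennreal (W w * h (jump n w)) \<partial>M) = (\<integral>\<^sup>+w. ennreal (W w) * ennreal (h (jump n w)) \<partial>M)"
    by (simp add: ennreal_mult W(3) h0)
  also have "\<dots> = (\<Sum>i\<in>UNIV. ennreal (\<integral>w. W w * draw_prob n i w \<partial>M) * (\<integral>\<^sup>+v. ennreal (h (xi i v)) \<partial>N))"
    by (rule nn_integral_jump[OF W]) measurable
  also have "\<dots> = (\<Sum>i\<in>UNIV. ennreal ((\<integral>w. W w * draw_prob n i w \<partial>M) * (\<integral>v. h (xi i v) \<partial>N)))"
    using h0 by (intro sum.cong refl) (simp add: nn_integral_eq_integral[OF hi] ennreal_mult
        integral_draw_prob_nonneg W(3) Bochner_Integration.integral_nonneg)
  also have "\<dots> = ennreal ?S"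
    by (intro sum_ennreal mult_nonneg_nonneg integral_draw_prob_nonneg W(3)
        Bochner_Integration.integral_nonneg h0)
  finally have nn: "(\<integral>\<^sup>+w. ennreal (W w * h (jump n w)) \<partial>M) = ennreal ?S" .
  have "has_bochner_integral M (\<lambda>w. W w * h (jump n w)) ?S"
    by (rule has_bochner_integral_nn_integral[OF _ _ S nn]) (use W(3) h0 in auto)
  then show "integrable M (\<lambda>w. W w * h (jump n w))" "(\<integral>w. W w * h (jump n w) \<partial>M) = ?S"
    by (auto simp: has_bochner_integral_iff)
qed

lemma integral_jump:
  assumes W: "W \<in> borel_measurable (F n)" "integrable M W"
    and h [measurable]: "h \<in> borel_measurable borel" and hi: "\<And>i. integrable N (\<lambda>v. h (xi i v))"
  shows "integrable M (\<lambda>w. W w * h (jump n w))"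
    and "(\<integral>w. W w * h (jump n w) \<partial>M)
      = (\<Sum>i\<in>UNIV. (\<integral>w. W w * draw_prob n i w \<partial>M) * (\<integral>v. h (xi i v) \<partial>N))"
proof -
  \<comment> \<open>Signs are removed in two stages: \<open>right\<close> splits \<open>h\<close>
    into positive and negative part for a nonnegative weight, then the weight itself is
    split.\<close>
  define J where "J V g \<longleftrightarrow> integrable M (\<lambda>w. V w * g (jump n w)) \<and> (\<integral>w. V w * g (jump n w) \<partial>M)
      = (\<Sum>i\<in>UNIV. (\<integral>w. V w * draw_prob n i w \<partial>M) * (\<integral>v. g (xi i v) \<partial>N))" for V g
  have right: "J V h" if V: "V \<in> borel_measurable (F n)" "integrable M V" "\<And>w. 0 \<le> V w" for V
  proof -
    let ?p = "\<lambda>x. max 0 (h x)" and ?m = "\<lambda>x. max 0 (- h x)"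
    have i: "integrable N (\<lambda>v. ?p (xi i v))" "integrable N (\<lambda>v. ?m (xi i v))" for i
      using hi[of i] by auto
    have p: "J V ?p" and m: "J V ?m"
      unfolding J_def using i by (auto intro!: integral_jump_nonneg V)
    have hh: "h x = ?p x - ?m x" for x by simp
    have "(\<integral>v. h (xi i v) \<partial>N) = (\<integral>v. ?p (xi i v) \<partial>N) - (\<integral>v. ?m (xi i v) \<partial>N)" for i
      by (subst hh, rule Bochner_Integration.integral_diff[OF i])
    moreover have eq: "(\<lambda>w. V w * h (jump n w)) = (\<lambda>w. V w * ?p (jump n w) - V w * ?m (jump n w))"
      by (subst hh) (simp add: right_diff_distrib)
    ultimately show ?thesis
      using p m unfolding J_def eq by (simp add: right_diff_distrib sum_subtractf)
  qed
  let ?p = "\<lambda>x. max 0 (W x)" and ?m = "\<lambda>x. max 0 (- W x)"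
  have i: "integrable M ?p" "integrable M ?m" using W(2) by auto
  have p: "J ?p h" and m: "J ?m h" using W(1) i by (auto intro!: right)
  have WW: "W w = ?p w - ?m w" for w by simp
  have "(\<integral>w. W w * draw_prob n i w \<partial>M) = (\<integral>w. ?p w * draw_prob n i w \<partial>M) - (\<integral>w. ?m w * draw_prob n i w \<partial>M)" for i
    by (subst WW, simp only: left_diff_distrib,
        rule Bochner_Integration.integral_diff[OF integrable_mult_draw_prob[OF i(1)] integrable_mult_draw_prob[OF i(2)]])
  moreover have eq: "(\<lambda>w. W w * h (jump n w)) = (\<lambda>w. ?p w * h (jump n w) - ?m w * h (jump n w))"
    by (subst WW) (simp add: left_diff_distrib)
  ultimately have "J W h"
    using p m unfolding J_def eq by (simp add: left_diff_distrib sum_subtractf)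
  then show "integrable M (\<lambda>w. W w * h (jump n w))"
    "(\<integral>w. W w * h (jump n w) \<partial>M)
      = (\<Sum>i\<in>UNIV. (\<integral>w. W w * draw_prob n i w \<partial>M) * (\<integral>v. h (xi i v) \<partial>N))"
    by (auto simp: J_def)
qed

section \<open>Means of the replacement vectors and the deterministic activity\<close>

lemma xi_norm_power_integrable: "integrable N (\<lambda>v. norm (xi i v) ^ m)"
proof (cases m)
  case (Suc k)
  note [measurable] = xi_measurable
  let ?c = "real CARD('q) ^ Suc k"
  have comp: "integrable N (\<lambda>v. \<bar>xi i v $ j\<bar> ^ Suc k)" for j
  proof -
    have "\<bar>xi i v $ j\<bar> powr real (Suc k) = \<bar>xi i v $ j\<bar> ^ Suc k" for v
      by (rule powr_realpow') auto
    then show ?thesis using moments[of "real (Suc k)" i j] by simp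
  qed
  have int: "integrable N (\<lambda>v. ?c * (\<Sum>j\<in>UNIV. \<bar>xi i v $ j\<bar> ^ Suc k))"
    by (intro integrable_mult_right Bochner_Integration.integrable_sum comp)
  have le: "norm (xi i v) ^ Suc k \<le> ?c * (\<Sum>j\<in>UNIV. \<bar>xi i v $ j\<bar> ^ Suc k)" for v
  proof -
    have "norm (xi i v) ^ Suc k \<le> (\<Sum>j\<in>UNIV. \<bar>xi i v $ j\<bar>) ^ Suc k"
      by (intro power_mono norm_le_l1_cart) simp
    also have "\<dots> \<le> ?c * (\<Sum>j\<in>UNIV. \<bar>xi i v $ j\<bar> ^ Suc k)"
      by (intro sum_power_le) auto
    finally show ?thesis .
  qed
  show ?thesis
    unfolding Suc
    by (rule integrable_of_le[OF int _ _ le]) auto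
qed simp

lemma xi_integrable: "integrable N (xi i)"
  using xi_norm_power_integrable[of i 1] xi_measurable[of i] by (simp add: integrable_norm_iff)

definition xi_mean :: "'q \<Rightarrow> real^'q" where "xi_mean i = (\<integral>v. xi i v \<partial>N)"

lemma xi_linear:
  fixes f :: "real^'q \<Rightarrow> 'c::euclidean_space"
  assumes "linear f"
  shows "integrable N (\<lambda>v. f (xi i v))" "(\<integral>v. f (xi i v) \<partial>N) = f (xi_mean i)"
proof -
  have f: "bounded_linear f" using assms by (simp add: linear_conv_bounded_linear)
  show "integrable N (\<lambda>v. f (xi i v))" by (rule integrable_bounded_linear[OF f xi_integrable])
  show "(\<integral>v. f (xi i v) \<partial>N) = f (xi_mean i)"
    unfolding xi_mean_def by (rule integral_bounded_linear[OF f xi_integrable])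
qed

lemma B_mult: "B *v x = (\<Sum>i\<in>UNIV. (a $ i * x $ i) *\<^sub>R xi_mean i)"
proof -
  have lin: "linear (\<lambda>x::real^'q. x $ j)" for j by (intro linearI) auto
  have "xi_mean i $ j = (\<integral>v. xi i v $ j \<partial>N)" for i j
    using xi_linear(2)[OF lin] by simp
  then have "(B *v x) $ k = (\<Sum>i\<in>UNIV. (a $ i * x $ i) *\<^sub>R xi_mean i) $ k" for k
    by (simp add: matrix_vector_mult_def intensity_matrix_def mult_ac)
  then show ?thesis unfolding Finite_Cartesian_Product.vec_eq_iff by blast
qed

lemma b_pos: "0 < b"
  using balanced by (simp add: balanced_def)

lemma a_xi_mean: "a \<bullet> xi_mean i = b"
proof -
  have lin: "linear (\<lambda>x. a \<bullet> x)" by (intro linearI) (auto simp: inner_right_distrib)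
  have "AE v in N. a \<bullet> xi i v = b" using balanced by (simp add: balanced_def inner_vec_def)
  then have "(\<integral>v. a \<bullet> xi i v \<partial>N) = (\<integral>v. b \<partial>N)"
    using xi_measurable by (intro integral_cong_AE) auto
  then show ?thesis using xi_linear(2)[OF lin, of i] by (simp add: N.prob_space)
qed

lemma a_B: "a \<bullet> (B *v x) = b * (a \<bullet> x)"
proof -
  have "a \<bullet> (B *v x) = (\<Sum>i\<in>UNIV. a $ i * x $ i * b)"
    by (simp add: B_mult inner_sum_right a_xi_mean)
  then show ?thesis by (simp add: inner_vec_def sum_distrib_left mult_ac)
qed

lemma activity_Suc: "activity (Suc n) = activity n + b"
  by (simp add: activity_def algebra_simps)

text \<open>Balance is a statement about \<open>xi\<close> on \<open>N\<close>. Applying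
  \<open>nn_integral_jump\<close> with weight 1 to the indicator of \<open>?E\<close> carries the
  null set over to the jump on \<open>M\<close>.\<close>

lemma AE_activity: "AE w in M. a \<bullet> X n w = activity n"
proof (induction n)
  case 0
  show ?case using initial by eventually_elim (simp add: activity_def)
next
  case (Suc n)
  let ?E = "{x. a \<bullet> x \<noteq> b}"
  have [measurable]: "?E \<in> sets borel" by measurable
  have "(\<integral>\<^sup>+w. ennreal 1 * indicator ?E (jump n w) \<partial>M)
    = (\<Sum>i\<in>UNIV. ennreal (\<integral>w. 1 * draw_prob n i w \<partial>M) * (\<integral>\<^sup>+v. indicator ?E (xi i v) \<partial>N))"
    by (rule nn_integral_jump) auto
  also have "\<dots> = 0"
  proof (rule sum.neutral, rule ballI)
    fix i
    have "AE v in N. a \<bullet> xi i v = b" using balanced by (simp add: balanced_def inner_vec_def)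
    then have "AE v in N. indicator ?E (xi i v) = (0::ennreal)" by eventually_elim simp
    from nn_integral_cong_AE[OF this]
    have "(\<integral>\<^sup>+v. indicator ?E (xi i v) \<partial>N) = 0" by simp
    then show "ennreal (\<integral>w. 1 * draw_prob n i w \<partial>M) * (\<integral>\<^sup>+v. indicator ?E (xi i v) \<partial>N) = 0" by simp
  qed
  finally have "AE w in M. indicator ?E (jump n w) = (0::ennreal)"
    by (subst (asm) nn_integral_0_iff_AE) auto
  then show ?case
    using Suc.IH
    by eventually_elim
      (auto simp: jump_def inner_diff_right activity_Suc indicator_def split: if_splits)
qed

text \<open>Tenability gives positivity almost surely; for a constant on a probability space this
  means that it holds outright.\<close>

lemma activity_pos: "0 < activity n"
proof -
  have "AE w in M. 0 < activity n"
    using AE_activity[of n] tenable[unfolded tenable_def, rule_format, of n]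
    by eventually_elim (simp add: inner_vec_def)
  then show ?thesis by simp
qed

lemma a_nonzero: "a \<noteq> 0"
  using AE_activity[of 0] activity_pos[of 0] by auto

lemma AE_drift: "AE w in M. drift n w = (\<Sum>i\<in>UNIV. draw_prob n i w *\<^sub>R xi_mean i)"
  using AE_activity[of n]
  by eventually_elim
    (simp add: drift_def B_mult draw_prob_def inner_vec_def scaleR_sum_right divide_inverse mult_ac)

text \<open>The drift is a convex combination of the \<open>xi_mean i\<close>, so it stays bounded
  although \<open>X n\<close> grows. This makes the noise moments uniform in
  \<open>n\<close>.\<close>

lemma AE_drift_le: "AE w in M. norm (drift n w) \<le> (\<Sum>i\<in>UNIV. norm (xi_mean i))"
  using AE_drift[of n] draw_prob_simplex[of n]
proof eventually_elim
  case (elim w)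
  have "norm (drift n w) \<le> (\<Sum>i\<in>UNIV. norm (draw_prob n i w *\<^sub>R xi_mean i))"
    unfolding elim(1) by (rule norm_sum)
  also have "\<dots> \<le> (\<Sum>i\<in>UNIV. norm (xi_mean i))"
    using elim(2) by (intro sum_mono) (simp add: mult_left_le_one_le)
  finally show ?case .
qed

lemma linear_B: "linear ((*v) B)"
  by (rule matrix_vector_mul_linear)

lemma drift_F [measurable]: "drift n \<in> borel_measurable (F n)"
proof -
  note [measurable] = linear_borel[OF linear_B]
  show ?thesis unfolding drift_def[abs_def] by measurable
qed

lemma drift_M [measurable]: "drift n \<in> borel_measurable M"
  by (rule F_measurable[OF drift_F])

lemma noise_M [measurable]: "noise n \<in> borel_measurable M"
  unfolding noise_def[abs_def] by measurable

lemma Y_F [measurable]: "Y n \<in> borel_measurable (F n)"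
  unfolding Y_def[abs_def] by measurable

lemma Y_M [measurable]: "Y n \<in> borel_measurable M"
  by (rule F_measurable[OF Y_F])

section \<open>Moments and orthogonality of the noise\<close>

lemma jump_moment:
  assumes W: "W \<in> borel_measurable (F n)" "integrable M W" "\<And>w. 0 \<le> W w"
  shows "integrable M (\<lambda>w. W w * norm (jump n w) ^ m)"
    and "(\<integral>w. W w * norm (jump n w) ^ m \<partial>M)
      \<le> (\<Sum>i\<in>UNIV. \<integral>v. norm (xi i v) ^ m \<partial>N) * (\<integral>w. W w \<partial>M)"
proof -
  note * = integral_jump_nonneg[OF W, of "\<lambda>x. norm x ^ m"]
  show "integrable M (\<lambda>w. W w * norm (jump n w) ^ m)"
    by (rule *(1)) (auto intro: xi_norm_power_integrable)
  have "(\<integral>w. W w * norm (jump n w) ^ m \<partial>M)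
      = (\<Sum>i\<in>UNIV. (\<integral>w. W w * draw_prob n i w \<partial>M) * (\<integral>v. norm (xi i v) ^ m \<partial>N))"
    by (rule *(2)) (auto intro: xi_norm_power_integrable)
  also have "\<dots> \<le> (\<Sum>i\<in>UNIV. (\<integral>w. W w * draw_prob n i w \<partial>M) * (\<Sum>i\<in>UNIV. \<integral>v. norm (xi i v) ^ m \<partial>N))"
    by (intro sum_mono mult_left_mono integral_draw_prob_nonneg W(3) member_le_sum
        Bochner_Integration.integral_nonneg) auto
  also have "\<dots> = (\<Sum>i\<in>UNIV. \<integral>v. norm (xi i v) ^ m \<partial>N) * (\<integral>w. W w \<partial>M)"
    by (simp add: sum_distrib_right[symmetric] sum_integral_draw_prob[OF W(2)] mult.commute)
  finally show "(\<integral>w. W w * norm (jump n w) ^ m \<partial>M)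
      \<le> (\<Sum>i\<in>UNIV. \<integral>v. norm (xi i v) ^ m \<partial>N) * (\<integral>w. W w \<partial>M)" .
qed

text \<open>A bound for the conditional moment of order \<open>m\<close> of the noise, independent
  of \<open>n\<close>; the factor \<open>2 ^ m\<close> comes from separating jump and drift by
  \<open>add_power_le\<close>.\<close>

definition noise_bound :: "nat \<Rightarrow> real" where
  "noise_bound m = 2 ^ m * ((\<Sum>i\<in>UNIV. \<integral>v. norm (xi i v) ^ m \<partial>N) + (\<Sum>i\<in>UNIV. norm (xi_mean i)) ^ m)"

lemma noise_bound_nonneg: "0 \<le> noise_bound m"
  unfolding noise_bound_def
  by (intro mult_nonneg_nonneg add_nonneg_nonneg sum_nonneg zero_le_power
      Bochner_Integration.integral_nonneg) auto

lemma noise_moment: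
  assumes W: "W \<in> borel_measurable (F n)" "integrable M W" "\<And>w. 0 \<le> W w"
  shows "integrable M (\<lambda>w. W w * norm (noise n w) ^ m)"
    and "(\<integral>w. W w * norm (noise n w) ^ m \<partial>M) \<le> noise_bound m * (\<integral>w. W w \<partial>M)"
proof -
  define c where "c = (\<Sum>i\<in>UNIV. norm (xi_mean i))"
  define d where "d = (\<Sum>i\<in>UNIV. \<integral>v. norm (xi i v) ^ m \<partial>N)"
  have c: "0 \<le> c" by (auto simp: c_def intro: sum_nonneg)
  have [measurable]: "W \<in> borel_measurable M" by (rule F_measurable[OF W(1)])
  let ?g = "\<lambda>w. 2 ^ m * (W w * norm (jump n w) ^ m + c ^ m * W w)"
  have int: "integrable M ?g"
    by (intro integrable_mult_right Bochner_Integration.integrable_add jump_moment(1) W)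
  have le: "AE w in M. W w * norm (noise n w) ^ m \<le> ?g w"
    using AE_drift_le[of n]
  proof eventually_elim
    case (elim w)
    have "norm (noise n w) ^ m \<le> (norm (jump n w) + c) ^ m"
      unfolding noise_def c_def using elim
      by (intro power_mono order_trans[OF norm_triangle_ineq4] add_left_mono) auto
    also have "\<dots> \<le> 2 ^ m * (norm (jump n w) ^ m + c ^ m)" by (intro add_power_le c) simp
    finally have "W w * norm (noise n w) ^ m \<le> W w * (2 ^ m * (norm (jump n w) ^ m + c ^ m))"
      using W(3) by (intro mult_left_mono)
    then show ?case by (simp add: algebra_simps)
  qed
  show I: "integrable M (\<lambda>w. W w * norm (noise n w) ^ m)"
  proof (rule Bochner_Integration.integrable_bound[OF int])
    show "AE w in M. norm (W w * norm (noise n w) ^ m) \<le> norm (?g w)"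
      using le by eventually_elim (use W(3) in \<open>auto intro: order_trans[OF _ abs_ge_self]\<close>)
  qed measurable
  have "(\<integral>w. W w * norm (noise n w) ^ m \<partial>M) \<le> (\<integral>w. ?g w \<partial>M)"
    by (rule integral_mono_AE[OF I int le])
  also have "\<dots> = 2 ^ m * ((\<integral>w. W w * norm (jump n w) ^ m \<partial>M) + c ^ m * (\<integral>w. W w \<partial>M))"
    using jump_moment(1)[OF W] W(2) by simp
  also have "\<dots> \<le> 2 ^ m * (d * (\<integral>w. W w \<partial>M) + c ^ m * (\<integral>w. W w \<partial>M))"
    using jump_moment(2)[OF W] by (simp add: d_def)
  finally show "(\<integral>w. W w * norm (noise n w) ^ m \<partial>M) \<le> noise_bound m * (\<integral>w. W w \<partial>M)"
    by (simp add: noise_bound_def c_def d_def algebra_simps)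
qed

text \<open>The martingale difference property in integrated form: \<open>integral_jump\<close> for
  the jump and \<open>AE_drift\<close> for the drift lead to the same combination of the values
  \<open>f (xi_mean i)\<close>.\<close>

lemma noise_orthogonal:
  fixes f :: "real^'q \<Rightarrow> real"
  assumes W: "W \<in> borel_measurable (F n)" "integrable M W" and f: "linear f"
  shows "integrable M (\<lambda>w. W w * f (noise n w))" "(\<integral>w. W w * f (noise n w) \<partial>M) = 0"
proof -
  have [measurable]: "W \<in> borel_measurable M" by (rule F_measurable[OF W(1)])
  note [measurable] = linear_borel[OF f]
  have f_noise: "f (noise n w) = f (jump n w) - f (drift n w)" for w
    unfolding noise_def by (rule linear_diff[OF f])
  have J: "integrable M (\<lambda>w. W w * f (jump n w))"
    "(\<integral>w. W w * f (jump n w) \<partial>M) = (\<Sum>i\<in>UNIV. (\<integral>w. W w * draw_prob n i w \<partial>M) * f (xi_mean i))"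
    using integral_jump[OF W linear_borel[OF f] xi_linear(1)[OF f]] by (simp_all add: xi_linear(2)[OF f])
  let ?D = "\<lambda>w. \<Sum>i\<in>UNIV. W w * draw_prob n i w * f (xi_mean i)"
  have D: "AE w in M. W w * f (drift n w) = ?D w"
    using AE_drift[of n]
    by eventually_elim (simp add: linear_sum[OF f] linear_scale[OF f] sum_distrib_left mult.assoc)
  have iD: "integrable M ?D"
    by (intro Bochner_Integration.integrable_sum integrable_mult_left integrable_mult_draw_prob W)
  have iW: "integrable M (\<lambda>w. W w * f (drift n w))"
    using iD by (subst integrable_cong_AE[OF _ _ D]) measurable
  have "(\<integral>w. W w * f (drift n w) \<partial>M) = (\<integral>w. ?D w \<partial>M)"
    by (rule integral_cong_AE[OF _ _ D]) measurable
  also have "\<dots> = (\<Sum>i\<in>UNIV. (\<integral>w. W w * draw_prob n i w \<partial>M) * f (xi_mean i))"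
    by (simp add: integrable_mult_draw_prob W)
  finally have "(\<integral>w. W w * f (drift n w) \<partial>M) = (\<integral>w. W w * f (jump n w) \<partial>M)" using J(2) by simp
  then show "(\<integral>w. W w * f (noise n w) \<partial>M) = 0"
    using J(1) iW by (simp add: f_noise right_diff_distrib)
  show "integrable M (\<lambda>w. W w * f (noise n w))"
    using J(1) iW by (simp add: f_noise right_diff_distrib)
qed

section \<open>The recursion for the centred process\<close>

lemma X_moment: "integrable M (\<lambda>w. norm (X n w) ^ m)"
proof (induction n)
  case 0
  have "AE w in M. norm (X 0 w) ^ m = norm x0 ^ m" using initial by eventually_elim simp
  then show ?case by (subst integrable_cong_AE[of _ _ "\<lambda>_. norm x0 ^ m"]) auto
next
  case (Suc n)
  have "integrable M (\<lambda>w. 1 * norm (jump n w) ^ m)" by (rule jump_moment(1)) auto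
  then have int: "integrable M (\<lambda>w. 2 ^ m * (norm (X n w) ^ m + norm (jump n w) ^ m))" using Suc by simp
  have le: "norm (X (Suc n) w) ^ m \<le> 2 ^ m * (norm (X n w) ^ m + norm (jump n w) ^ m)" for w
  proof -
    have "norm (X (Suc n) w) ^ m \<le> (norm (X n w) + norm (jump n w)) ^ m"
      using norm_triangle_ineq[of "X n w" "jump n w"] by (intro power_mono) (auto simp: jump_def)
    also have "\<dots> \<le> 2 ^ m * (norm (X n w) ^ m + norm (jump n w) ^ m)" by (rule add_power_le) auto
    finally show ?thesis .
  qed
  show ?case
    by (rule integrable_of_le[OF int _ _ le]) auto
qed

lemma X_integrable: "integrable M (X n)"
  using X_moment[of n 1] by (simp add: integrable_norm_iff)

lemma Y_moment: "integrable M (\<lambda>w. norm (Y n w) ^ m)"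
proof (rule Bochner_Integration.integrable_bound)
  let ?c = "norm (\<integral>w. X n w \<partial>M)"
  show "integrable M (\<lambda>w. 2 ^ m * (norm (X n w) ^ m + ?c ^ m))" using X_moment by simp
  have "norm (Y n w) ^ m \<le> 2 ^ m * (norm (X n w) ^ m + ?c ^ m)" for w
    unfolding Y_def
    by (intro order_trans[OF power_mono[OF norm_triangle_ineq4] add_power_le]) auto
  then show "AE w in M. norm (norm (Y n w) ^ m) \<le> norm (2 ^ m * (norm (X n w) ^ m + ?c ^ m))"
    by (intro AE_I2) (auto intro: order_trans[OF _ abs_ge_self])
qed measurable

lemma linear_Y_moment:
  fixes f :: "real^'q \<Rightarrow> 'c::euclidean_space"
  assumes f: "linear f" shows "integrable M (\<lambda>w. norm (f (Y n w)) ^ m)"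
proof -
  note [measurable] = linear_borel[OF f]
  obtain c where c: "0 < c" "\<And>x. norm (f x) \<le> c * norm x" using linear_bounded_pos[OF f] by blast
  have int: "integrable M (\<lambda>w. c ^ m * norm (Y n w) ^ m)" using Y_moment by simp
  have le: "norm (f (Y n w)) ^ m \<le> c ^ m * norm (Y n w) ^ m" for w
    unfolding power_mult_distrib[symmetric] by (intro power_mono c) simp
  show ?thesis
    by (rule integrable_of_le[OF int _ _ le]) auto
qed

text \<open>The noise has mean zero and the drift is linear in \<open>X n\<close>, so the mean obeys
  the same recursion as the process. Subtracting it leaves no inhomogeneous term in
  \<open>Y_Suc\<close>.\<close>

lemma X_mean_Suc:
  "(\<integral>w. X (Suc n) w \<partial>M) = (\<integral>w. X n w \<partial>M) + (1 / activity n) *\<^sub>R (B *v (\<integral>w. X n w \<partial>M))"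
proof -
  have int_noise: "integrable M (noise n)" "(\<integral>w. noise n w \<partial>M) = 0"
  proof -
    have "integrable M (\<lambda>w. 1 * norm (noise n w) ^ 1)" by (rule noise_moment(1)) auto
    then show int: "integrable M (noise n)" by (simp add: integrable_norm_iff)
    show "(\<integral>w. noise n w \<partial>M) = 0"
    proof (rule vector_eq_ldot[THEN iffD1], rule allI)
      fix u :: "real^'q"
      have lin: "linear (\<lambda>x. u \<bullet> x)" by (intro linearI) (auto simp: inner_right_distrib)
      have "(\<integral>w. 1 * (u \<bullet> noise n w) \<partial>M) = 0"
        by (rule noise_orthogonal(2)[OF _ _ lin]) simp_all
      then have "(\<integral>w. u \<bullet> noise n w \<partial>M) = 0" by simp
      then show "u \<bullet> (\<integral>w. noise n w \<partial>M) = u \<bullet> 0" using int by simp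
    qed
  qed
  have bl: "bounded_linear (\<lambda>x. (1 / activity n) *\<^sub>R (B *v x))"
    by (intro bounded_linear_compose[OF bounded_linear_scaleR_right]
        matrix_vector_mul_bounded_linear)
  have d: "integrable M (drift n)" "(\<integral>w. drift n w \<partial>M) = (1 / activity n) *\<^sub>R (B *v (\<integral>w. X n w \<partial>M))"
    unfolding drift_def[abs_def]
    by (rule integrable_bounded_linear[OF bl X_integrable], rule integral_bounded_linear[OF bl X_integrable])
  have "X (Suc n) w = X n w + drift n w + noise n w" for w by (simp add: noise_def jump_def)
  then show ?thesis using int_noise d X_integrable by simp
qed

lemma Y_Suc: "Y (Suc n) w = Y n w + (1 / activity n) *\<^sub>R (B *v Y n w) + noise n w"
  unfolding Y_def X_mean_Suc noise_def jump_def drift_def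
  by (simp add: matrix_vector_mult_diff_distrib scaleR_diff_right)

lemma AE_a_Y: "AE w in M. a \<bullet> Y n w = 0"
proof -
  have "a \<bullet> (\<integral>w. X n w \<partial>M) = (\<integral>w. a \<bullet> X n w \<partial>M)" using X_integrable by simp
  also have "\<dots> = (\<integral>w. activity n \<partial>M)" by (rule integral_cong_AE) (use AE_activity in auto)
  also have "\<dots> = activity n" by (simp add: M.prob_space)
  finally have mean: "a \<bullet> (\<integral>w. X n w \<partial>M) = activity n" .
  show ?thesis using AE_activity[of n] by eventually_elim (simp add: Y_def inner_diff_right mean)
qed

section \<open>Recursive moment bounds\<close>

text \<open>For variances this is orthogonality. For higher orders the remainder of
  \<open>norm_add_power_le\<close> contributes at most a constant times
  \<open>(w ^ 2) ^ k + 1\<close>, by \<open>noise_moment\<close> and \<open>lower_moment_le\<close>,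
  and \<open>power_add_const_ge\<close> converts this into an additive constant on
  \<open>w ^ 2\<close>. That \<open>c\<close> does not depend on \<open>n\<close>, \<open>W\<close>
  or \<open>w\<close> is what makes the recursion close.\<close>

lemma noise_step:
  fixes U :: "real^'q \<Rightarrow> complex"
  assumes U: "linear U"
  obtains c where "0 \<le> c"
    and "\<And>n W w. W \<in> borel_measurable (F n) \<Longrightarrow> (\<And>j. integrable M (\<lambda>x. norm (W x) ^ j)) \<Longrightarrow> 0 \<le> w \<Longrightarrow>
      (\<integral>x. norm (W x) ^ (2 * Suc k) \<partial>M) \<le> w ^ (2 * Suc k) \<Longrightarrow>
      (\<integral>x. norm (W x + U (noise n x)) ^ (2 * Suc k) \<partial>M) \<le> (w\<^sup>2 + c) ^ Suc k"
proof -
  obtain C0 where C0: "0 \<le> C0" and ineq: "\<And>z e :: complex. norm (z + e) ^ (2 * Suc k) \<le>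
     norm z ^ (2 * Suc k) + 2 * real (Suc k) * norm z ^ (2 * k) * (z \<bullet> e)
     + C0 * (norm z ^ (2 * k) * (norm e)\<^sup>2 + norm e ^ (2 * Suc k))"
    using norm_add_power_le[of k, where 'a = complex] by blast
  obtain u where u: "0 < u" "\<And>x. norm (U x) \<le> u * norm x" using linear_bounded_pos[OF U] by blast
  \<comment> \<open>The two products are the costs of the quadratic term, weighted by a power of
    \<open>W\<close>, and of the pure noise term. The maximum with 1 and the later doubling fit
    \<open>power_add_const_ge\<close>.\<close>
  define c1 where "c1 = max 1 (C0 * (u ^ 2 * noise_bound 2 + u ^ (2 * Suc k) * noise_bound (2 * Suc k)))"
  note [measurable] = linear_borel[OF U]
  have c1: "1 \<le> c1" by (simp add: c1_def)
  show thesis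
  proof (rule that[of "2 * c1"])
    show "0 \<le> 2 * c1" using c1 by simp
    fix n and W :: "'w \<Rightarrow> complex" and w :: real
    assume WF: "W \<in> borel_measurable (F n)" and Wi: "\<And>j. integrable M (\<lambda>x. norm (W x) ^ j)"
      and w: "0 \<le> w" and le: "(\<integral>x. norm (W x) ^ (2 * Suc k) \<partial>M) \<le> w ^ (2 * Suc k)"
    note [measurable] = WF F_measurable[OF WF]
    let ?V = "\<lambda>x. norm (W x) ^ (2 * k)"
    have V: "?V \<in> borel_measurable (F n)" "integrable M ?V" "\<And>x. 0 \<le> ?V x" using Wi by auto
    have lin: "linear (\<lambda>x. Re (U x))" "linear (\<lambda>x. Im (U x))"
      using linear_compose[OF U] bounded_linear.linear[OF bounded_linear_Re]
        bounded_linear.linear[OF bounded_linear_Im] by (auto simp: o_def)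
    have VRe: "integrable M (\<lambda>x. ?V x * Re (W x))" and VIm: "integrable M (\<lambda>x. ?V x * Im (W x))"
    proof -
      have "norm (?V x * Re (W x)) \<le> norm (W x) ^ (2 * k + 1)"
        "norm (?V x * Im (W x)) \<le> norm (W x) ^ (2 * k + 1)" for x
        using abs_Re_le_cmod[of "W x"] abs_Im_le_cmod[of "W x"]
        by (simp_all add: abs_mult mult.commute mult_right_mono)
      then show "integrable M (\<lambda>x. ?V x * Re (W x))" "integrable M (\<lambda>x. ?V x * Im (W x))"
        by (auto intro!: Bochner_Integration.integrable_bound[OF Wi[of "2 * k + 1"]])
    qed
    \<comment> \<open>\<open>noise_orthogonal\<close> concerns real functionals, so the inner
      product on the complex plane is split into real and imaginary parts.\<close>
    have inner: "?V x * (W x \<bullet> U (noise n x)) =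
        ?V x * Re (W x) * Re (U (noise n x)) + ?V x * Im (W x) * Im (U (noise n x))" for x
      by (simp add: inner_complex_def algebra_simps)
    \<comment> \<open>The term of first order in the noise has mean zero, so only terms of order at least two remain.\<close>
    have or: "integrable M (\<lambda>x. ?V x * (W x \<bullet> U (noise n x)))" "(\<integral>x. ?V x * (W x \<bullet> U (noise n x)) \<partial>M) = 0"
      unfolding inner
      using noise_orthogonal[OF _ VRe lin(1), of n] noise_orthogonal[OF _ VIm lin(2), of n] by auto
    \<comment> \<open>The explicit factor 1 makes the second summand an instance of
      \<open>noise_moment\<close> with constant weight.\<close>
    let ?G = "\<lambda>x. u\<^sup>2 * (?V x * norm (noise n x) ^ 2) + u ^ (2 * Suc k) * (1 * norm (noise n x) ^ (2 * Suc k))"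
    let ?H = "\<lambda>x. norm (W x) ^ (2 * Suc k) + 2 * real (Suc k) * (?V x * (W x \<bullet> U (noise n x))) + C0 * ?G x"
    have one: "(\<lambda>_. 1) \<in> borel_measurable (F n)" "integrable M (\<lambda>_. 1::real)" by auto
    have i1: "integrable M (\<lambda>x. ?V x * norm (noise n x) ^ 2)" by (rule noise_moment(1)[OF V])
    have i2: "integrable M (\<lambda>x. 1 * norm (noise n x) ^ (2 * Suc k))" by (rule noise_moment(1)[OF one]) simp
    have iG: "integrable M ?G"
      by (intro Bochner_Integration.integrable_add integrable_mult_right i1 i2)
    have iH: "integrable M ?H"
      by (intro Bochner_Integration.integrable_add integrable_mult_right iG or Wi)
    have pt: "norm (W x + U (noise n x)) ^ (2 * Suc k) \<le> ?H x" for x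
    proof -
      have U2: "norm (U (noise n x)) ^ j \<le> u ^ j * norm (noise n x) ^ j" for j
        unfolding power_mult_distrib[symmetric] by (intro power_mono u) simp
      have "?V x * (norm (U (noise n x)))\<^sup>2 + norm (U (noise n x)) ^ (2 * Suc k) \<le>
          ?V x * (u ^ 2 * norm (noise n x) ^ 2) + u ^ (2 * Suc k) * norm (noise n x) ^ (2 * Suc k)"
        by (intro add_mono mult_left_mono U2) auto
      also have "\<dots> = ?G x" by (simp add: mult.left_commute)
      finally have "C0 * (?V x * (norm (U (noise n x)))\<^sup>2 + norm (U (noise n x)) ^ (2 * Suc k)) \<le> C0 * ?G x"
        using C0 by (rule mult_left_mono)
      then show ?thesis using ineq[of "W x" "U (noise n x)"] by (simp only: mult.assoc)
    qed
    have iL: "integrable M (\<lambda>x. norm (W x + U (noise n x)) ^ (2 * Suc k))"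
      by (rule integrable_of_le[OF iH _ _ pt]) auto
    \<comment> \<open>\<open>lower_moment_le\<close> is applied to the squared norm, so that one
      step from \<open>Suc k\<close> down to \<open>k\<close> lowers the exponent by two.\<close>
    have low: "(\<integral>x. ?V x \<partial>M) \<le> (w\<^sup>2) ^ k"
      using M.lower_moment_le[of "\<lambda>x. (norm (W x))\<^sup>2" k "w\<^sup>2"] Wi le
      by (simp only: power_mult[symmetric]) simp
    have "(\<integral>x. norm (W x + U (noise n x)) ^ (2 * Suc k) \<partial>M) \<le> (\<integral>x. ?H x \<partial>M)"
      by (rule integral_mono[OF iL iH pt])
    also have "\<dots> = (\<integral>x. norm (W x) ^ (2 * Suc k) \<partial>M) + C0 * (\<integral>x. ?G x \<partial>M)"
      using iG or Wi by (simp del: power_Suc mult_Suc_right)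
    also have "(\<integral>x. ?G x \<partial>M) = u\<^sup>2 * (\<integral>x. ?V x * norm (noise n x) ^ 2 \<partial>M)
        + u ^ (2 * Suc k) * (\<integral>x. 1 * norm (noise n x) ^ (2 * Suc k) \<partial>M)"
      by (simp only: Bochner_Integration.integral_add[OF integrable_mult_right[OF i1] integrable_mult_right[OF i2]]
          integral_mult_right_zero)
    also have "\<dots> \<le> u\<^sup>2 * (noise_bound 2 * (\<integral>x. ?V x \<partial>M)) + u ^ (2 * Suc k) * (noise_bound (2 * Suc k) * (\<integral>x. 1 \<partial>M))"
      using u by (intro add_mono mult_left_mono noise_moment(2)[OF V] noise_moment(2)[OF one]) auto
    also have "\<dots> \<le> (u\<^sup>2 * noise_bound 2 + u ^ (2 * Suc k) * noise_bound (2 * Suc k)) * ((w\<^sup>2) ^ k + 1)"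
    proof -
      have "(\<integral>x. ?V x \<partial>M) \<le> (w\<^sup>2) ^ k + 1" "(\<integral>x. (1::real) \<partial>M) \<le> (w\<^sup>2) ^ k + 1"
        using low by (auto simp: M.prob_space)
      then have "u\<^sup>2 * (noise_bound 2 * (\<integral>x. ?V x \<partial>M)) + u ^ (2 * Suc k) * (noise_bound (2 * Suc k) * (\<integral>x. 1 \<partial>M))
        \<le> u\<^sup>2 * (noise_bound 2 * ((w\<^sup>2) ^ k + 1)) + u ^ (2 * Suc k) * (noise_bound (2 * Suc k) * ((w\<^sup>2) ^ k + 1))"
        using u noise_bound_nonneg by (intro add_mono mult_left_mono) auto
      then show ?thesis by (simp only: distrib_right mult.assoc)
    qed
    finally have "(\<integral>x. norm (W x + U (noise n x)) ^ (2 * Suc k) \<partial>M) \<le> w ^ (2 * Suc k)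
       + C0 * ((u\<^sup>2 * noise_bound 2 + u ^ (2 * Suc k) * noise_bound (2 * Suc k)) * ((w\<^sup>2) ^ k + 1))"
      using le C0 by (simp add: mult_left_mono del: power_Suc mult_Suc_right)
    also have "\<dots> \<le> w ^ (2 * Suc k) + c1 * ((w\<^sup>2) ^ k + 1)"
      unfolding mult.assoc[symmetric] by (intro add_left_mono mult_right_mono) (auto simp: c1_def mult.assoc)
    also have "\<dots> = (w\<^sup>2) ^ Suc k + c1 * (w\<^sup>2) ^ k + c1"
      by (simp only: power_mult distrib_left mult_1_right add.assoc)
    also have "\<dots> \<le> (w\<^sup>2 + 2 * c1) ^ Suc k" by (rule power_add_const_ge[OF _ c1]) simp
    finally show "(\<integral>x. norm (W x + U (noise n x)) ^ (2 * Suc k) \<partial>M) \<le> (w\<^sup>2 + 2 * c1) ^ Suc k" .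
  qed
qed

text \<open>\<open>U (Y n)\<close> is of order \<open>sqrt (g n)\<close> in every even
  \<open>L^p\<close> norm, with a constant depending on the exponent. The bound is only eventual,
  since the recursion needs large times; writing it as a power of \<open>K * g n\<close> matches the
  squared norms in \<open>noise_step\<close>.\<close>

definition moment_order :: "(real^'q \<Rightarrow> complex) \<Rightarrow> (nat \<Rightarrow> real) \<Rightarrow> bool" where
  "moment_order U g \<longleftrightarrow> (\<forall>k. \<exists>K>0. \<forall>\<^sub>F n in sequentially.
     (\<integral>w. norm (U (Y n w)) ^ (2 * Suc k) \<partial>M) \<le> (K * g n) ^ Suc k)"

text \<open>Induction on \<open>n\<close> with a fixed \<open>K\<close>: Minkowski combines the
  predictable terms \<open>p\<close> and \<open>q\<close>, \<open>noise_step\<close> adds the noise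
  to the square, and the hypothesis \<open>drift\<close> restores the bound with the same
  \<open>K\<close>.\<close>

lemma moment_order_recursion:
  fixes U U' :: "real^'q \<Rightarrow> complex" and l :: complex
  assumes U: "linear U" and U': "linear U'" and rec: "\<And>x. U (B *v x) = l * U x + U' x"
    and h: "moment_order U' h" "\<forall>\<^sub>F n in sequentially. 0 \<le> h n"
    and g: "\<forall>\<^sub>F n in sequentially. 0 < g n"
    and drift: "\<And>C D. 0 \<le> C \<Longrightarrow> 0 \<le> D \<Longrightarrow> \<exists>K0 n0. \<forall>K\<ge>K0. \<forall>n\<ge>n0.
      (norm (1 + l / of_real (activity n)) * sqrt (K * g n) + sqrt (C * h n) / activity n)\<^sup>2 + D
        \<le> K * g (Suc n)"
  shows "moment_order U g"
  unfolding moment_order_def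
proof
  fix k
  from h(1) obtain C where C: "0 < C" and
    C': "\<forall>\<^sub>F n in sequentially. (\<integral>w. norm (U' (Y n w)) ^ (2 * Suc k) \<partial>M) \<le> (C * h n) ^ Suc k"
    unfolding moment_order_def by blast
  obtain c where c: "0 \<le> c" and step: "\<And>n W w. W \<in> borel_measurable (F n) \<Longrightarrow>
      (\<And>j. integrable M (\<lambda>x. norm (W x) ^ j)) \<Longrightarrow> 0 \<le> w \<Longrightarrow>
      (\<integral>x. norm (W x) ^ (2 * Suc k) \<partial>M) \<le> w ^ (2 * Suc k) \<Longrightarrow>
      (\<integral>x. norm (W x + U (noise n x)) ^ (2 * Suc k) \<partial>M) \<le> (w\<^sup>2 + c) ^ Suc k"
    using noise_step[OF U, of k] by blast
  obtain K0 n0 where K0: "\<And>K n. K0 \<le> K \<Longrightarrow> n0 \<le> n \<Longrightarrow>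
      (norm (1 + l / of_real (activity n)) * sqrt (K * g n) + sqrt (C * h n) / activity n)\<^sup>2 + c
        \<le> K * g (Suc n)"
    using drift[OF less_imp_le[OF C] c] by blast
  from eventually_conj[OF C' eventually_conj[OF h(2) g]]
  obtain n1 where n1: "\<And>n. n1 \<le> n \<Longrightarrow>
      (\<integral>w. norm (U' (Y n w)) ^ (2 * Suc k) \<partial>M) \<le> (C * h n) ^ Suc k \<and> 0 \<le> h n \<and> 0 < g n"
    unfolding eventually_sequentially by blast
  define N where "N = max n0 n1"
  define E where "E n = (\<integral>w. norm (U (Y n w)) ^ (2 * Suc k) \<partial>M)" for n
  have E0: "0 \<le> E n" for n unfolding E_def by (rule Bochner_Integration.integral_nonneg) simp
  \<comment> \<open>\<open>K0\<close> is required by \<open>drift\<close>, and 1 makes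
    \<open>K * g n\<close> nonnegative. The last entry gives \<open>K * g N \<ge> 1 + E N\<close>;
    as this is at least 1, taking the power \<open>Suc k\<close> does not decrease it, which starts
    the induction.\<close>
  define K where "K = max (max K0 1) ((1 + E N) / g N)"
  have K: "K0 \<le> K" "1 \<le> K" "(1 + E N) / g N \<le> K" by (auto simp: K_def)
  note [measurable] = linear_borel[OF U] linear_borel[OF U']
  have "E n \<le> (K * g n) ^ Suc k" if "N \<le> n" for n
    using that
  proof (induction n rule: nat_induct_at_least)
    case base
    have "1 + E N \<le> K * g N" using K(3) n1[of N] by (simp add: N_def divide_le_eq)
    moreover then have "K * g N \<le> (K * g N) ^ Suc k" using E0[of N] by (intro self_le_power) auto
    ultimately show ?case by linarith
  next
    case (Suc n)
    let ?s = "activity n"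
    have s: "0 < ?s" by (rule activity_pos)
    have n: "n0 \<le> n" "n1 \<le> n" using Suc by (auto simp: N_def)
    define p where "p w = (1 + l / of_real ?s) * U (Y n w)" for w
    define q where "q w = U' (Y n w) / of_real ?s" for w
    define \<alpha> where "\<alpha> = norm (1 + l / of_real ?s) * sqrt (K * g n)"
    define \<beta> where "\<beta> = sqrt (C * h n) / ?s"
    have [measurable]: "p \<in> borel_measurable (F n)" "q \<in> borel_measurable (F n)"
      "p \<in> borel_measurable M" "q \<in> borel_measurable M"
      unfolding p_def q_def by measurable
    have ip: "integrable M (\<lambda>w. norm (p w) ^ j)" and iq: "integrable M (\<lambda>w. norm (q w) ^ j)" for j
      using linear_Y_moment[OF U] linear_Y_moment[OF U']
      by (simp_all add: p_def q_def norm_mult norm_divide power_mult_distrib power_divide)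
    have Kg: "0 \<le> K * g n" and Ch: "0 \<le> C * h n" using K n1[OF n(2)] C by auto
    have ab: "0 \<le> \<alpha>" "0 \<le> \<beta>" using Kg Ch s by (auto simp: \<alpha>_def \<beta>_def)
    have "(\<integral>w. norm (p w) ^ (2 * Suc k) \<partial>M) = norm (1 + l / of_real ?s) ^ (2 * Suc k) * E n"
      by (simp add: p_def norm_mult power_mult_distrib E_def del: power_Suc mult_Suc_right)
    also have "\<dots> \<le> norm (1 + l / of_real ?s) ^ (2 * Suc k) * (K * g n) ^ Suc k"
      using Suc by (intro mult_left_mono) auto
    also have "\<dots> = \<alpha> ^ (2 * Suc k)"
      unfolding \<alpha>_def power_mult_distrib[of "norm (1 + l / of_real ?s)"] sqrt_power_even[OF Kg] ..
    finally have p: "(\<integral>w. norm (p w) ^ (2 * Suc k) \<partial>M) \<le> \<alpha> ^ (2 * Suc k)" .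
    have "(\<integral>w. norm (q w) ^ (2 * Suc k) \<partial>M) = (\<integral>w. norm (U' (Y n w)) ^ (2 * Suc k) \<partial>M) / ?s ^ (2 * Suc k)"
      using s by (simp add: q_def norm_divide power_divide del: power_Suc mult_Suc_right)
    also have "\<dots> \<le> (C * h n) ^ Suc k / ?s ^ (2 * Suc k)"
      using n1[OF n(2)] s by (intro divide_right_mono) auto
    also have "\<dots> = \<beta> ^ (2 * Suc k)"
      unfolding \<beta>_def power_divide by (simp only: sqrt_power_even[OF Ch])
    finally have q: "(\<integral>w. norm (q w) ^ (2 * Suc k) \<partial>M) \<le> \<beta> ^ (2 * Suc k)" .
    have pq: "(\<integral>w. norm (p w + q w) ^ (2 * Suc k) \<partial>M) \<le> (\<alpha> + \<beta>) ^ (2 * Suc k)"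
      by (rule Minkowski_le[OF _ _ ip p iq q ab]) measurable
    have ipq: "integrable M (\<lambda>w. norm (p w + q w) ^ j)" for j
    proof (rule integrable_of_le)
      show "integrable M (\<lambda>w. 2 ^ j * (norm (p w) ^ j + norm (q w) ^ j))" using ip iq by simp
      show "norm (p w + q w) ^ j \<le> 2 ^ j * (norm (p w) ^ j + norm (q w) ^ j)" for w
        by (rule order_trans[OF power_mono[OF norm_triangle_ineq] add_power_le]) auto
    qed auto
    have "U (Y (Suc n) w) = p w + q w + U (noise n w)" for w
      unfolding Y_Suc p_def q_def using s
      by (simp add: linear_add[OF U] linear_scale[OF U] rec scaleR_conv_of_real[where 'a = complex] field_simps)
    then have "E (Suc n) = (\<integral>w. norm (p w + q w + U (noise n w)) ^ (2 * Suc k) \<partial>M)"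
      by (simp add: E_def)
    also have "\<dots> \<le> ((\<alpha> + \<beta>)\<^sup>2 + c) ^ Suc k"
      using ab by (intro step ipq pq) auto
    also have "\<dots> \<le> (K * g (Suc n)) ^ Suc k"
      using K0[OF K(1) n(1)] c by (intro power_mono) (auto simp: \<alpha>_def \<beta>_def)
    finally show ?case .
  qed
  then show "\<exists>K>0. \<forall>\<^sub>F n in sequentially. (\<integral>w. norm (U (Y n w)) ^ (2 * Suc k) \<partial>M) \<le> (K * g n) ^ Suc k"
    using K unfolding eventually_sequentially E_def by (intro exI[of _ K] conjI exI[of _ N]) auto
qed

lemma moment_order_mono:
  assumes "moment_order U g" "0 < c" "\<forall>\<^sub>F n in sequentially. 0 \<le> g n \<and> g n \<le> c * g' n"
  shows "moment_order U g'"
  unfolding moment_order_def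
proof
  fix k
  from assms(1) obtain K where K: "0 < K" and
    ev: "\<forall>\<^sub>F n in sequentially. (\<integral>w. norm (U (Y n w)) ^ (2 * Suc k) \<partial>M) \<le> (K * g n) ^ Suc k"
    unfolding moment_order_def by blast
  have "\<forall>\<^sub>F n in sequentially. (\<integral>w. norm (U (Y n w)) ^ (2 * Suc k) \<partial>M) \<le> (K * c * g' n) ^ Suc k"
    using ev assms(3)
  proof eventually_elim
    case (elim n)
    have "(K * g n) ^ Suc k \<le> (K * c * g' n) ^ Suc k"
      using elim(2) K by (intro power_mono) (auto simp: mult.assoc)
    then show ?case using elim(1) by simp
  qed
  then show "\<exists>K>0. \<forall>\<^sub>F n in sequentially. (\<integral>w. norm (U (Y n w)) ^ (2 * Suc k) \<partial>M) \<le> (K * g' n) ^ Suc k"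
    using K assms(2) by (intro exI[of _ "K * c"]) auto
qed

text \<open>Used both for the zero functional that closes each chain and for the functional
  proportional to \<open>a\<close>.\<close>

lemma moment_order_vanish:
  assumes "\<And>n. AE w in M. U (Y n w) = 0" "\<forall>\<^sub>F n in sequentially. 0 \<le> g n"
  shows "moment_order U g"
  unfolding moment_order_def
proof (intro allI exI[of _ 1] conjI)
  fix k
  have "(\<integral>w. norm (U (Y n w)) ^ (2 * Suc k) \<partial>M) = 0" for n
  proof (rule integral_eq_zero_AE)
    show "AE w in M. norm (U (Y n w)) ^ (2 * Suc k) = 0"
      using assms(1)[of n] by eventually_elim simp
  qed
  then show "\<forall>\<^sub>F n in sequentially. (\<integral>w. norm (U (Y n w)) ^ (2 * Suc k) \<partial>M) \<le> (1 * g n) ^ Suc k"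
    using assms(2) by (auto elim!: eventually_mono)
qed simp

section \<open>Rescaled time\<close>

definition time :: "nat \<Rightarrow> real" where "time n = activity n / b"

lemma time_Suc: "time (Suc n) = time n + 1"
  using b_pos by (simp add: time_def activity_Suc add_divide_distrib)

lemma time_eq: "time n = time 0 + real n"
  using b_pos by (simp add: time_def activity_def add_divide_distrib)

lemma time_pos: "0 < time n"
  using activity_pos b_pos by (simp add: time_def)

lemma eventually_time_ge: "\<forall>\<^sub>F n in sequentially. t0 \<le> time n"
proof -
  have "filterlim (\<lambda>n. time 0 + real n) at_top sequentially"
    by (intro filterlim_tendsto_add_at_top[OF tendsto_const] filterlim_real_sequentially)
  then show ?thesis by (subst time_eq) (simp add: filterlim_at_top)
qed

text \<open>In this time each step has length 1 and \<open>l / activity n\<close> becomes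
  \<open>(l / b) / time n\<close>, as the scalar drift lemmas expect. Positivity of \<open>g\<close>
  is asked only for \<open>t > 1\<close>, because \<open>ln 1 = 0\<close> in the critical
  case.\<close>

lemma moment_order_time:
  fixes U U' :: "real^'q \<Rightarrow> complex" and l :: complex
  assumes lin: "linear U" "linear U'" and rec: "\<And>x. U (B *v x) = l * U x + U' x"
    and h: "moment_order U' (\<lambda>n. h (time n))" "\<And>t. 1 \<le> t \<Longrightarrow> 0 \<le> h t"
    and g: "\<And>t. 1 < t \<Longrightarrow> 0 < g t"
    and drift: "\<And>C D. 0 \<le> C \<Longrightarrow> 0 \<le> D \<Longrightarrow> \<exists>K0\<ge>1. \<exists>t0\<ge>1. \<forall>K\<ge>K0. \<forall>t\<ge>t0.
      (norm (1 + (l / of_real b) / of_real t) * sqrt (K * g t) + sqrt (C * h t) / t)\<^sup>2 + D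
        \<le> K * g (t + 1)"
  shows "moment_order U (\<lambda>n. g (time n))"
proof (rule moment_order_recursion[OF lin rec h(1)])
  show "\<forall>\<^sub>F n in sequentially. 0 \<le> h (time n)"
    using eventually_time_ge[of 1] by eventually_elim (rule h(2))
  show "\<forall>\<^sub>F n in sequentially. 0 < g (time n)"
    using eventually_time_ge[of 2] by eventually_elim (rule g, simp)
  fix C D :: real assume CD: "0 \<le> C" "0 \<le> D"
  \<comment> \<open>The next functional is divided by the activity, not by the time; the constant
    \<open>C / b\<^sup>2\<close> absorbs the ratio \<open>b\<close>.\<close>
  then obtain K0 t0 where K0: "\<And>K t. K0 \<le> K \<Longrightarrow> t0 \<le> t \<Longrightarrow>
      (norm (1 + (l / of_real b) / of_real t) * sqrt (K * g t) + sqrt (C / b\<^sup>2 * h t) / t)\<^sup>2 + D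
        \<le> K * g (t + 1)"
    using drift[of "C / b\<^sup>2" D] by auto
  obtain n0 where n0: "\<And>n. n0 \<le> n \<Longrightarrow> t0 \<le> time n"
    using eventually_time_ge[of t0] unfolding eventually_sequentially by blast
  have act: "activity n = b * time n" for n using b_pos by (simp add: time_def)
  have "(norm (1 + l / of_real (activity n)) * sqrt (K * g (time n)) + sqrt (C * h (time n)) / activity n)\<^sup>2 + D
        \<le> K * g (time (Suc n))" if "K0 \<le> K" "n0 \<le> n" for K n
  proof -
    have "sqrt (C / b\<^sup>2 * h (time n)) / time n = sqrt (C * h (time n)) / activity n"
      using b_pos by (simp add: act real_sqrt_divide)
    then show ?thesis using K0[OF that(1) n0[OF that(2)]] by (simp add: act time_Suc)
  qed
  then show "\<exists>K0 n0. \<forall>K\<ge>K0. \<forall>n\<ge>n0. (norm (1 + l / of_real (activity n)) * sqrt (K * g (time n))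
      + sqrt (C * h (time n)) / activity n)\<^sup>2 + D \<le> K * g (time (Suc n))" by blast
qed

lemma moment_order_norm:
  fixes U :: "nat \<Rightarrow> real^'q \<Rightarrow> complex" and d :: nat
  assumes U: "\<And>i. linear (U i)" and ord: "\<And>i. i < d \<Longrightarrow> moment_order (U i) g"
    and C: "\<And>x. norm x \<le> C * (\<Sum>i<d. norm (U i x))"
  shows "\<exists>K. \<forall>\<^sub>F n in sequentially. (\<integral>w. norm (Y n w) ^ (2 * Suc k) \<partial>M) \<le> K * g n ^ Suc k"
proof -
  let ?p = "2 * Suc k"
  have "\<forall>i\<in>{..<d}. \<exists>K>0. \<forall>\<^sub>F n in sequentially. (\<integral>w. norm (U i (Y n w)) ^ ?p \<partial>M) \<le> (K * g n) ^ Suc k"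
    using ord by (auto simp: moment_order_def)
  then obtain K where K: "\<And>i. i < d \<Longrightarrow> \<forall>\<^sub>F n in sequentially. (\<integral>w. norm (U i (Y n w)) ^ ?p \<partial>M) \<le> (K i * g n) ^ Suc k"
    by (subst (asm) bchoice_iff) auto
  \<comment> \<open>The sign of \<open>C\<close> is unknown, hence the absolute value.\<close>
  let ?c = "\<bar>C\<bar> ^ ?p * real d ^ ?p"
  have le: "norm x ^ ?p \<le> ?c * (\<Sum>i<d. norm (U i x) ^ ?p)" for x
  proof -
    have "norm x \<le> \<bar>C\<bar> * (\<Sum>i<d. norm (U i x))"
      by (rule order_trans[OF C mult_right_mono]) (auto intro: sum_nonneg)
    then have "norm x ^ ?p \<le> (\<bar>C\<bar> * (\<Sum>i<d. norm (U i x))) ^ ?p" by (rule power_mono) simp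
    also have "\<dots> = \<bar>C\<bar> ^ ?p * (\<Sum>i<d. norm (U i x)) ^ ?p" by (rule power_mult_distrib)
    also have "\<dots> \<le> \<bar>C\<bar> ^ ?p * (real d ^ ?p * (\<Sum>i<d. norm (U i x) ^ ?p))"
      using sum_power_le[of "{..<d}" "\<lambda>i. norm (U i x)" "2 * k + 1"] by (intro mult_left_mono) auto
    finally show ?thesis by (simp only: mult.assoc)
  qed
  have int: "integrable M (\<lambda>w. norm (U i (Y n w)) ^ ?p)" for i n by (rule linear_Y_moment[OF U])
  have "\<forall>\<^sub>F n in sequentially. \<forall>i\<in>{..<d}. (\<integral>w. norm (U i (Y n w)) ^ ?p \<partial>M) \<le> (K i * g n) ^ Suc k"
    using K by (intro eventually_ball_finite) auto
  then have "\<forall>\<^sub>F n in sequentially. (\<integral>w. norm (Y n w) ^ ?p \<partial>M) \<le> (?c * (\<Sum>i<d. K i ^ Suc k)) * g n ^ Suc k"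
  proof eventually_elim
    case (elim n)
    have "(\<integral>w. norm (Y n w) ^ ?p \<partial>M) \<le> (\<integral>w. ?c * (\<Sum>i<d. norm (U i (Y n w)) ^ ?p) \<partial>M)"
      by (intro integral_mono Y_moment integrable_mult_right Bochner_Integration.integrable_sum int le)
    also have "\<dots> = ?c * (\<Sum>i<d. \<integral>w. norm (U i (Y n w)) ^ ?p \<partial>M)"
      by (simp only: integral_mult_right_zero Bochner_Integration.integral_sum[OF int])
    also have "\<dots> \<le> ?c * (\<Sum>i<d. (K i * g n) ^ Suc k)"
      using elim by (intro mult_left_mono sum_mono) auto
    also have "\<dots> = (?c * (\<Sum>i<d. K i ^ Suc k)) * g n ^ Suc k"
      by (simp only: power_mult_distrib sum_distrib_right[symmetric] mult.assoc)
    finally show ?case .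
  qed
  then show ?thesis by blast
qed

text \<open>Common end of both regimes: the orders of the functionals bound every even moment of the
  normalised variable, and the limit theorem for all moments applies. The covariance statement is
  its case of degree two.\<close>

lemma moments_from_clt:
  fixes U :: "nat \<Rightarrow> real^'q \<Rightarrow> complex" and d :: nat
  assumes U: "\<And>i. linear (U i)" and ord: "\<And>i. i < d \<Longrightarrow> moment_order (U i) g"
    and C: "\<And>x. norm x \<le> C * (\<Sum>i<d. norm (U i x))"
    and g: "\<forall>\<^sub>F n in sequentially. 0 < g n"
    and mu: "centred_normal S mu"
    and conv: "converges_in_distribution M (\<lambda>n w. (X n w - (\<integral>w. X n w \<partial>M)) /\<^sub>R sqrt (g n)) mu"
  shows "all_moments_converge M (\<lambda>n w. (X n w - (\<integral>w. X n w \<partial>M)) /\<^sub>R sqrt (g n)) mu \<and>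
    (\<lambda>n. cov_matrix M (X n) /\<^sub>R g n) \<longlonglongrightarrow> S"
proof -
  define Z where "Z n w = (X n w - (\<integral>w. X n w \<partial>M)) /\<^sub>R sqrt (g n)" for n w
  have ZY: "Z n w = Y n w /\<^sub>R sqrt (g n)" for n w by (simp add: Z_def Y_def)
  \<comment> \<open>For small \<open>n\<close>, \<open>g n\<close> may be 0, and then
    \<open>Z n\<close> is 0 since \<open>inverse 0 = 0\<close>. Integrability holds there too, while
    the bounds are claimed only where \<open>g n\<close> is positive.\<close>
  have nZ: "norm (Z n w) ^ m = inverse \<bar>sqrt (g n)\<bar> ^ m * norm (Y n w) ^ m" for n w m
    by (simp add: ZY power_mult_distrib)
  have [measurable]: "Z n \<in> borel_measurable M" for n unfolding ZY[abs_def] by measurable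
  have all: "all_moments_converge M Z mu"
  proof (rule all_moments_convergeI)
    show "prob_space M" by (rule M.prob_space_axioms)
    show "prob_space mu" "sets mu = sets borel" using mu by (auto simp: centred_normal_def)
    show "converges_in_distribution M Z mu" using conv by (simp add: Z_def[abs_def])
    show "Z n \<in> borel_measurable M" for n by measurable
    show "integrable M (\<lambda>w. norm (Z n w) ^ (2 * m))" for n m
      unfolding nZ by (intro integrable_mult_right Y_moment)
    show "\<exists>C. \<forall>\<^sub>F n in sequentially. (\<integral>w. norm (Z n w) ^ (2 * m) \<partial>M) \<le> C" for m
    proof (cases m)
      case 0
      then show ?thesis by (intro exI[of _ 1]) (simp add: M.prob_space)
    next
      case (Suc k)
      obtain K where K: "\<forall>\<^sub>F n in sequentially. (\<integral>w. norm (Y n w) ^ (2 * Suc k) \<partial>M) \<le> K * g n ^ Suc k"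
        using moment_order_norm[OF U ord C] by blast
      have "\<forall>\<^sub>F n in sequentially. (\<integral>w. norm (Z n w) ^ (2 * Suc k) \<partial>M) \<le> K"
        using K g
      proof eventually_elim
        case (elim n)
        have "inverse \<bar>sqrt (g n)\<bar> ^ (2 * Suc k) = inverse (g n ^ Suc k)"
          using elim(2) by (simp only: power_inverse power_even_abs[of "2 * Suc k"] sqrt_power_even
              even_mult_iff even_numeral less_imp_le simp_thms)
        then have "(\<integral>w. norm (Z n w) ^ (2 * Suc k) \<partial>M) = (\<integral>w. norm (Y n w) ^ (2 * Suc k) \<partial>M) / g n ^ Suc k"
          unfolding nZ by (simp only: integral_mult_right_zero divide_inverse mult.commute)
        also have "\<dots> \<le> K" using elim by (simp add: divide_le_eq del: power_Suc mult_Suc_right)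
        finally show ?case .
      qed
      then show ?thesis unfolding Suc by blast
    qed
  qed
  have "(\<lambda>n. cov_matrix M (X n) /\<^sub>R g n) \<longlonglongrightarrow> S"
  proof (rule Lim_transform_eventually[OF second_moments_converge[OF all mu]])
    show "\<forall>\<^sub>F n in sequentially. (\<chi> i j. \<integral>w. Z n w $ i * Z n w $ j \<partial>M) = cov_matrix M (X n) /\<^sub>R g n"
      using g
    proof eventually_elim
      case (elim n)
      have mean: "(\<integral>w. X n w $ i \<partial>M) = (\<integral>w. X n w \<partial>M) $ i" for i
        by (rule integral_bounded_linear[OF bounded_linear_vec_nth X_integrable])
      have "Z n w $ i * Z n w $ j = (X n w $ i - (\<integral>w. X n w $ i \<partial>M)) * (X n w $ j - (\<integral>w. X n w $ j \<partial>M)) / g n" for i j w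
      proof -
        have "inverse (sqrt (g n)) * inverse (sqrt (g n)) = inverse (g n)"
          using elim by (simp flip: inverse_mult_distrib)
        then show ?thesis by (simp add: Z_def mean divide_inverse mult_ac)
      qed
      then show ?case
        by (simp add: cov_matrix_def Finite_Cartesian_Product.vec_eq_iff divide_inverse mult.commute)
    qed
  qed
  with all show ?thesis by (simp add: Z_def[abs_def])
qed

section \<open>Induction along the Jordan chains\<close>

text \<open>The induction runs from the end of the chain, where the next functional is replaced by
  zero. The fixed slack absorbs a neighbour of the same order, so the position does not affect the
  growth.\<close>

lemma moment_order_subcritical:
  fixes U :: "nat \<Rightarrow> real^'q \<Rightarrow> complex" and ev :: "nat \<Rightarrow> complex" and pos :: "nat \<Rightarrow> nat"
  assumes lin: "\<And>i. linear (U i)"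
    and rec: "\<And>i x. i < d \<Longrightarrow> U i (B *v x) = ev i * U i x + (if pos i \<noteq> 0 then U (Suc i) x else 0)"
    and link: "\<And>i. i < d \<Longrightarrow> pos i \<noteq> 0 \<Longrightarrow> Suc i < d \<and> pos (Suc i) = pos i - 1 \<and> ev (Suc i) = ev i"
    and i: "i < d" "Re (ev i) < b / 2"
  shows "moment_order (U i) time"
  using i
proof (induction "pos i" arbitrary: i)
  case 0
  have "moment_order (U i) (\<lambda>n. (\<lambda>t. t) (time n))"
  proof (rule moment_order_time[of "U i" "\<lambda>_. 0" "ev i" "\<lambda>t. t" "\<lambda>t. t"])
    show "U i (B *v x) = ev i * U i x + 0" for x using rec[OF 0(2)] 0 by simp
    show "moment_order (\<lambda>_. 0) (\<lambda>n. time n)"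
      by (rule moment_order_vanish) (auto simp: time_pos less_imp_le)
    show "\<exists>K0\<ge>1. \<exists>t0\<ge>1. \<forall>K\<ge>K0. \<forall>t\<ge>t0.
      (norm (1 + (ev i / of_real b) / of_real t) * sqrt (K * t) + sqrt (C * t) / t)\<^sup>2 + D
        \<le> K * (t + 1)" if "0 \<le> C" "0 \<le> D" for C D
      using that 0(3) b_pos by (intro drift_subcritical) (auto simp: field_simps)
  qed (auto simp: lin intro: linear_zero)
  then show ?case by simp
next
  case (Suc l)
  then have "pos i \<noteq> 0" by simp
  note link = link[OF Suc.prems(1) this]
  have "moment_order (U i) (\<lambda>n. (\<lambda>t. t) (time n))"
  proof (rule moment_order_time[of "U i" "U (Suc i)" "ev i" "\<lambda>t. t" "\<lambda>t. t"])
    show "U i (B *v x) = ev i * U i x + U (Suc i) x" for x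
      using rec[OF Suc.prems(1)] \<open>pos i \<noteq> 0\<close> by simp
    have "moment_order (U (Suc i)) time"
      using Suc.hyps(2) Suc.prems link by (intro Suc.hyps(1)) auto
    then show "moment_order (U (Suc i)) (\<lambda>n. time n)" by simp
    show "\<exists>K0\<ge>1. \<exists>t0\<ge>1. \<forall>K\<ge>K0. \<forall>t\<ge>t0.
      (norm (1 + (ev i / of_real b) / of_real t) * sqrt (K * t) + sqrt (C * t) / t)\<^sup>2 + D
        \<le> K * (t + 1)" if "0 \<le> C" "0 \<le> D" for C D
      using that Suc.prems(2) b_pos by (intro drift_subcritical) (auto simp: field_simps)
  qed (auto simp: lin)
  then show ?case by simp
qed

text \<open>If \<open>pos i = Suc l\<close>, dividing the claimed order by the square of the
  logarithm leaves exponent \<open>2 * l + 1\<close>, exactly the order of the next functional. This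
  is the gain that \<open>drift_critical\<close> demands.\<close>

lemma moment_order_critical:
  fixes U :: "nat \<Rightarrow> real^'q \<Rightarrow> complex" and ev :: "nat \<Rightarrow> complex" and pos :: "nat \<Rightarrow> nat"
  assumes lin: "\<And>i. linear (U i)"
    and rec: "\<And>i x. i < d \<Longrightarrow> U i (B *v x) = ev i * U i x + (if pos i \<noteq> 0 then U (Suc i) x else 0)"
    and link: "\<And>i. i < d \<Longrightarrow> pos i \<noteq> 0 \<Longrightarrow> Suc i < d \<and> pos (Suc i) = pos i - 1 \<and> ev (Suc i) = ev i"
    and i: "i < d" "Re (ev i) = b / 2"
  shows "moment_order (U i) (\<lambda>n. time n * ln (time n) ^ (2 * pos i + 1))"
  using i
proof (induction "pos i" arbitrary: i)
  case 0
  define G :: "real \<Rightarrow> real" where "G t = t * ln t ^ (2 * pos i + 1)" for t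
  have "moment_order (U i) (\<lambda>n. G (time n))"
  proof (rule moment_order_time[of "U i" "\<lambda>_. 0" "ev i" "\<lambda>t. G t / (ln t)\<^sup>2"])
    show "U i (B *v x) = ev i * U i x + 0" for x using rec[OF 0(2)] 0 by simp
    show "moment_order (\<lambda>_. 0) (\<lambda>n. G (time n) / (ln (time n))\<^sup>2)"
      by (rule moment_order_vanish)
        (use eventually_time_ge[of 1] in \<open>auto simp: G_def elim!: eventually_mono\<close>)
    show "\<exists>K0\<ge>1. \<exists>t0\<ge>1. \<forall>K\<ge>K0. \<forall>t\<ge>t0.
      (norm (1 + (ev i / of_real b) / of_real t) * sqrt (K * G t) + sqrt (C * (G t / (ln t)\<^sup>2)) / t)\<^sup>2 + D
        \<le> K * G (t + 1)" if "0 \<le> C" "0 \<le> D" for C D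
      unfolding G_def using that 0(3) b_pos by (intro drift_critical) (auto simp: field_simps)
  qed (auto simp: lin G_def intro: linear_zero)
  then show ?case by (simp add: G_def)
next
  case (Suc l)
  then have "pos i \<noteq> 0" by simp
  note link = link[OF Suc.prems(1) this]
  define G :: "real \<Rightarrow> real" where "G t = t * ln t ^ (2 * pos i + 1)" for t
  have "moment_order (U i) (\<lambda>n. G (time n))"
  proof (rule moment_order_time[of "U i" "U (Suc i)" "ev i" "\<lambda>t. G t / (ln t)\<^sup>2"])
    show "U i (B *v x) = ev i * U i x + U (Suc i) x" for x
      using rec[OF Suc.prems(1)] \<open>pos i \<noteq> 0\<close> by simp
    have l: "pos (Suc i) = l" "pos i = Suc l" using Suc.hyps(2) link by auto
    have "moment_order (U (Suc i)) (\<lambda>n. time n * ln (time n) ^ (2 * pos (Suc i) + 1))"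
      using Suc.hyps(2) Suc.prems link by (intro Suc.hyps(1)) auto
    then show "moment_order (U (Suc i)) (\<lambda>n. G (time n) / (ln (time n))\<^sup>2)"
    proof (rule moment_order_mono[where c = 1])
      show "\<forall>\<^sub>F n in sequentially. 0 \<le> time n * ln (time n) ^ (2 * pos (Suc i) + 1) \<and>
          time n * ln (time n) ^ (2 * pos (Suc i) + 1) \<le> 1 * (G (time n) / (ln (time n))\<^sup>2)"
        using eventually_time_ge[of 2]
      proof eventually_elim
        case (elim n)
        then have "0 < ln (time n)" by simp
        then show ?case using elim by (simp add: G_def l power2_eq_square)
      qed
    qed simp
    show "\<exists>K0\<ge>1. \<exists>t0\<ge>1. \<forall>K\<ge>K0. \<forall>t\<ge>t0.
      (norm (1 + (ev i / of_real b) / of_real t) * sqrt (K * G t) + sqrt (C * (G t / (ln t)\<^sup>2)) / t)\<^sup>2 + D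
        \<le> K * G (t + 1)" if "0 \<le> C" "0 \<le> D" for C D
      unfolding G_def using that Suc.prems(2) b_pos by (intro drift_critical) (auto simp: field_simps)
  qed (auto simp: lin G_def)
  then show ?case by (simp add: G_def)
qed

section \<open>The two regimes\<close>

lemma moment_order_vanish_on_hyperplane:
  assumes "\<forall>x. a \<bullet> x = 0 \<longrightarrow> U x = 0" "\<forall>\<^sub>F n in sequentially. 0 \<le> g n"
  shows "moment_order U g"
proof (rule moment_order_vanish[OF _ assms(2)])
  fix n show "AE w in M. U (Y n w) = 0"
    using AE_a_Y[of n] by eventually_elim (use assms(1) in blast)
qed

lemma eventually_time_le: "\<forall>\<^sub>F n in sequentially. time n \<le> 2 * real n"
  unfolding eventually_sequentially
  by (intro exI[of _ "nat \<lceil>time 0\<rceil>"] allI impI) (subst time_eq, linarith)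

lemma moments_subcritical:
  assumes ls: "eigenvalue_listing (complex_mat_of B) ls" "ls ! 0 = of_real b" "Re (ls ! 1) < b / 2"
    and mu: "centred_normal S mu"
    and conv: "converges_in_distribution M (\<lambda>n w. (X n w - (\<integral>w. X n w \<partial>M)) /\<^sub>R sqrt (real n)) mu"
  shows "all_moments_converge M (\<lambda>n w. (X n w - (\<integral>w. X n w \<partial>M)) /\<^sub>R sqrt (real n)) mu \<and>
    (\<lambda>n. cov_matrix M (X n) /\<^sub>R real n) \<longlonglongrightarrow> S"
proof -
  have lt: "Re (ls ! 1) < b" using ls(3) b_pos by simp
  obtain U ev pos d C where lin: "\<And>i. linear (U i)"
    and rec: "\<And>i x. i < d \<Longrightarrow> U i (B *v x) = ev i * U i x + (if pos i \<noteq> 0 then U (Suc i) x else 0)"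
    and link: "\<And>i. i < d \<Longrightarrow> pos i \<noteq> 0 \<Longrightarrow> Suc i < d \<and> pos (Suc i) = pos i - 1 \<and> ev (Suc i) = ev i"
    and rows: "\<And>i. i < d \<Longrightarrow> (\<forall>x. a \<bullet> x = 0 \<longrightarrow> U i x = 0) \<or>
      Re (ev i) < Re (ls ! 1) \<or> Re (ev i) = Re (ls ! 1) \<and> pos i \<le> jordan_nu (complex_mat_of B) (ls ! 1)"
    and C: "\<And>x. norm x \<le> C * (\<Sum>i<d. norm (U i x))"
  proof (rule spectral_functionals[OF ls(1,2) lt colours a_nonzero a_B], goal_cases)
    case (1 U ev pos d C)
    show ?case by (rule 1(1)[of U d ev pos C]) (fact 1)+
  qed
  have "moment_order (U i) real" if i: "i < d" for i
    using rows[OF i]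
  proof
    assume "Re (ev i) < Re (ls ! 1) \<or> Re (ev i) = Re (ls ! 1) \<and> pos i \<le> jordan_nu (complex_mat_of B) (ls ! 1)"
    then have ev: "Re (ev i) < b / 2" using ls(3) by linarith
    have "moment_order (U i) time"
      by (rule moment_order_subcritical[of U d ev pos]) (fact lin rec link i ev)+
    then show ?thesis
      by (rule moment_order_mono[where c = 2])
        (use eventually_time_le in \<open>auto simp: time_pos less_imp_le elim!: eventually_mono\<close>)
  qed (rule moment_order_vanish_on_hyperplane, auto)
  moreover have "\<forall>\<^sub>F n in sequentially. 0 < real n" using eventually_gt_at_top[of 0] by simp
  ultimately show ?thesis by (rule moments_from_clt[OF lin _ C _ mu conv])
qed

text \<open>Positions on critical chains are at most \<nu>, so no exponent exceeds
  \<open>2 * \<nu> + 1\<close>. Functionals with smaller real part have order \<open>n\<close>,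
  which \<open>g\<close> dominates as soon as \<open>ln n \<ge> 1\<close>.\<close>

lemma moments_critical:
  fixes ls
  defines "\<nu> \<equiv> jordan_nu (complex_mat_of B) (ls ! 1)"
  assumes ls: "eigenvalue_listing (complex_mat_of B) ls" "ls ! 0 = of_real b" "Re (ls ! 1) = b / 2"
    and mu: "centred_normal S mu"
    and conv: "converges_in_distribution M (\<lambda>n w. (X n w - (\<integral>w. X n w \<partial>M))
      /\<^sub>R sqrt (real n * ln (real n) ^ (2 * \<nu> + 1))) mu"
  shows "all_moments_converge M (\<lambda>n w. (X n w - (\<integral>w. X n w \<partial>M))
      /\<^sub>R sqrt (real n * ln (real n) ^ (2 * \<nu> + 1))) mu \<and>
    (\<lambda>n. cov_matrix M (X n) /\<^sub>R (real n * ln (real n) ^ (2 * \<nu> + 1))) \<longlonglongrightarrow> S"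
proof -
  have lt: "Re (ls ! 1) < b" using ls(3) b_pos by simp
  obtain U ev pos d C where lin: "\<And>i. linear (U i)"
    and rec: "\<And>i x. i < d \<Longrightarrow> U i (B *v x) = ev i * U i x + (if pos i \<noteq> 0 then U (Suc i) x else 0)"
    and link: "\<And>i. i < d \<Longrightarrow> pos i \<noteq> 0 \<Longrightarrow> Suc i < d \<and> pos (Suc i) = pos i - 1 \<and> ev (Suc i) = ev i"
    and rows: "\<And>i. i < d \<Longrightarrow> (\<forall>x. a \<bullet> x = 0 \<longrightarrow> U i x = 0) \<or>
      Re (ev i) < Re (ls ! 1) \<or> Re (ev i) = Re (ls ! 1) \<and> pos i \<le> \<nu>"
    and C: "\<And>x. norm x \<le> C * (\<Sum>i<d. norm (U i x))"
    unfolding \<nu>_def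
  proof (rule spectral_functionals[OF ls(1,2) lt colours a_nonzero a_B], goal_cases)
    case (1 U ev pos d C)
    show ?case by (rule 1(1)[of U d ev pos C]) (fact 1)+
  qed
  define g where "g n = real n * ln (real n) ^ (2 * \<nu> + 1)" for n
  have ln_ge: "\<forall>\<^sub>F n in sequentially. 1 \<le> ln (real n)"
    by (rule filterlim_at_top[THEN iffD1, rule_format])
      (rule filterlim_compose[OF ln_at_top filterlim_real_sequentially])
  have g: "\<forall>\<^sub>F n in sequentially. 0 < g n"
    using ln_ge eventually_gt_at_top[of 0]
  proof eventually_elim
    case (elim n)
    then have "0 < ln (real n) ^ (2 * \<nu> + 1)" by (intro zero_less_power) linarith
    then show ?case using elim by (simp add: g_def del: power_Suc)
  qed
  then have g0: "\<forall>\<^sub>F n in sequentially. 0 \<le> g n" by eventually_elim simp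
  have "moment_order (U i) g" if i: "i < d" for i
    using rows[OF i]
  proof (elim disjE conjE)
    assume "Re (ev i) < Re (ls ! 1)"
    then have ev: "Re (ev i) < b / 2" using ls(3) by simp
    have "moment_order (U i) time"
      by (rule moment_order_subcritical[of U d ev pos]) (fact lin rec link i ev)+
    then show ?thesis
    proof (rule moment_order_mono[where c = 2])
      show "\<forall>\<^sub>F n in sequentially. 0 \<le> time n \<and> time n \<le> 2 * g n"
        using eventually_time_le ln_ge
      proof eventually_elim
        case (elim n)
        have "1 \<le> ln (real n) ^ (2 * \<nu> + 1)" using elim(2) by (rule one_le_power)
        then have "real n * 1 \<le> g n" unfolding g_def by (intro mult_left_mono) auto
        then show ?case using elim(1) time_pos[of n] by simp
      qed
    qed simp
  next
    assume "Re (ev i) = Re (ls ! 1)" and p: "pos i \<le> \<nu>"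
    then have ev: "Re (ev i) = b / 2" using ls(3) by simp
    have "moment_order (U i) (\<lambda>n. time n * ln (time n) ^ (2 * pos i + 1))"
      by (rule moment_order_critical[of U d ev pos]) (fact lin rec link i ev)+
    then show ?thesis
    \<comment> \<open>One factor 2 comes from \<open>time n \<le> 2 * real n\<close>. The others
      come from \<open>ln (time n) \<le> 2 * ln (real n)\<close>, which holds because
      \<open>time n\<close> is at most the square of \<open>n\<close> once
      \<open>n \<ge> 2\<close>.\<close>
    proof (rule moment_order_mono[where c = "2 * 2 ^ (2 * pos i + 1)"])
      show "\<forall>\<^sub>F n in sequentially. 0 \<le> time n * ln (time n) ^ (2 * pos i + 1) \<and>
          time n * ln (time n) ^ (2 * pos i + 1) \<le> 2 * 2 ^ (2 * pos i + 1) * g n"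
        using eventually_time_le eventually_time_ge[of 1] ln_ge eventually_ge_at_top[of 2]
      proof eventually_elim
        case (elim n)
        have "time n \<le> real n * real n"
          by (rule order_trans[OF elim(1) mult_right_mono]) (use elim(4) in auto)
        then have "ln (time n) \<le> ln (real n * real n)" using elim(2,4) by simp
        also have "\<dots> = 2 * ln (real n)" using elim(4) by (simp add: ln_mult)
        finally have ln_le: "ln (time n) \<le> 2 * ln (real n)" .
        have "time n * ln (time n) ^ (2 * pos i + 1) \<le> (2 * real n) * (2 * ln (real n)) ^ (2 * pos i + 1)"
          using elim ln_le by (intro mult_mono power_mono) auto
        also have "\<dots> = 2 * 2 ^ (2 * pos i + 1) * (real n * ln (real n) ^ (2 * pos i + 1))"
          unfolding power_mult_distrib by (simp only: mult_ac)
        also have "\<dots> \<le> 2 * 2 ^ (2 * pos i + 1) * g n"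
          unfolding g_def using elim p by (intro mult_left_mono power_increasing) auto
        finally show ?case using elim(2) by simp
      qed
    qed simp
  qed (rule moment_order_vanish_on_hyperplane[OF _ g0])
  then show ?thesis
    using moments_from_clt[OF lin _ C g mu] conv unfolding g_def by blast
qed

end

theorem theorem3p2:
  fixes M :: "'w measure" and N :: "'v measure" and F :: "nat \<Rightarrow> 'w measure"
    and a x0 :: "real^'q" and xi :: "'q \<Rightarrow> 'v \<Rightarrow> real^'q"
    and X :: "nat \<Rightarrow> 'w \<Rightarrow> real^'q" and I :: "nat \<Rightarrow> 'w \<Rightarrow> 'q"
    and b :: real and A :: "complex mat" and ls :: "complex list"
  defines "A \<equiv> complex_mat_of (intensity_matrix N a xi)"
  assumes urn: "polya_urn M N F a xi x0 X I"
    and tenable: "tenable M a X"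
    and balanced: "balanced N a xi b"
    and eigenvalues: "eigenvalue_listing A ls"
    and lambda1: "ls ! 0 = complex_of_real b"
    and moments: "\<forall>i j. \<forall>p\<ge>1. integrable N (\<lambda>v. \<bar>xi i v $ j\<bar> powr p)"
  shows "(\<forall>S mu.
      Re (ls ! 1) < Re (ls ! 0) / 2 \<longrightarrow>
      centred_normal S mu \<longrightarrow>
      converges_in_distribution M
        (\<lambda>n w. (X n w - (\<integral>w. X n w \<partial>M)) /\<^sub>R sqrt (real n)) mu \<longrightarrow>
      all_moments_converge M
        (\<lambda>n w. (X n w - (\<integral>w. X n w \<partial>M)) /\<^sub>R sqrt (real n)) mu \<and>
      (\<lambda>n. cov_matrix M (X n) /\<^sub>R real n) \<longlonglongrightarrow> S)
    \<and> (\<forall>S mu.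
      Re (ls ! 1) = Re (ls ! 0) / 2 \<longrightarrow>
      centred_normal S mu \<longrightarrow>
      converges_in_distribution M
        (\<lambda>n w. (X n w - (\<integral>w. X n w \<partial>M))
          /\<^sub>R sqrt (real n * ln (real n) ^ (2 * jordan_nu A (ls ! 1) + 1))) mu \<longrightarrow>
      all_moments_converge M
        (\<lambda>n w. (X n w - (\<integral>w. X n w \<partial>M))
          /\<^sub>R sqrt (real n * ln (real n) ^ (2 * jordan_nu A (ls ! 1) + 1))) mu \<and>
      (\<lambda>n. cov_matrix M (X n)
          /\<^sub>R (real n * ln (real n) ^ (2 * jordan_nu A (ls ! 1) + 1))) \<longlonglongrightarrow> S)"
proof -
  interpret polya_urn M N F a xi x0 X I by (rule urn)
  interpret balanced_urn M N F a xi x0 X I b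
    by unfold_locales (use tenable balanced moments in auto)
  have Re0: "Re (ls ! 0) = b" by (simp add: lambda1)
  show ?thesis
    unfolding Re0
    using moments_subcritical[OF eigenvalues[unfolded A_def] lambda1]
      moments_critical[OF eigenvalues[unfolded A_def] lambda1]
    unfolding A_def by blast
qed

end
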